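(* For each $i\ge 0$, $H_i(E_2(\mathbb{Z}[t]),\mathbb{Z})$ contains $\bigwedge_{\mathbb{Z}}^i t\mathbb{Z}[t]$ as a direct summand. Moreover, for every prime $p$ the element $t^{l_1}\wedge\cdots\wedge t^{l_i}$ of this summand maps to the element $t^{l_1}\wedge\cdots\wedge t^{l_i}$ in $\bigwedge_{\mathbb{F}_p}^i t\mathbb{F}_p[t]\subseteq H_i(E_2(\mathbb{Z}[t]),\mathbb{F}_p)$ under the map $H_i(E_2(\mathbb{Z}[t]),\mathbb{Z})\to H_i(E_2(\mathbb{Z}[t]),\mathbb{F}_p)$ induced by reducing coefficients modulo $p$.
   Context: For a commutative ring $A$, $E_2(A)$ denotes the subgroup of $GL_2(A)$ generated by the elementary matrices. $t\mathbb{Z}[t]$ is the additive group of polynomials with zero constant term. Since it is torsion-free, $H_i(t\mathbb{Z}[t],\mathbb{Z})=\bigwedge^i_{\mathbb{Z}}t\mathbb{Z}[t]$ and $H_i(t\mathbb{Z}[t],\mathbb{F}_p)=\bigwedge^i_{\mathbb{F}_p}t\mathbb{F}_p[t]$ (via the Pontryagin product). The groups $\bigwedge_{\mathbb{Z}}^i t\mathbb{Z}[t]$ and $\bigwedge_{\mathbb{F}_p}^i t\mathbb{F}_p[t]$ are regarded as subgroups of $H_i(E_2(\mathbb{Z}[t]),\mathbb{Z})$ and $H_i(E_2(\mathbb{Z}[t]),\mathbb{F}_p)$ via the map induced in homology by the homomorphism $t\mathbb{Z}[t]\to E_2(\mathbb{Z}[t])$, $f\mapsto\begin{pmatrix}1&f\\0&1\end{pmatrix}$.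 *)

theory Defs
  imports
    "HOL-Analysis.Analysis"
    "HOL-Algebra.UnivPoly"
    "HOL-Algebra.IntRing"
    "HOL-Algebra.Generated_Groups"
    "HOL-Number_Theory.Residues"
    "HOL-Computational_Algebra.Polynomial"
begin

section \<open>Free modules\<close>

text \<open>
  The ring fields \<open>mult\<close> and \<open>one\<close> of a module record play no role; here and below they are
  filled with arbitrary values.
\<close>

definition free_module :: "('r, 'x) ring_scheme \<Rightarrow> 's set \<Rightarrow> ('r, 's \<Rightarrow> 'r) module" where
  "free_module R S =
     \<lparr>carrier = {c. (\<forall>s. c s \<in> carrier R) \<and> finite {s. c s \<noteq> \<zero>\<^bsub>R\<^esub>} \<and> {s. c s \<noteq> \<zero>\<^bsub>R\<^esub>} \<subseteq> S},
      mult = (\<lambda>c d. undefined), one = undefined,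
      zero = (\<lambda>s. \<zero>\<^bsub>R\<^esub>), add = (\<lambda>c d s. c s \<oplus>\<^bsub>R\<^esub> d s),
      smult = (\<lambda>r c s. r \<otimes>\<^bsub>R\<^esub> c s)\<rparr>"

definition basis_elt :: "('r, 'x) ring_scheme \<Rightarrow> 's \<Rightarrow> 's \<Rightarrow> 'r" where
  "basis_elt R s = (\<lambda>s'. if s' = s then \<one>\<^bsub>R\<^esub> else \<zero>\<^bsub>R\<^esub>)"

definition lin_ext :: "('r, 'x) ring_scheme \<Rightarrow> ('s \<Rightarrow> 'u \<Rightarrow> 'r) \<Rightarrow> ('s \<Rightarrow> 'r) \<Rightarrow> 'u \<Rightarrow> 'r" where
  "lin_ext R f c =
     (\<Oplus>\<^bsub>free_module R UNIV\<^esub>s\<in>{s. c s \<noteq> \<zero>\<^bsub>R\<^esub>}. c s \<odot>\<^bsub>free_module R UNIV\<^esub> f s)"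

definition push :: "('r, 'x) ring_scheme \<Rightarrow> ('s \<Rightarrow> 'u) \<Rightarrow> ('s \<Rightarrow> 'r) \<Rightarrow> 'u \<Rightarrow> 'r" where
  "push R f = lin_ext R (\<lambda>s. basis_elt R (f s))"

definition tuples :: "nat \<Rightarrow> 'a set \<Rightarrow> 'a list set" where
  "tuples n A = {xs. length xs = n \<and> set xs \<subseteq> A}"

definition sign_in :: "('r, 'x) ring_scheme \<Rightarrow> nat \<Rightarrow> 'r" where
  "sign_in R k = (\<ominus>\<^bsub>R\<^esub> \<one>\<^bsub>R\<^esub>) [^]\<^bsub>R\<^esub> k"


section \<open>Exterior powers\<close>

definition exterior_relators ::
  "('r, 'x) ring_scheme \<Rightarrow> ('r, 'm, 'y) module_scheme \<Rightarrow> nat \<Rightarrow> ('m list \<Rightarrow> 'r) set" where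
  "exterior_relators R M n =
     (let F = free_module R (tuples n (carrier M)); e = basis_elt R in
        {e (xs[j := x \<oplus>\<^bsub>M\<^esub> y]) \<ominus>\<^bsub>F\<^esub> (e (xs[j := x]) \<oplus>\<^bsub>F\<^esub> e (xs[j := y])) | xs j x y.
           xs \<in> tuples n (carrier M) \<and> j < n \<and> x \<in> carrier M \<and> y \<in> carrier M}
      \<union> {e (xs[j := r \<odot>\<^bsub>M\<^esub> x]) \<ominus>\<^bsub>F\<^esub> (r \<odot>\<^bsub>F\<^esub> e (xs[j := x])) | xs j r x.
           xs \<in> tuples n (carrier M) \<and> j < n \<and> r \<in> carrier R \<and> x \<in> carrier M}
      \<union> {e xs | xs j k. xs \<in> tuples n (carrier M) \<and> j < k \<and> k < n \<and> xs ! j = xs ! k})"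

definition exterior_kernel ::
  "('r, 'x) ring_scheme \<Rightarrow> ('r, 'm, 'y) module_scheme \<Rightarrow> nat \<Rightarrow> ('m list \<Rightarrow> 'r) set" where
  "exterior_kernel R M n =
     \<Inter> {N. submodule N R (free_module R (tuples n (carrier M))) \<and> exterior_relators R M n \<subseteq> N}"

definition exterior_power ::
  "('r, 'x) ring_scheme \<Rightarrow> ('r, 'm, 'y) module_scheme \<Rightarrow> nat \<Rightarrow> ('m list \<Rightarrow> 'r) set monoid" where
  "exterior_power R M n = free_module R (tuples n (carrier M)) A_Mod exterior_kernel R M n"

definition wedge ::
  "('r, 'x) ring_scheme \<Rightarrow> ('r, 'm, 'y) module_scheme \<Rightarrow> 'm list \<Rightarrow> ('m list \<Rightarrow> 'r) set" where
  "wedge R M xs = exterior_kernel R M (length xs) +>\<^bsub>free_module R UNIV\<^esub> basis_elt R xs"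


section \<open>Group homology with trivial coefficients, via the (unnormalised) bar complex\<close>

text \<open>The list \<open>[g\<^sub>1, \<dots>, g\<^sub>n]\<close> stands for the bar symbol \<open>[g\<^sub>1|\<dots>|g\<^sub>n]\<close>.\<close>

abbreviation bar_chains ::
  "('r, 'x) ring_scheme \<Rightarrow> ('g, 'y) monoid_scheme \<Rightarrow> nat \<Rightarrow> ('r, 'g list \<Rightarrow> 'r) module" where
  "bar_chains R G n \<equiv> free_module R (tuples n (carrier G))"

definition bar_face :: "('g, 'y) monoid_scheme \<Rightarrow> nat \<Rightarrow> 'g list \<Rightarrow> 'g list" where
  "bar_face G j gs =
     (if j = 0 then tl gs
      else if j = length gs then butlast gs
      else take (j - 1) gs @ [gs ! (j - 1) \<otimes>\<^bsub>G\<^esub> gs ! j] @ drop (j + 1) gs)"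

definition bar_boundary ::
  "('r, 'x) ring_scheme \<Rightarrow> ('g, 'y) monoid_scheme \<Rightarrow> ('g list \<Rightarrow> 'r) \<Rightarrow> 'g list \<Rightarrow> 'r" where
  "bar_boundary R G = lin_ext R (\<lambda>gs.
     if gs = [] then \<zero>\<^bsub>free_module R UNIV\<^esub>
     else (\<Oplus>\<^bsub>free_module R UNIV\<^esub>j\<in>{..length gs}.
             sign_in R j \<odot>\<^bsub>free_module R UNIV\<^esub> basis_elt R (bar_face G j gs)))"

definition bar_cycles ::
  "('r, 'x) ring_scheme \<Rightarrow> ('g, 'y) monoid_scheme \<Rightarrow> nat \<Rightarrow> ('g list \<Rightarrow> 'r) set" where
  "bar_cycles R G n =
     {c \<in> carrier (bar_chains R G n). bar_boundary R G c = \<zero>\<^bsub>free_module R UNIV\<^esub>}"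

definition bar_boundaries ::
  "('r, 'x) ring_scheme \<Rightarrow> ('g, 'y) monoid_scheme \<Rightarrow> nat \<Rightarrow> ('g list \<Rightarrow> 'r) set" where
  "bar_boundaries R G n = bar_boundary R G ` carrier (bar_chains R G (Suc n))"

definition group_homology ::
  "('r, 'x) ring_scheme \<Rightarrow> ('g, 'y) monoid_scheme \<Rightarrow> nat \<Rightarrow> ('g list \<Rightarrow> 'r) set monoid" where
  "group_homology R G n =
     (bar_chains R G n)\<lparr>carrier := bar_cycles R G n\<rparr> A_Mod bar_boundaries R G n"

definition homology_class ::
  "('r, 'x) ring_scheme \<Rightarrow> ('g, 'y) monoid_scheme \<Rightarrow> nat \<Rightarrow> ('g list \<Rightarrow> 'r) \<Rightarrow> ('g list \<Rightarrow> 'r) set" where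
  "homology_class R G n c = bar_boundaries R G n +>\<^bsub>free_module R UNIV\<^esub> c"

definition homology_map ::
  "('r, 'x) ring_scheme \<Rightarrow> ('h, 'y) monoid_scheme \<Rightarrow> nat \<Rightarrow> ('g \<Rightarrow> 'h)
     \<Rightarrow> ('g list \<Rightarrow> 'r) set \<Rightarrow> ('h list \<Rightarrow> 'r) set" where
  "homology_map R H n \<phi> X = the_elem ((\<lambda>c. homology_class R H n (push R (map \<phi>) c)) ` X)"

definition coeff_map ::
  "('r, 'x) ring_scheme \<Rightarrow> ('g, 'y) monoid_scheme \<Rightarrow> nat \<Rightarrow> ('q \<Rightarrow> 'r)
     \<Rightarrow> ('g list \<Rightarrow> 'q) set \<Rightarrow> ('g list \<Rightarrow> 'r) set" where
  "coeff_map R G n h X = the_elem ((\<lambda>c. homology_class R G n (h \<circ> c)) ` X)"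


section \<open>The Pontryagin product\<close>

text \<open>
  On the bar complex of an abelian group the Pontryagin product is induced by the shuffle product,
  the sum over all \<open>(m, n)\<close>-shuffles with their signs. In the last equation below,
  the first letter \<open>y\<close> of the second word is moved past the whole first word.
\<close>

fun shuffle :: "('r, 'x) ring_scheme \<Rightarrow> 'a list \<Rightarrow> 'a list \<Rightarrow> 'a list \<Rightarrow> 'r" where
  "shuffle R [] ys = basis_elt R ys"
| "shuffle R (x # xs) [] = basis_elt R (x # xs)"
| "shuffle R (x # xs) (y # ys) =
     push R (Cons x) (shuffle R xs (y # ys))
     \<oplus>\<^bsub>free_module R UNIV\<^esub>
     sign_in R (length (x # xs)) \<odot>\<^bsub>free_module R UNIV\<^esub> push R (Cons y) (shuffle R (x # xs) ys)"

definition shuffle_product ::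
  "('r, 'x) ring_scheme \<Rightarrow> ('a list \<Rightarrow> 'r) \<Rightarrow> ('a list \<Rightarrow> 'r) \<Rightarrow> 'a list \<Rightarrow> 'r" where
  "shuffle_product R c d = lin_ext R (\<lambda>xs. lin_ext R (\<lambda>ys. shuffle R xs ys) d) c"

text \<open>The product \<open>[a\<^sub>1] \<cdot> \<dots> \<cdot> [a\<^sub>n]\<close> of one-dimensional cycles; the empty product is the unit \<open>[]\<close>.\<close>

primrec pontryagin_cycle :: "('r, 'x) ring_scheme \<Rightarrow> 'a list \<Rightarrow> 'a list \<Rightarrow> 'r" where
  "pontryagin_cycle R [] = basis_elt R []"
| "pontryagin_cycle R (a # as) = shuffle_product R (basis_elt R [a]) (pontryagin_cycle R as)"

text \<open>
  The map from the \<open>n\<close>-th exterior power of \<open>H\<^sub>1(A, R) = A \<otimes> R\<close> to \<open>H\<^sub>n(A, R)\<close> which sends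
  \<open>x\<^sub>1 \<and> \<dots> \<and> x\<^sub>n\<close> to the Pontryagin product of the \<open>x\<^sub>j\<close>. Here \<open>A \<otimes> R\<close> is given as
  an \<open>R\<close>-module \<open>M\<close> whose elements \<open>x\<close> correspond to the homology classes of the cycles \<open>[s x]\<close>,
  for a choice of representatives \<open>s x\<close> in \<open>A\<close>.
\<close>

definition pontryagin_map ::
  "('r, 'x) ring_scheme \<Rightarrow> ('a, 'y) monoid_scheme \<Rightarrow> ('m \<Rightarrow> 'a) \<Rightarrow> nat
     \<Rightarrow> ('m list \<Rightarrow> 'r) set \<Rightarrow> ('a list \<Rightarrow> 'r) set" where
  "pontryagin_map R A s n X =
     the_elem ((\<lambda>c. homology_class R A n (lin_ext R (\<lambda>xs. pontryagin_cycle R (map s xs)) c)) ` X)"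


section \<open>The groups \<open>E\<^sub>2(A)\<close> and the polynomials without constant term\<close>

definition GL2 :: "('a::comm_ring_1 ^ 2 ^ 2) monoid" where
  "GL2 = \<lparr>carrier = {A. invertible A}, mult = (**), one = mat 1\<rparr>"

definition upper_elem :: "'a::comm_ring_1 \<Rightarrow> 'a ^ 2 ^ 2" where
  "upper_elem f = vector [vector [1, f], vector [0, 1]]"

definition lower_elem :: "'a::comm_ring_1 \<Rightarrow> 'a ^ 2 ^ 2" where
  "lower_elem f = vector [vector [1, 0], vector [f, 1]]"

definition E2 :: "('a::comm_ring_1 ^ 2 ^ 2) monoid" where
  "E2 = GL2\<lparr>carrier := generate GL2 (range upper_elem \<union> range lower_elem)\<rparr>"

definition tZt :: "(int, int poly) module" where
  "tZt = \<lparr>carrier = {f. Polynomial.coeff f 0 = 0}, mult = (*), one = 1,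
          zero = 0, add = (+), smult = Polynomial.smult\<rparr>"

abbreviation Fp :: "nat \<Rightarrow> int ring" where
  "Fp p \<equiv> residue_ring (int p)"

definition tFpt :: "nat \<Rightarrow> (int, nat \<Rightarrow> int) up_ring" where
  "tFpt p = (UP (Fp p))
     \<lparr>carrier := {f \<in> carrier (UP (Fp p)). UnivPoly.coeff (UP (Fp p)) f 0 = \<zero>\<^bsub>Fp p\<^esub>}\<rparr>"

text \<open>
  The integer polynomial whose coefficients are the representatives in \<open>{0..p-1}\<close>;
  the class of the cycle \<open>[f]\<close> in \<open>H\<^sub>1\<close> with coefficients in \<open>Fp p\<close> depends only on \<open>f\<close> modulo \<open>p\<close>.
\<close>

definition lift_poly :: "nat \<Rightarrow> (nat \<Rightarrow> int) \<Rightarrow> int poly" where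
  "lift_poly p f = Abs_poly (UnivPoly.coeff (UP (Fp p)) f)"

definition wedge_Z_incl ::
  "nat \<Rightarrow> (int poly list \<Rightarrow> int) set \<Rightarrow> ((int poly ^ 2 ^ 2) list \<Rightarrow> int) set" where
  "wedge_Z_incl i X =
     homology_map \<Z> E2 i upper_elem (pontryagin_map \<Z> (add_monoid tZt) (\<lambda>f. f) i X)"

definition wedge_Fp_incl ::
  "nat \<Rightarrow> nat \<Rightarrow> ((nat \<Rightarrow> int) list \<Rightarrow> int) set \<Rightarrow> ((int poly ^ 2 ^ 2) list \<Rightarrow> int) set" where
  "wedge_Fp_incl p i X =
     homology_map (Fp p) E2 i upper_elem
       (pontryagin_map (Fp p) (add_monoid tZt) (lift_poly p) i X)"

definition direct_summand :: "'a set \<Rightarrow> ('a, 'x) monoid_scheme \<Rightarrow> bool" where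
  "direct_summand A H \<longleftrightarrow>
     subgroup A H \<and> (\<exists>B. subgroup B H \<and> A \<inter> B = {\<one>\<^bsub>H\<^esub>} \<and> A <#>\<^bsub>H\<^esub> B = carrier H)"

end

theory Submission
  imports Defs "HOL-Library.Poly_Mapping"
begin

text \<open>
  The group \<open>E\<^sub>2(\<int>[t])\<close> retracts onto \<open>t\<int>[t]\<close>. Indeed every element is a product of matrices in
  \<open>SL\<^sub>2(\<int>)\<close> and of upper elementary matrices \<open>U(f)\<close> with \<open>f \<in> t\<int>[t]\<close>, and the sum of the
  polynomials \<open>f\<close> does not depend on the product: a product in which no \<open>f\<close> vanishes and no inner
  integral factor is upper triangular moves the vector \<open>(0, 1)\<close> to a vector of positive degree, so it is
  not an integral matrix. Hence \<open>H\<^sub>i(t\<int>[t])\<close> is a direct summand of \<open>H\<^sub>i(E\<^sub>2(\<int>[t]))\<close>.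

  The Pontryagin map from the exterior power to \<open>H\<^sub>i(t\<int>[t])\<close> has a left inverse, induced by the
  cocycles which send \<open>[f\<^sub>1|\<dots>|f\<^sub>i]\<close> to the product of the coefficients of \<open>f\<^sub>j\<close> at \<open>t\<close> to the power
  \<open>l\<^sub>j\<close>, one for each strictly increasing sequence \<open>l\<^sub>1 < \<dots> < l\<^sub>i\<close>. The restriction to increasing
  sequences avoids the factor \<open>i!\<close> of the full antisymmetrisation, so that the argument works over any
  coefficient ring.

  Chains with coefficients modulo \<open>q\<close> are represented by integral chains \<open>x\<close> through their reductions
  \<open>red q x\<close>; integral coefficients are the case \<open>q = 0\<close>, since \<open>a mod 0 = a\<close>.
\<close>

text \<open>Why a plain sum of the polynomials is invariant: an upper triangular matrix in
  \<open>SL2Z\<close> has diagonal entries both equal to 1 or both equal to -1, so it commutes with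
  every \<open>U(f)\<close>. Merging letters across such a matrix preserves the sum, and the degree
  argument shows that no other relations occur.

  On the homological side the obstacle is that the Pontryagin map is alternating on chains but
  multilinear only up to boundaries; the homotopy for additivity is the shuffle product with
  \<open>[a|b]\<close>. Instead of using a basis of the exterior power, the composite of inclusion
  and left inverse is compared with the identity modulo \<open>exterior_kernel\<close>: every slot
  is expanded in monomials and the exponents are sorted by adjacent swaps.

  Modulo a prime the chosen lifts of polynomials are additive only modulo that prime, and cycles
  lift to integral chains whose boundary is merely divisible by it. Identities are therefore proved
  for integral chains, and memberships in subgroups are tested after reduction.\<close>

type_synonym 'a frag = "'a \<Rightarrow>\<^sub>0 int"

section \<open>Calculus of finitely supported integral chains\<close>

lemma frag_cmul_minus2: "frag_cmul c (x - y) = frag_cmul c x - frag_cmul c y"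
  by (rule poly_mapping_eqI) (simp add: lookup_minus algebra_simps)

lemmas frag_extend_linear = frag_extend_add frag_extend_diff frag_extend_minus frag_extend_cmul

text \<open>Additive maps on a free abelian group are determined by the generators. Through this
  rule, identities proved for words by list induction pass to arbitrary chains.\<close>

lemma frag_eqI:
  assumes "F 0 = (0::'b frag)" "G 0 = 0"
    and "\<And>x y. F (x - y) = F x - F y" "\<And>x y. G (x - y) = G x - G y"
    and "\<And>a. F (frag_of a) = G (frag_of a)"
  shows "F (z::'a frag) = G z"
  by (induction z rule: frag_induction[OF subset_UNIV]) (simp_all add: assms)

lemma frag_extend_fun_diff:
  "frag_extend (\<lambda>x. f x - g x) z = frag_extend f z - frag_extend g z"
  by (rule frag_eqI) (simp_all add: frag_extend_linear)

lemma frag_extend_fun_0 [simp]: "frag_extend (\<lambda>x. 0) z = 0"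
  by (rule frag_extend_eq_0) simp

lemma frag_extend_extend:
  "frag_extend f (frag_extend g z) = frag_extend (\<lambda>x. frag_extend f (g x)) z"
  by (rule frag_eqI) (simp_all add: frag_extend_linear)

lemma frag_extend_swap:
  "frag_extend (\<lambda>l. frag_extend (\<lambda>k. f l k) y) x = frag_extend (\<lambda>k. frag_extend (\<lambda>l. f l k) x) y"
  by (rule frag_eqI[where z = x]) (simp_all add: frag_extend_linear frag_extend_fun_diff)

definition fmap :: "('a \<Rightarrow> 'b) \<Rightarrow> 'a frag \<Rightarrow> 'b frag" where
  "fmap f = frag_extend (\<lambda>x. frag_of (f x))"

lemma fmap_of [simp]: "fmap f (frag_of a) = frag_of (f a)"
  and fmap_0 [simp]: "fmap f 0 = 0"
  and fmap_add: "fmap f (x + y) = fmap f x + fmap f y"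
  and fmap_diff: "fmap f (x - y) = fmap f x - fmap f y"
  and fmap_minus: "fmap f (- x) = - fmap f x"
  and fmap_cmul: "fmap f (frag_cmul c x) = frag_cmul c (fmap f x)"
  by (simp_all add: fmap_def frag_extend_linear)

lemmas fmap_linear = fmap_add fmap_diff fmap_minus fmap_cmul

lemma keys_fmap: "Poly_Mapping.keys (fmap f x) \<subseteq> f ` Poly_Mapping.keys x"
  using keys_frag_extend[of "\<lambda>x. frag_of (f x)" x] by (auto simp: fmap_def)

lemma fmap_fmap: "fmap f (fmap g z) = fmap (\<lambda>x. f (g x)) z"
  by (rule frag_eqI) (simp_all add: fmap_linear)

lemma frag_extend_fmap: "frag_extend f (fmap g z) = frag_extend (\<lambda>x. f (g x)) z"
  by (rule frag_eqI) (simp_all add: frag_extend_linear fmap_linear)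

lemma fmap_extend: "fmap f (frag_extend g z) = frag_extend (\<lambda>x. fmap f (g x)) z"
  by (rule frag_eqI) (simp_all add: frag_extend_linear fmap_linear)

section \<open>The shuffle product with words of length one and two\<close>

text \<open>The signed shuffle product of \<open>[a]\<close> with a word: each letter that
  \<open>a\<close> is moved past costs a sign. It is the integral form of
  \<open>shuffle R [a]\<close>.\<close>

primrec ins :: "'a \<Rightarrow> 'a list \<Rightarrow> 'a list frag" where
  "ins a [] = frag_of [a]"
| "ins a (y # ys) = frag_of (a # y # ys) - fmap (Cons y) (ins a ys)"

text \<open>The shuffle product of \<open>[a, b]\<close> with a word. If \<open>a\<close> comes
  first, \<open>[b]\<close> remains to be shuffled; if \<open>y\<close> comes first, it has passed
  two letters, so its sign is positive.\<close>

primrec ins2 :: "'a \<Rightarrow> 'a \<Rightarrow> 'a list \<Rightarrow> 'a list frag" where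
  "ins2 a b [] = frag_of [a, b]"
| "ins2 a b (y # ys) = fmap (Cons a) (ins b (y # ys)) + fmap (Cons y) (ins2 a b ys)"

text \<open>All faces of \<open>x # xs\<close> except the one that deletes \<open>x\<close>, with
  the overall minus sign of the bar differential left out. The leading letter is a parameter because
  the next face multiplies it into its neighbour; for \<open>[x]\<close> only the face that deletes
  the last letter remains.\<close>

primrec bar_tail :: "('a \<Rightarrow> 'a \<Rightarrow> 'a) \<Rightarrow> 'a list \<Rightarrow> 'a \<Rightarrow> 'a list frag" where
  "bar_tail m [] = (\<lambda>x. frag_of [])"
| "bar_tail m (y # ys) = (\<lambda>x. frag_of (m x y # ys) - fmap (Cons x) (bar_tail m ys y))"

fun bar_diff :: "('a \<Rightarrow> 'a \<Rightarrow> 'a) \<Rightarrow> 'a list \<Rightarrow> 'a list frag" where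
  "bar_diff m [] = 0"
| "bar_diff m (x # xs) = frag_of xs - bar_tail m xs x"

primrec pont :: "'a list \<Rightarrow> 'a list frag" where
  "pont [] = frag_of []"
| "pont (a # as) = frag_extend (ins a) (pont as)"

abbreviation "Ins a \<equiv> frag_extend (ins a)"
abbreviation "Ins2 a b \<equiv> frag_extend (ins2 a b)"
abbreviation "Bd m \<equiv> frag_extend (bar_diff m)"
abbreviation "Bt m x \<equiv> frag_extend (\<lambda>xs. bar_tail m xs x)"

lemma Ins_Cons: "Ins a (fmap (Cons y) z) = fmap (Cons a) (fmap (Cons y) z) - fmap (Cons y) (Ins a z)"
  by (rule frag_eqI) (simp_all add: frag_extend_linear fmap_linear)

lemma Ins2_Cons:
  "Ins2 a b (fmap (Cons y) z) = fmap (Cons a) (Ins b (fmap (Cons y) z)) + fmap (Cons y) (Ins2 a b z)"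
  by (rule frag_eqI) (simp_all add: frag_extend_linear fmap_linear algebra_simps)

lemma Bd_Cons: "Bd m (fmap (Cons x) z) = z - Bt m x z"
  by (rule frag_eqI) (simp_all add: frag_extend_linear fmap_linear)

lemma Bt_Cons: "Bt m x (fmap (Cons y) z) = fmap (Cons (m x y)) z - fmap (Cons x) (Bt m y z)"
  by (rule frag_eqI) (simp_all add: frag_extend_linear fmap_linear)

lemmas ch_simps = frag_extend_linear fmap_linear Ins_Cons Ins2_Cons Bd_Cons Bt_Cons

text \<open>This is graded commutativity of the shuffle product for two factors of degree one; it
  holds on chains, before passing to homology.\<close>

lemma ins_anticommute: "Ins a (ins b ys) = - Ins b (ins a ys)"
  by (induction ys) (simp_all add: ch_simps algebra_simps)

lemma Ins_anticommute: "Ins a (Ins b z) = - Ins b (Ins a z)"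
  by (rule frag_eqI) (simp_all add: ch_simps ins_anticommute[of a b])

text \<open>Anticommutativity gives a chain equal to its negative, and integral chains have no
  2-torsion. Arguing before the reduction modulo \<open>q\<close> is what makes the square vanish
  for the prime 2 as well.\<close>

lemma Ins_Ins_0: "Ins a (Ins a z) = 0"
proof (rule poly_mapping_eqI)
  fix k
  have "Ins a (Ins a z) = - Ins a (Ins a z)" by (rule Ins_anticommute)
  then have "poly_mapping.lookup (Ins a (Ins a z)) k = - poly_mapping.lookup (Ins a (Ins a z)) k"
    by (metis lookup_uminus)
  then show "poly_mapping.lookup (Ins a (Ins a z)) k = poly_mapping.lookup 0 k" by simp
qed

lemma pont_swap: "pont (u @ x # y # v) = - pont (u @ y # x # v)"
  by (induction u) (simp_all add: frag_extend_minus Ins_anticommute[of x y])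

lemma pont_adjacent: "pont (u @ x # x # v) = 0"
  by (induction u) (simp_all add: Ins_Ins_0)

lemma keys_ins: "Poly_Mapping.keys (ins a ys) \<subseteq> {zs. mset zs = add_mset a (mset ys)}"
proof (induction ys)
  case (Cons y ys)
  have "Poly_Mapping.keys (fmap (Cons y) (ins a ys)) \<subseteq> {zs. mset zs = add_mset a (mset (y # ys))}"
    using keys_fmap[of "Cons y" "ins a ys"] Cons by fastforce
  then show ?case using keys_diff[of "frag_of (a # y # ys)" "fmap (Cons y) (ins a ys)"] by auto
qed simp

lemma keys_pont: "Poly_Mapping.keys (pont as) \<subseteq> {zs. mset zs = mset as}"
proof (induction as)
  case (Cons a as)
  then show ?case using keys_frag_extend[of "ins a" "pont as"] keys_ins[of a] by fastforce
qed simp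

text \<open>Swapping adjacent letters sorts every word, so properties invariant under such swaps need
  only be checked on strictly sorted words and on words with two equal neighbours.\<close>

lemma swap_induct:
  fixes L :: "'a::linorder list"
  assumes swap: "\<And>u x y v. Q (u @ x # y # v) \<Longrightarrow> Q (u @ y # x # v)"
    and eq: "\<And>u x v. Q (u @ x # x # v)"
    and sorted: "\<And>L. sorted_wrt (<) L \<Longrightarrow> Q L"
  shows "Q L"
proof -
  \<comment> \<open>Insertion sort is run backwards: each move of \<open>x\<close> past a smaller
    \<open>y\<close> is undone by one adjacent swap.\<close>
  have ins: "Q (u @ insort x L) \<Longrightarrow> Q (u @ x # L)" for u x L
  proof (induction L arbitrary: u)
    case (Cons y L)
    show ?case
    proof (cases "x \<le> y")
      case False
      then have "Q ((u @ [y]) @ insort x L)" using Cons.prems by simp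
      then have "Q (u @ y # x # L)" using Cons.IH[of "u @ [y]"] by simp
      then show ?thesis by (rule swap)
    qed (use Cons.prems in simp)
  qed simp
  have srt: "Q (u @ sort L) \<Longrightarrow> Q (u @ L)" for u L
  proof (induction L arbitrary: u)
    case (Cons x L)
    then have "Q ((u @ [x]) @ sort L)" using ins[of u x "sort L"] by simp
    then show ?case using Cons.IH[of "u @ [x]"] by simp
  qed simp
  have "Q (sort L)"
  proof (cases "distinct L")
    case True
    then show ?thesis by (intro sorted) (simp add: strict_sorted_iff)
  next
    case False
    have "\<not> sorted_wrt (<) S \<Longrightarrow> sorted S \<Longrightarrow> \<exists>u x v. S = u @ x # x # v" for S :: "'a list"
    proof (induction S)
      case (Cons a S)
      show ?case
      proof (cases "sorted_wrt (<) S")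
        case True
        then obtain b T where "S = b # T" "a = b"
          using Cons.prems by (cases S) force+
        then show ?thesis by (metis append_Nil)
      next
        case False
        then show ?thesis using Cons by (metis append_Cons sorted_simps(2))
      qed
    qed simp
    then obtain u x v where "sort L = u @ x # x # v"
      using False by (metis distinct_sort sorted_sort strict_sorted_iff)
    then show ?thesis using eq by simp
  qed
  then show ?thesis using srt[of "[]"] by simp
qed

text \<open>The last three terms are minus the boundary of \<open>a # x # xs\<close>, the shuffle in
  which \<open>a\<close> precedes \<open>x\<close>; they cancel against it in
  \<open>bar_diff_ins\<close>.\<close>

lemma bar_tail_ins:
  fixes a x :: "'a::ab_semigroup_add"
  shows "Bt (+) x (ins a xs) = Ins a (bar_tail (+) xs x) + frag_of ((a + x) # xs)
     - frag_of (x # xs) - fmap (Cons a) (bar_tail (+) xs x)"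
proof (induction xs arbitrary: x)
  case (Cons y ys)
  show ?case by (simp add: ch_simps Cons) (simp add: algebra_simps)
qed (simp add: ch_simps algebra_simps)

text \<open>This is the Leibniz rule for the cycle \<open>[a]\<close>. Commutativity enters when
  \<open>a\<close> stands just before or just after a letter \<open>y\<close>: the merged letters
  \<open>a + y\<close> and \<open>y + a\<close> agree and occur with opposite signs.\<close>

lemma bar_diff_ins:
  fixes a :: "'a::ab_semigroup_add"
  shows "Bd (+) (ins a xs) = - Ins a (bar_diff (+) xs)"
  by (cases xs) (simp_all add: ch_simps bar_tail_ins algebra_simps)

lemma Bd_Ins:
  fixes a :: "'a::ab_semigroup_add"
  shows "Bd (+) (Ins a z) = - Ins a (Bd (+) z)"
  by (rule frag_eqI) (simp_all add: ch_simps bar_diff_ins)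

lemma Bd_pont:
  fixes as :: "'a::ab_semigroup_add list"
  shows "Bd (+) (pont as) = 0"
  by (induction as) (simp_all add: Bd_Ins)

lemma bar_tail_ins2:
  fixes a b x :: "'a::ab_semigroup_add"
  shows "Bt (+) x (ins2 a b xs) = Ins2 a b (bar_tail (+) xs x) + ins (a + b) (x # xs)
    - ins a (x # xs) - Bt (+) a (ins b (x # xs))"
proof (induction xs arbitrary: x)
  case (Cons y ys)
  show ?case by (simp add: ch_simps Cons bar_tail_ins) (simp add: algebra_simps)
qed (simp add: ch_simps algebra_simps)

text \<open>This is the Leibniz rule for \<open>[a, b]\<close>, whose own boundary is
  \<open>[b] - [a + b] + [a]\<close>. On a cycle the last term vanishes, so \<open>ins2\<close> is
  the homotopy that makes \<open>ins\<close> additive in its letter up to boundaries.\<close>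

lemma bar_diff_ins2:
  fixes a b :: "'a::ab_semigroup_add"
  shows "Bd (+) (ins2 a b xs) = ins a xs + ins b xs - ins (a + b) xs + Ins2 a b (bar_diff (+) xs)"
  by (cases xs) (simp_all add: ch_simps bar_tail_ins2 bar_tail_ins algebra_simps)

lemma Bd_Ins2:
  fixes a b :: "'a::ab_semigroup_add"
  shows "Bd (+) (Ins2 a b z) = Ins a z + Ins b z - Ins (a + b) z + Ins2 a b (Bd (+) z)"
  by (rule frag_eqI) (simp_all add: ch_simps bar_diff_ins2)

lemma keys_ins2: "Poly_Mapping.keys (ins2 a b ys) \<subseteq> {zs. mset zs = add_mset a (add_mset b (mset ys))}"
proof (induction ys)
  case (Cons y ys)
  have "Poly_Mapping.keys (fmap (Cons y) (ins2 a b ys)) \<subseteq> {zs. mset zs = add_mset a (add_mset b (mset (y # ys)))}"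
    using keys_fmap[of "Cons y" "ins2 a b ys"] Cons by fastforce
  moreover have "Poly_Mapping.keys (fmap (Cons a) (ins b (y # ys))) \<subseteq> {zs. mset zs = add_mset a (add_mset b (mset (y # ys)))}"
    using keys_fmap[of "Cons a" "ins b (y # ys)"] keys_ins[of b "y # ys"] by (fastforce simp del: ins.simps)
  ultimately show ?case
    using keys_add[of "fmap (Cons a) (ins b (y # ys))" "fmap (Cons y) (ins2 a b ys)"] by (auto simp del: ins.simps)
qed simp

section \<open>Multilinear cocycles\<close>

text \<open>The tensor product of the chains \<open>\<kappa> a\<close>, with words of indices as
  basis. For additive \<open>\<kappa>\<close> its coefficients are the multilinear cocycles of the
  bar complex.\<close>

primrec tens :: "('g \<Rightarrow> 'b frag) \<Rightarrow> 'g list \<Rightarrow> 'b list frag" where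
  "tens \<kappa> [] = frag_of []"
| "tens \<kappa> (a # as) = frag_extend (\<lambda>l. fmap (Cons l) (tens \<kappa> as)) (\<kappa> a)"

abbreviation "Tens \<kappa> \<equiv> frag_extend (tens \<kappa>)"

lemma Tens_Cons: "Tens \<kappa> (fmap (Cons y) z) = frag_extend (\<lambda>l. fmap (Cons l) (Tens \<kappa> z)) (\<kappa> y)"
  by (rule frag_eqI[where z = z]) (simp_all add: ch_simps frag_extend_fun_diff)

lemma tens_map: "tens \<kappa> (map s xs) = tens (\<lambda>x. \<kappa> (s x)) xs"
  by (induction xs) simp_all

text \<open>The sum telescopes: additivity splits the letter \<open>m x y\<close>, and the part
  belonging to \<open>x\<close> is cancelled by the remaining faces, which all keep \<open>x\<close>
  in front.\<close>

lemma Tens_bar_tail: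
  assumes "\<And>x y. x \<in> C \<Longrightarrow> y \<in> C \<Longrightarrow> \<kappa> (m x y) = \<kappa> x + \<kappa> y"
    and "x \<in> C" "set xs \<subseteq> C"
  shows "Tens \<kappa> (bar_tail m xs x) = tens \<kappa> xs"
  using assms(2,3)
  by (induction xs arbitrary: x) (simp_all add: ch_simps Tens_Cons assms(1))

lemma Tens_bar_diff:
  assumes "\<And>x y. x \<in> C \<Longrightarrow> y \<in> C \<Longrightarrow> \<kappa> (m x y) = \<kappa> x + \<kappa> y" "set xs \<subseteq> C"
  shows "Tens \<kappa> (bar_diff m xs) = 0"
proof (cases xs)
  case (Cons y ys)
  then have "Tens \<kappa> (bar_tail m ys y) = tens \<kappa> ys"
    using assms by (intro Tens_bar_tail[where C = C]) auto
  then show ?thesis using Cons by (simp add: frag_extend_diff)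
qed simp

lemma Tens_Bd:
  assumes "\<And>x y. x \<in> C \<Longrightarrow> y \<in> C \<Longrightarrow> \<kappa> (m x y) = \<kappa> x + \<kappa> y"
    and "\<And>xs. xs \<in> Poly_Mapping.keys z \<Longrightarrow> set xs \<subseteq> C"
  shows "Tens \<kappa> (Bd m z) = 0"
  unfolding frag_extend_extend by (rule frag_extend_eq_0) (metis Tens_bar_diff assms)

text \<open>A shuffle only moves letters, so it may be carried out before or after each letter is
  expanded by \<open>\<kappa>\<close>.\<close>

lemma Tens_ins: "Tens \<kappa> (ins a xs) = frag_extend (\<lambda>l. Ins l (tens \<kappa> xs)) (\<kappa> a)"
proof (induction xs)
  case (Cons y ys)
  have "frag_extend (\<lambda>l. Ins l (tens \<kappa> (y # ys))) (\<kappa> a)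
      = frag_extend (\<lambda>l. frag_extend (\<lambda>k. fmap (Cons l) (fmap (Cons k) (tens \<kappa> ys))) (\<kappa> y)) (\<kappa> a)
      - frag_extend (\<lambda>l. frag_extend (\<lambda>k. fmap (Cons k) (Ins l (tens \<kappa> ys))) (\<kappa> y)) (\<kappa> a)"
    by (simp add: frag_extend_extend Ins_Cons frag_extend_fun_diff)
  moreover have "frag_extend (\<lambda>l. frag_extend (\<lambda>k. fmap (Cons k) (Ins l (tens \<kappa> ys))) (\<kappa> y)) (\<kappa> a)
     = Tens \<kappa> (fmap (Cons y) (ins a ys))"
    unfolding Tens_Cons Cons
    by (subst frag_extend_swap) (simp add: fmap_extend)
  ultimately show ?case by (simp add: ch_simps fmap_extend)
qed (simp add: fmap_def)

lemma Tens_Ins: "Tens \<kappa> (Ins a z) = frag_extend (\<lambda>l. Ins l (Tens \<kappa> z)) (\<kappa> a)"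
  by (rule frag_eqI[where z = z]) (simp_all add: ch_simps Tens_ins frag_extend_fun_diff)

text \<open>This reduces Pontryagin cycles of arbitrary letters to those of index words, on which
  \<open>ssort\<close> can be evaluated.\<close>

lemma Tens_pont: "Tens \<kappa> (pont as) = frag_extend pont (tens \<kappa> as)"
proof (induction as)
  case (Cons a as)
  show ?case
    by (simp add: Tens_Ins Cons) (simp add: frag_extend_extend frag_extend_fmap)
qed simp

text \<open>Nothing is rearranged here: words that are not strictly increasing are discarded. Each
  surviving word selects one of the cocycles.\<close>

definition ssort :: "'a::linorder list frag \<Rightarrow> 'a list frag" where
  "ssort = frag_extend (\<lambda>L. if sorted_wrt (<) L then frag_of L else 0)"

lemma ssort_ins:
  assumes "\<And>y. y \<in> set ys \<Longrightarrow> l < y"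
  shows "ssort (ins l ys) = ssort (frag_of (l # ys))"
proof (cases ys)
  case (Cons y zs)
  have "ssort (fmap (Cons y) (ins l zs)) = 0"
    unfolding ssort_def frag_extend_fmap
  proof (rule frag_extend_eq_0)
    fix L assume "L \<in> Poly_Mapping.keys (ins l zs)"
    then have "mset L = add_mset l (mset zs)" using keys_ins by fastforce
    then have "l \<in> set L" by (metis set_mset_mset union_single_eq_member)
    then show "(if sorted_wrt (<) (y # L) then frag_of (y # L) else 0) = 0"
      using assms[of y] Cons by (auto dest: order.asym)
  qed
  then show ?thesis using Cons by (simp add: ssort_def frag_extend_diff)
qed simp

text \<open>Of all signed permutations in \<open>pont L\<close> only the trivial one is increasing:
  at each insertion the smallest letter \<open>l\<close> must stay in front, where its coefficient
  is 1.\<close>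

lemma ssort_pont: "sorted_wrt (<) L \<Longrightarrow> ssort (pont L) = frag_of L"
proof (induction L)
  case (Cons l L)
  have "ssort (pont (l # L)) = frag_extend (\<lambda>ys. ssort (ins l ys)) (pont L)"
    by (simp add: ssort_def frag_extend_extend)
  also have "\<dots> = frag_extend (\<lambda>ys. fmap (Cons l) (ssort (frag_of ys))) (pont L)"
  proof (rule frag_extend_eq)
    fix ys assume "ys \<in> Poly_Mapping.keys (pont L)"
    then have "mset ys = mset L" using keys_pont by fastforce
    then have "set ys = set L" by (rule mset_eq_setD)
    then have *: "\<And>y. y \<in> set ys \<Longrightarrow> l < y" using Cons.prems by simp
    show "ssort (ins l ys) = fmap (Cons l) (ssort (frag_of ys))"
      by (subst ssort_ins) (use * in \<open>auto simp: ssort_def\<close>)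
  qed
  also have "\<dots> = fmap (Cons l) (ssort (pont L))"
    by (simp add: ssort_def fmap_extend)
  finally show ?case using Cons by simp
qed (simp add: ssort_def)

section \<open>Reduction of integral chains modulo \<open>q\<close>\<close>

definition red :: "int \<Rightarrow> 'a frag \<Rightarrow> 'a \<Rightarrow> int" where
  "red q x = (\<lambda>s. poly_mapping.lookup x s mod q)"

lemma red_eq_iff: "red q x = red q y \<longleftrightarrow> (\<exists>z. x = y + frag_cmul q z)"
proof
  assume eq: "red q x = red q y"
  have dvd: "q dvd poly_mapping.lookup (x - y) s" for s
    using fun_cong[OF eq, of s] by (simp add: red_def lookup_minus mod_eq_dvd_iff)
  \<comment> \<open>For \<open>q = 0\<close> divisibility forces \<open>x = y\<close>, and since
    \<open>a div 0 = 0\<close> the quotient chain is zero.\<close>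
  have "x = y + frag_cmul q (Poly_Mapping.map (\<lambda>a. a div q) (x - y))"
  proof (rule poly_mapping_eqI)
    fix s
    show "poly_mapping.lookup x s = poly_mapping.lookup (y + frag_cmul q (Poly_Mapping.map (\<lambda>a. a div q) (x - y))) s"
      using dvd[of s] by (simp add: lookup_add Poly_Mapping.map.rep_eq when_def lookup_minus)
  qed
  then show "\<exists>z. x = y + frag_cmul q z" ..
next
  assume "\<exists>z. x = y + frag_cmul q z"
  then show "red q x = red q y" by (auto simp: red_def lookup_add)
qed

lemma red_extend_cong: "red q x = red q y \<Longrightarrow> red q (frag_extend f x) = red q (frag_extend f y)"
  unfolding red_eq_iff by (auto simp: frag_extend_linear)

lemma red_fmap_cong: "red q x = red q y \<Longrightarrow> red q (fmap f x) = red q (fmap f y)"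
  unfolding fmap_def by (rule red_extend_cong)

lemma red_cmul_self [simp]: "red q (frag_cmul q x) = (\<lambda>s. 0)"
  by (simp add: red_def)

lemma red_zero [simp]: "red q 0 = (\<lambda>s. 0)"
  by (simp add: red_def)

lemma red_add: "red q (x + y) = (\<lambda>s. (red q x s + red q y s) mod q)"
  by (simp add: red_def lookup_add mod_add_eq)

lemma red_diff: "red q (x - y) = (\<lambda>s. (red q x s - red q y s) mod q)"
  by (simp add: red_def lookup_minus mod_diff_eq)

section \<open>Quotients of groups of chains\<close>

text \<open>\<open>exterior_power\<close> and \<open>group_homology\<close> both turn out to be
  factor groups of some \<open>fgrp\<close>, so that the same quotient lemmas serve both.\<close>

definition fgrp :: "int \<Rightarrow> ('a \<Rightarrow> int) set \<Rightarrow> ('a \<Rightarrow> int) monoid" where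
  "fgrp q C = \<lparr>carrier = C, monoid.mult = (\<lambda>c d s. (c s + d s) mod q), one = (\<lambda>s. 0)\<rparr>"

text \<open>Subgroups are described through integral representatives, without naming an ambient
  group. Closure under integer multiples follows, so submodules and additive subgroups
  coincide.\<close>

definition fsub :: "int \<Rightarrow> ('a \<Rightarrow> int) set \<Rightarrow> bool" where
  "fsub q C \<longleftrightarrow> C \<subseteq> range (red q) \<and> (\<lambda>s. 0) \<in> C
     \<and> (\<forall>x y. red q x \<in> C \<longrightarrow> red q y \<in> C \<longrightarrow> red q (x - y) \<in> C)"

definition cls :: "int \<Rightarrow> ('a \<Rightarrow> int) set \<Rightarrow> 'a frag \<Rightarrow> ('a \<Rightarrow> int) set" where
  "cls q N x = (\<lambda>n s. (n s + red q x s) mod q) ` N"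

lemma fsub_diff: "fsub q C \<Longrightarrow> red q x \<in> C \<Longrightarrow> red q y \<in> C \<Longrightarrow> red q (x - y) \<in> C"
  and fsub_0: "fsub q C \<Longrightarrow> (\<lambda>s. 0) \<in> C"
  and fsub_rep: "fsub q C \<Longrightarrow> c \<in> C \<Longrightarrow> \<exists>x. c = red q x"
  by (auto simp: fsub_def)

lemma fsub_minus: "fsub q C \<Longrightarrow> red q x \<in> C \<Longrightarrow> red q (- x) \<in> C"
  using fsub_diff[of q C 0 x] fsub_0 by auto

lemma fsub_add: "fsub q C \<Longrightarrow> red q x \<in> C \<Longrightarrow> red q y \<in> C \<Longrightarrow> red q (x + y) \<in> C"
  using fsub_diff[of q C x "- y"] fsub_minus[of q C y] by simp

lemma fsub_cmul: "fsub q C \<Longrightarrow> red q x \<in> C \<Longrightarrow> red q (frag_cmul k x) \<in> C"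
  by (rule frag_closure_minus_cmul) (auto simp: fsub_0 fsub_diff)

lemma fsub_sum: "fsub q C \<Longrightarrow> (\<And>i. i \<in> I \<Longrightarrow> red q (g i) \<in> C) \<Longrightarrow> red q (sum g I) \<in> C"
  by (induction I rule: infinite_finite_induct) (auto simp: fsub_0 fsub_add)

lemma fsub_extend:
  "fsub q C \<Longrightarrow> (\<And>i. i \<in> Poly_Mapping.keys x \<Longrightarrow> red q (f i) \<in> C) \<Longrightarrow> red q (frag_extend f x) \<in> C"
  unfolding frag_extend_def by (rule fsub_sum) (auto simp: fsub_cmul)

lemma fgrp_comm_group:
  assumes C: "fsub q C"
  shows "comm_group (fgrp q C)"
proof (rule comm_groupI)
  fix c d assume "c \<in> carrier (fgrp q C)" "d \<in> carrier (fgrp q C)"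
  then have cd: "c \<in> C" "d \<in> C" by (simp_all add: fgrp_def)
  then obtain x y where xy: "c = red q x" "d = red q y" by (metis fsub_rep[OF C])
  then show "c \<otimes>\<^bsub>fgrp q C\<^esub> d \<in> carrier (fgrp q C)"
    using fsub_add[OF C, of x y] cd by (simp add: fgrp_def red_add)
next
  fix c assume c: "c \<in> carrier (fgrp q C)"
  then have "c \<in> C" by (simp add: fgrp_def)
  then obtain x where x: "c = red q x" "red q x \<in> C" by (metis fsub_rep[OF C])
  show "\<one>\<^bsub>fgrp q C\<^esub> \<otimes>\<^bsub>fgrp q C\<^esub> c = c"
    using x by (simp add: fgrp_def red_def)
  have "red q (- x) \<otimes>\<^bsub>fgrp q C\<^esub> c = \<one>\<^bsub>fgrp q C\<^esub>"
    using red_add[of q "- x" x] x by (simp add: fgrp_def)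
  then show "\<exists>y\<in>carrier (fgrp q C). y \<otimes>\<^bsub>fgrp q C\<^esub> c = \<one>\<^bsub>fgrp q C\<^esub>"
    using fsub_minus[OF C x(2)] by (auto simp: fgrp_def)
qed (simp_all add: fgrp_def fsub_0[OF C] mod_add_left_eq mod_add_right_eq add.assoc, simp add: add.commute)

lemma fgrp_mult: "red q x \<otimes>\<^bsub>fgrp q C\<^esub> red q y = red q (x + y)"
  by (simp add: fgrp_def red_add)

lemma fgrp_inv:
  assumes "fsub q C" "red q x \<in> C"
  shows "inv\<^bsub>fgrp q C\<^esub> (red q x) = red q (- x)"
proof -
  interpret comm_group "fgrp q C" by (rule fgrp_comm_group[OF assms(1)])
  have "red q (- x) \<otimes>\<^bsub>fgrp q C\<^esub> red q x = \<one>\<^bsub>fgrp q C\<^esub>"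
    unfolding fgrp_mult by (simp add: fgrp_def)
  then show ?thesis
    using inv_equality fsub_minus[OF assms] assms(2) by (simp add: fgrp_def)
qed

lemma fgrp_subgroup:
  assumes "fsub q N" "fsub q C" "N \<subseteq> C"
  shows "subgroup N (fgrp q C)"
proof
  show "N \<subseteq> carrier (fgrp q C)" using assms(3) by (simp add: fgrp_def)
  show "\<one>\<^bsub>fgrp q C\<^esub> \<in> N" using fsub_0[OF assms(1)] by (simp add: fgrp_def)
next
  fix c d assume "c \<in> N" "d \<in> N"
  then obtain x y where xy: "c = red q x" "d = red q y" "red q x \<in> N" "red q y \<in> N"
    using fsub_rep[OF assms(1)] by metis
  then show "c \<otimes>\<^bsub>fgrp q C\<^esub> d \<in> N" using fsub_add[OF assms(1)] by (simp add: fgrp_mult)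
next
  fix c assume c: "c \<in> N"
  then obtain x where x: "c = red q x" using fsub_rep[OF assms(1)] by metis
  then show "inv\<^bsub>fgrp q C\<^esub> c \<in> N"
    using fgrp_inv[OF assms(2), of x] fsub_minus[OF assms(1), of x] c assms(3) by auto
qed

lemma fgrp_subgroupD:
  assumes "subgroup N (fgrp q C)" "fsub q C"
  shows "fsub q N"
  unfolding fsub_def
proof (intro conjI allI impI)
  interpret subgroup N "fgrp q C" by fact
  have sub: "N \<subseteq> C" using subset by (simp add: fgrp_def)
  show "N \<subseteq> range (red q)" using sub assms(2) by (auto simp: fsub_def)
  show "(\<lambda>s. 0) \<in> N" using one_closed by (simp add: fgrp_def)
  fix x y assume xy: "red q x \<in> N" "red q y \<in> N"
  have "inv\<^bsub>fgrp q C\<^esub> (red q y) = red q (- y)" using xy sub by (intro fgrp_inv[OF assms(2)]) blast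
  then have "red q (- y) \<in> N" using m_inv_closed[OF xy(2)] by simp
  from m_closed[OF xy(1) this] show "red q (x - y) \<in> N" by (simp add: fgrp_mult)
qed

lemma mem_cls:
  assumes "fsub q N"
  shows "c \<in> cls q N x \<longleftrightarrow> (\<exists>y. c = red q y \<and> red q (y - x) \<in> N)"
proof
  assume "c \<in> cls q N x"
  then obtain n where n: "n \<in> N" "c = (\<lambda>s. (n s + red q x s) mod q)" by (auto simp: cls_def)
  then obtain z where "n = red q z" using fsub_rep[OF assms] by blast
  then have "red q z \<in> N" "c = red q (z + x)" using n by (simp_all add: red_add)
  then show "\<exists>y. c = red q y \<and> red q (y - x) \<in> N" by (intro exI[of _ "z + x"]) simp
next
  assume "\<exists>y. c = red q y \<and> red q (y - x) \<in> N"
  then obtain y where y: "c = red q y" "red q (y - x) \<in> N" by blast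
  then have "c = (\<lambda>s. (red q (y - x) s + red q x s) mod q)" using red_add[of q "y - x" x] by simp
  then show "c \<in> cls q N x" using y(2) unfolding cls_def by blast
qed

lemma cls_eq_iff:
  assumes N: "fsub q N"
  shows "cls q N x = cls q N y \<longleftrightarrow> red q (x - y) \<in> N"
proof
  assume "cls q N x = cls q N y"
  moreover have "red q x \<in> cls q N x" using fsub_0[OF N] by (subst mem_cls[OF N]) (intro exI[of _ x], simp)
  ultimately have "red q x \<in> cls q N y" by simp
  then obtain z where z: "red q x = red q z" "red q (z - y) \<in> N" unfolding mem_cls[OF N] by blast
  then have "red q (x - y) = red q (z - y)" by (simp add: red_diff)
  then show "red q (x - y) \<in> N" using z by simp
next
  assume xy: "red q (x - y) \<in> N"
  have "red q (z - x) \<in> N \<longleftrightarrow> red q (z - y) \<in> N" for z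
    using fsub_add[OF N _ xy, of "z - x"] fsub_diff[OF N _ xy, of "z - y"] by auto
  then show "cls q N x = cls q N y" unfolding set_eq_iff mem_cls[OF N] by simp
qed

lemma cls_conv_coset: "N #>\<^bsub>fgrp q C\<^esub> red q x = cls q N x"
  by (auto simp: r_coset_def cls_def fgrp_def)

lemma carrier_quot:
  assumes "fsub q C"
  shows "carrier (fgrp q C Mod N) = {cls q N x | x. red q x \<in> C}"
proof -
  have 1: "carrier (fgrp q C Mod N) = (\<lambda>c. N #>\<^bsub>fgrp q C\<^esub> c) ` C"
    by (auto simp: FactGroup_def RCOSETS_def fgrp_def)
  have 2: "C = {red q x | x. red q x \<in> C}" using fsub_rep[OF assms] by blast
  have "carrier (fgrp q C Mod N) = (\<lambda>c. N #>\<^bsub>fgrp q C\<^esub> c) ` {red q x | x. red q x \<in> C}"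
    using 1 2 by simp
  also have "\<dots> = {N #>\<^bsub>fgrp q C\<^esub> red q x | x. red q x \<in> C}" by blast
  finally show ?thesis by (simp add: cls_conv_coset)
qed

lemma quot_group:
  assumes "fsub q C" "fsub q N" "N \<subseteq> C"
  shows "comm_group (fgrp q C Mod N)"
  using comm_group.abelian_FactGroup[OF fgrp_comm_group[OF assms(1)] fgrp_subgroup[OF assms(2,1,3)]] .

lemma quot_mult:
  assumes "fsub q C" "fsub q N" "N \<subseteq> C" "red q x \<in> C" "red q y \<in> C"
  shows "cls q N x \<otimes>\<^bsub>fgrp q C Mod N\<^esub> cls q N y = cls q N (x + y)"
proof -
  interpret comm_group "fgrp q C" by (rule fgrp_comm_group[OF assms(1)])
  have "N \<lhd> fgrp q C" using fgrp_subgroup[OF assms(2,1,3)] subgroup_imp_normal by blast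
  then have "(N #>\<^bsub>fgrp q C\<^esub> red q x) <#>\<^bsub>fgrp q C\<^esub> (N #>\<^bsub>fgrp q C\<^esub> red q y)
      = N #>\<^bsub>fgrp q C\<^esub> (red q x \<otimes>\<^bsub>fgrp q C\<^esub> red q y)"
    by (rule normal.rcos_sum) (use assms(4,5) in \<open>simp_all add: fgrp_def\<close>)
  then show ?thesis by (simp add: cls_conv_coset fgrp_mult FactGroup_def)
qed

text \<open>The maps between quotients are defined by \<open>the_elem\<close> of an image, so their
  values must be constant on cosets. An additive \<open>F\<close> on representatives that carries
  \<open>N\<close> into \<open>N'\<close> ensures this. Two moduli occur because reduction of
  coefficients passes from 0 to \<open>p\<close>.\<close>

lemma induced_the_elem:
  assumes "fsub q C" "fsub q N" "N \<subseteq> C" "fsub r N'"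
    and diff: "\<And>x y. F (x - y) = F x - F y"
    and N: "\<And>x. red q x \<in> N \<Longrightarrow> red r (F x) \<in> N'"
    and \<Phi>: "\<And>x. red q x \<in> C \<Longrightarrow> \<Phi> (red q x) = cls r N' (F x)"
    and x: "red q x \<in> C"
  shows "the_elem (\<Phi> ` cls q N x) = cls r N' (F x)"
proof -
  have "\<Phi> c = cls r N' (F x)" if "c \<in> cls q N x" for c
  proof -
    obtain y where y: "c = red q y" "red q (y - x) \<in> N" using \<open>c \<in> cls q N x\<close> mem_cls[OF assms(2)] by metis
    have "red q (y - x) \<in> C" using y(2) assms(3) by blast
    then have "red q y \<in> C" using fsub_add[OF assms(1) _ x, of "y - x"] by simp
    then have "\<Phi> c = cls r N' (F y)" unfolding y(1) by (rule \<Phi>)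
    also have "\<dots> = cls r N' (F x)"
      using N[OF y(2)] unfolding diff by (simp only: cls_eq_iff[OF assms(4)])
    finally show ?thesis .
  qed
  then have "\<Phi> ` cls q N x = (\<lambda>c. cls r N' (F x)) ` cls q N x" by (rule image_cong[OF refl])
  moreover have "cls q N x \<noteq> {}" unfolding cls_def image_is_empty using fsub_0[OF assms(2)] by blast
  ultimately have "\<Phi> ` cls q N x = {cls r N' (F x)}" by (simp only: image_constant_conv if_False)
  then show ?thesis by simp
qed

lemma quot_homI:
  assumes "fsub q C" "fsub q N" "N \<subseteq> C" "fsub q C'" "fsub q N'" "N' \<subseteq> C'"
    and add: "\<And>x y. F (x + y) = F x + F y"
    and C: "\<And>x. red q x \<in> C \<Longrightarrow> red q (F x) \<in> C'"
    and \<phi>: "\<And>x. red q x \<in> C \<Longrightarrow> \<phi> (cls q N x) = cls q N' (F x)"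
  shows "\<phi> \<in> hom (fgrp q C Mod N) (fgrp q C' Mod N')"
proof (rule homI)
  fix X assume "X \<in> carrier (fgrp q C Mod N)"
  then obtain x where x: "X = cls q N x" "red q x \<in> C" unfolding carrier_quot[OF assms(1)] by blast
  then show "\<phi> X \<in> carrier (fgrp q C' Mod N')"
    unfolding carrier_quot[OF assms(4)] using C[OF x(2)] \<phi>[OF x(2)] by blast
next
  fix X Y assume "X \<in> carrier (fgrp q C Mod N)" "Y \<in> carrier (fgrp q C Mod N)"
  then obtain x y where xy: "X = cls q N x" "Y = cls q N y" "red q x \<in> C" "red q y \<in> C"
    unfolding carrier_quot[OF assms(1)] by blast
  have 1: "X \<otimes>\<^bsub>fgrp q C Mod N\<^esub> Y = cls q N (x + y)"
    unfolding xy by (rule quot_mult[OF assms(1-3) xy(3,4)])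
  have 2: "cls q N' (F x) \<otimes>\<^bsub>fgrp q C' Mod N'\<^esub> cls q N' (F y) = cls q N' (F x + F y)"
    by (rule quot_mult[OF assms(4-6) C[OF xy(3)] C[OF xy(4)]])
  show "\<phi> (X \<otimes>\<^bsub>fgrp q C Mod N\<^esub> Y) = \<phi> X \<otimes>\<^bsub>fgrp q C' Mod N'\<^esub> \<phi> Y"
    unfolding 1 \<phi>[OF fsub_add[OF assms(1) xy(3,4)]] unfolding xy(1,2) \<phi>[OF xy(3)] \<phi>[OF xy(4)] 2 add ..
qed

text \<open>The complement is the kernel of \<open>r\<close>: every \<open>h\<close> is the product
  of \<open>f (r h)\<close> and an element of that kernel.\<close>

lemma direct_summand_retract:
  assumes L: "group L" and H: "group H" and f: "f \<in> hom L H" and r: "r \<in> hom H L"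
    and rf: "\<And>x. x \<in> carrier L \<Longrightarrow> r (f x) = x"
  shows "f \<in> mon L H" "direct_summand (f ` carrier L) H"
proof -
  interpret f: group_hom L H f using assms by (simp add: group_hom_def group_hom_axioms_def)
  interpret r: group_hom H L r using assms by (simp add: group_hom_def group_hom_axioms_def)
  show "f \<in> mon L H" using f rf by (auto simp: mon_def intro: inj_on_inverseI)
  have "f ` carrier L \<inter> kernel H L r = {\<one>\<^bsub>H\<^esub>}"
    using rf f.hom_one f.G.one_closed by (auto simp: kernel_def image_iff intro!: bexI[of _ "\<one>\<^bsub>L\<^esub>"])
  moreover have "f ` carrier L <#>\<^bsub>H\<^esub> kernel H L r = carrier H"
  proof (intro equalityI subsetI)
    fix h assume h: "h \<in> carrier H"
    define a where "a = f (r h)"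
    have a: "a \<in> carrier H" "a \<in> f ` carrier L" "r a = r h" using h rf by (auto simp: a_def)
    have "inv\<^bsub>H\<^esub> a \<otimes>\<^bsub>H\<^esub> h \<in> kernel H L r" using a h by (auto simp: kernel_def)
    moreover have "h = a \<otimes>\<^bsub>H\<^esub> (inv\<^bsub>H\<^esub> a \<otimes>\<^bsub>H\<^esub> h)"
      using a h H by (simp add: group.inv_solve_left f.H.m_assoc[symmetric])
    ultimately show "h \<in> f ` carrier L <#>\<^bsub>H\<^esub> kernel H L r"
      using a unfolding set_mult_def by blast
  qed (auto simp: set_mult_def kernel_def)
  ultimately show "direct_summand (f ` carrier L) H"
    unfolding direct_summand_def
    using f.img_is_subgroup r.subgroup_kernel by blast
qed

section \<open>Chains modulo \<open>q\<close> as reductions of integral chains\<close>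

lemma comm_group_fields:
  fixes G :: "('a, 'b) monoid_scheme" and H :: "('a, 'c) monoid_scheme"
  assumes "comm_group H" "carrier G = carrier H" "monoid.mult G = monoid.mult H" "\<one>\<^bsub>G\<^esub> = \<one>\<^bsub>H\<^esub>"
  shows "comm_group G"
  using assms(1)
  unfolding comm_group_def comm_monoid_def group_def monoid_def comm_monoid_axioms_def group_axioms_def Units_def
    assms(2-4) .

text \<open>Fixing the record literally lets every ring operation be computed on integers modulo
  \<open>q\<close>. The condition \<open>one_mod\<close> admits \<open>q = 0\<close> and excludes
  \<open>q = 1\<close>.\<close>

locale mod_ring = R: cring R for R :: "int ring" (structure) +
  fixes q :: int
  assumes R_eq: "R = \<lparr>carrier = {a. a mod q = a}, monoid.mult = (\<lambda>x y. (x * y) mod q), one = 1,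
      zero = 0, add = (\<lambda>x y. (x + y) mod q)\<rparr>"
    and one_mod: "1 mod q = 1"
begin

lemma R_simps [simp]: "\<zero> = 0" "\<one> = 1" "a \<oplus> b = (a + b) mod q" "a \<otimes> b = (a * b) mod q"
  "a \<in> carrier R \<longleftrightarrow> a mod q = a"
  by (simp_all add: R_eq)

lemma fm_simps [simp]:
  "\<zero>\<^bsub>free_module R S\<^esub> = (\<lambda>s. 0)"
  "c \<oplus>\<^bsub>free_module R S\<^esub> d = (\<lambda>s. (c s + d s) mod q)"
  "r \<odot>\<^bsub>free_module R S\<^esub> c = (\<lambda>s. (r * c s) mod q)"
  by (simp_all add: free_module_def)

lemma red_mem_free: "red q x \<in> carrier (free_module R S) \<longleftrightarrow> (\<forall>s. red q x s \<noteq> 0 \<longrightarrow> s \<in> S)"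
proof -
  have "finite {s. red q x s \<noteq> 0}"
    by (rule finite_subset[OF _ finite_keys[of x]]) (auto simp: red_def in_keys_iff)
  then show ?thesis by (auto simp: free_module_def) (auto simp: red_def)
qed

lemma red_free_rep:
  assumes "c \<in> carrier (free_module R S)"
  shows "\<exists>x. Poly_Mapping.keys x \<subseteq> S \<and> c = red q x"
proof (intro exI conjI)
  have c: "\<And>s. c s mod q = c s" "finite {s. c s \<noteq> 0}" "{s. c s \<noteq> 0} \<subseteq> S"
    using assms by (auto simp: free_module_def)
  show "c = red q (Abs_poly_mapping c)" "Poly_Mapping.keys (Abs_poly_mapping c) \<subseteq> S"
    using c by (auto simp: red_def in_keys_iff)
qed

lemma red_keys_free: "Poly_Mapping.keys x \<subseteq> S \<Longrightarrow> red q x \<in> carrier (free_module R S)"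
  by (auto simp: red_mem_free) (metis in_keys_iff mod_0 red_def subsetD)

lemma fsub_free: "fsub q (carrier (free_module R S))"
  unfolding fsub_def
proof (intro conjI allI impI)
  show "carrier (free_module R S) \<subseteq> range (red q)" using red_free_rep by fastforce
  show "(\<lambda>s. 0) \<in> carrier (free_module R S)" by (simp add: free_module_def)
  fix x y
  assume "red q x \<in> carrier (free_module R S)" "red q y \<in> carrier (free_module R S)"
  then show "red q (x - y) \<in> carrier (free_module R S)"
    unfolding red_mem_free by (auto simp: red_def lookup_minus) (metis diff_zero mod_0 mod_diff_cong)
qed

lemma free_comm_group: "comm_group (add_monoid (free_module R S))"
  by (rule comm_group_fields[OF fgrp_comm_group[OF fsub_free[of S]]]) (simp_all add: fgrp_def free_module_def)

lemma free_minus: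
  assumes "red q y \<in> carrier (free_module R S)"
  shows "red q x \<ominus>\<^bsub>free_module R S\<^esub> red q y = red q (x - y)"
proof -
  have "\<ominus>\<^bsub>free_module R S\<^esub> red q y = red q (- y)"
    using fgrp_inv[OF fsub_free assms] unfolding a_inv_def m_inv_def by (simp add: fgrp_def)
  then show ?thesis using red_add[of q x "- y"] by (simp add: a_minus_def)
qed

lemma basis_elt_red: "basis_elt R s = red q (frag_of s)"
  by (auto simp: basis_elt_def red_def one_mod)

lemma smult_red: "r \<odot>\<^bsub>free_module R S\<^esub> red q x = red q (frag_cmul r x)"
  by (simp add: red_def mod_mult_right_eq)

lemma add_red: "red q x \<oplus>\<^bsub>free_module R S\<^esub> red q y = red q (x + y)"
  by (simp add: red_add)

lemma finsum_red:
  assumes "finite I"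
  shows "(\<Oplus>\<^bsub>free_module R UNIV\<^esub>i\<in>I. red q (g i)) = red q (\<Sum>i\<in>I. g i)"
proof -
  interpret comm_group "add_monoid (free_module R UNIV)" by (rule free_comm_group)
  interpret F: abelian_monoid "free_module R UNIV" by unfold_locales
  show ?thesis
    using assms
  proof (induction I rule: finite_induct)
    case (insert i I)
    have "red q (g j) \<in> carrier (free_module R UNIV)" for j by (simp add: red_mem_free)
    then show ?case using insert by (subst F.finsum_insert) (auto simp: add_red simp del: fm_simps)
  next
    case empty
    show ?case unfolding F.finsum_empty by simp
  qed
qed

text \<open>Keys lost under reduction have coefficients divisible by \<open>q\<close>, so summing
  over the smaller support changes nothing modulo \<open>q\<close>. Since \<open>push\<close>,
  \<open>shuffle_product\<close> and \<open>bar_boundary\<close> are built with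
  \<open>lin_ext\<close>, this transfers all of them to integral chains.\<close>

lemma lin_ext_red:
  assumes "\<And>s. s \<in> Poly_Mapping.keys x \<Longrightarrow> f s = red q (f' s)"
  shows "lin_ext R f (red q x) = red q (frag_extend f' x)"
proof -
  let ?I = "{s. red q x s \<noteq> 0}"
  have sub: "?I \<subseteq> Poly_Mapping.keys x" by (auto simp: red_def in_keys_iff)
  then have fin: "finite ?I" by (rule finite_subset) simp
  have "lin_ext R f (red q x) = (\<Oplus>\<^bsub>free_module R UNIV\<^esub>s\<in>?I. red q x s \<odot>\<^bsub>free_module R UNIV\<^esub> f s)"
    by (simp add: lin_ext_def)
  also have "\<dots> = (\<Oplus>\<^bsub>free_module R UNIV\<^esub>s\<in>?I. red q (frag_cmul (red q x s) (f' s)))"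
    unfolding finsum_def
  proof (rule comm_monoid.finprod_cong)
    show "comm_monoid (add_monoid (free_module R UNIV))"
      using free_comm_group by (rule comm_group.axioms)
  qed (use sub assms in \<open>auto simp: smult_red red_mem_free simp_implies_def simp del: fm_simps\<close>)
  also have "\<dots> = red q (\<Sum>s\<in>?I. frag_cmul (red q x s) (f' s))" by (rule finsum_red[OF fin])
  also have "\<dots> = red q (frag_extend f' x)"
  proof (rule ext)
    fix u
    let ?X = "\<lambda>s. poly_mapping.lookup x s" and ?f = "\<lambda>s. poly_mapping.lookup (f' s) u"
    have "(\<Sum>s\<in>?I. red q x s * ?f s) = (\<Sum>s\<in>Poly_Mapping.keys x. red q x s * ?f s)"
      by (rule sum.mono_neutral_left) (use sub in auto)
    moreover have "(\<Sum>s\<in>Poly_Mapping.keys x. red q x s * ?f s) mod q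
        = (\<Sum>s\<in>Poly_Mapping.keys x. ?X s * ?f s) mod q"
    proof -
      have "(\<Sum>s\<in>Poly_Mapping.keys x. (red q x s * ?f s) mod q) mod q
          = (\<Sum>s\<in>Poly_Mapping.keys x. (?X s * ?f s) mod q) mod q"
        by (simp add: red_def mod_mult_left_eq)
      then show ?thesis by (simp add: mod_sum_eq)
    qed
    ultimately show "red q (\<Sum>s\<in>?I. frag_cmul (red q x s) (f' s)) u = red q (frag_extend f' x) u"
      by (simp add: red_def[of q "sum _ _"] red_def[of q "frag_extend f' x"] frag_extend_def lookup_sum)
  qed
  finally show ?thesis .
qed

lemma push_red: "push R f (red q x) = red q (fmap f x)"
  unfolding push_def fmap_def by (rule lin_ext_red) (simp add: basis_elt_red)

lemma minus_one: "\<ominus> \<one> = (- 1) mod q"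
proof -
  have "(- 1) mod q \<oplus> \<one> = \<zero>" by (simp add: mod_simps)
  then show ?thesis by (intro R.minus_equality) (auto simp: one_mod)
qed

lemma sign_in_red: "sign_in R k = (- 1) ^ k mod q"
  unfolding sign_in_def minus_one
  by (induction k) (auto simp: one_mod mod_simps)

lemma sign_smult_red: "sign_in R k \<odot>\<^bsub>free_module R S\<^esub> red q x = red q (frag_cmul ((- 1) ^ k) x)"
  by (simp add: red_def sign_in_red mod_mult_eq)

lemma shuffle_red: "shuffle R [x] ys = red q (ins x ys)"
  by (induction ys)
    (simp_all add: basis_elt_red push_red sign_smult_red add_red del: fm_simps)

lemma pontryagin_cycle_red: "pontryagin_cycle R as = red q (pont as)"
proof (induction as)
  case (Cons a as)
  have 1: "lin_ext R (shuffle R [a]) (red q (pont as)) = red q (Ins a (pont as))"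
    by (rule lin_ext_red) (rule shuffle_red)
  have "shuffle_product R (red q (frag_of [a])) (red q (pont as))
      = red q (frag_extend (\<lambda>xs. Ins a (pont as)) (frag_of [a]))"
    unfolding shuffle_product_def by (rule lin_ext_red) (simp add: 1)
  then show ?case by (simp add: Cons basis_elt_red)
qed (simp add: basis_elt_red)

end

section \<open>The integral bar differential\<close>

lemma bar_tail_faces:
  "bar_tail (monoid.mult G) xs x
     = (\<Sum>j\<le>length xs. frag_cmul ((- 1) ^ j) (frag_of (bar_face G (Suc j) (x # xs))))"
proof (induction xs arbitrary: x)
  case Nil
  then show ?case by (simp add: bar_face_def)
next
  case (Cons y ys)
  \<comment> \<open>From index 2 on, a face keeps the letter \<open>x\<close> and is a face of the
    shorter word with \<open>x\<close> put in front; the shift of the index produces the minus sign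
    in \<open>bar_tail\<close>.\<close>
  have face: "bar_face G (Suc (Suc j)) (x # y # ys) = x # bar_face G (Suc j) (y # ys)" for j
    by (auto simp: bar_face_def)
  have "fmap (Cons x) (bar_tail (monoid.mult G) ys y)
     = (\<Sum>j\<le>length ys. frag_cmul ((- 1) ^ j) (frag_of (bar_face G (Suc (Suc j)) (x # y # ys))))"
    unfolding Cons face fmap_def by (simp add: frag_extend_sum o_def frag_extend_cmul)
  then show ?case
    by (simp add: sum.atMost_Suc_shift sum_negf[symmetric] bar_face_def del: sum.atMost_Suc)
qed

lemma bar_diff_faces:
  assumes "gs \<noteq> []"
  shows "bar_diff (monoid.mult G) gs
     = (\<Sum>j\<le>length gs. frag_cmul ((- 1) ^ j) (frag_of (bar_face G j gs)))"
proof -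
  obtain x xs where gs: "gs = x # xs" using assms by (cases gs) auto
  have "- bar_tail (monoid.mult G) xs x
      = (\<Sum>j\<le>length xs. frag_cmul ((- 1) ^ Suc j) (frag_of (bar_face G (Suc j) (x # xs))))"
    unfolding bar_tail_faces sum_negf[symmetric] by simp
  moreover have "bar_face G 0 (x # xs) = xs" by (simp add: bar_face_def)
  ultimately show ?thesis
    unfolding gs list.size add_Suc_right add_0_right sum.atMost_Suc_shift
    by (simp only: bar_diff.simps diff_conv_add_uminus power_0 frag_cmul_one)
qed

lemma keys_bar_tail:
  assumes "\<And>x y. x \<in> C \<Longrightarrow> y \<in> C \<Longrightarrow> m x y \<in> C" "x \<in> C" "set xs \<subseteq> C"
  shows "Poly_Mapping.keys (bar_tail m xs x) \<subseteq> tuples (length xs) C"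
  using assms(2,3)
proof (induction xs arbitrary: x)
  case (Cons y ys)
  have "Poly_Mapping.keys (fmap (Cons x) (bar_tail m ys y)) \<subseteq> tuples (length (y # ys)) C"
    using keys_fmap[of "Cons x" "bar_tail m ys y"] Cons.IH[of y] Cons.prems by (fastforce simp: tuples_def)
  moreover have "m x y # ys \<in> tuples (length (y # ys)) C"
    using Cons.prems assms(1) by (auto simp: tuples_def)
  ultimately show ?case
    using keys_diff[of "frag_of (m x y # ys)" "fmap (Cons x) (bar_tail m ys y)"] by auto
qed (simp add: tuples_def)

lemma keys_Bd:
  assumes "\<And>x y. x \<in> C \<Longrightarrow> y \<in> C \<Longrightarrow> m x y \<in> C" "Poly_Mapping.keys z \<subseteq> tuples (Suc n) C"
  shows "Poly_Mapping.keys (Bd m z) \<subseteq> tuples n C"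
proof -
  have "Poly_Mapping.keys (bar_diff m gs) \<subseteq> tuples n C" if "gs \<in> tuples (Suc n) C" for gs
  proof -
    obtain x xs where gs: "gs = x # xs" "x \<in> C" "set xs \<subseteq> C" "length xs = n"
      using \<open>gs \<in> tuples (Suc n) C\<close> by (cases gs) (auto simp: tuples_def)
    then show ?thesis
      using keys_diff[of "frag_of xs" "bar_tail m xs x"] keys_bar_tail[of C m x xs, OF assms(1)]
      by (auto simp: tuples_def)
  qed
  then show ?thesis using keys_frag_extend[of "bar_diff m" z] assms(2) by fastforce
qed

text \<open>By induction the terms that keep \<open>x\<close> in front cancel, and associativity
  matches \<open>m x (m y z)\<close> with \<open>m (m x y) z\<close> in the rest. It is the share of
  the identity \<open>Bd_Bd\<close> that does not involve the zeroth face.\<close>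

lemma Bt_bar_tail:
  assumes "\<And>x y z. x \<in> C \<Longrightarrow> y \<in> C \<Longrightarrow> z \<in> C \<Longrightarrow> m (m x y) z = m x (m y z)"
    and "x \<in> C" "y \<in> C" "set ys \<subseteq> C"
  shows "Bt m x (bar_tail m ys y) = bar_tail m ys (m x y)"
  using assms(2-)
  by (induction ys arbitrary: x y) (simp_all add: ch_simps assms(1))

lemma Bd_Bd:
  assumes "\<And>x y z. x \<in> C \<Longrightarrow> y \<in> C \<Longrightarrow> z \<in> C \<Longrightarrow> m (m x y) z = m x (m y z)"
    and "\<And>xs. xs \<in> Poly_Mapping.keys z \<Longrightarrow> set xs \<subseteq> C"
  shows "Bd m (Bd m z) = 0"
  unfolding frag_extend_extend
proof (rule frag_extend_eq_0)
  fix xs assume "xs \<in> Poly_Mapping.keys z"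
  then have xs: "set xs \<subseteq> C" by (rule assms(2))
  have "Bd m (bar_tail m ys x) = bar_diff m ys" if "x \<in> C" "set ys \<subseteq> C" for x ys
  proof (cases ys)
    case (Cons y zs)
    have "Bt m x (bar_tail m zs y) = bar_tail m zs (m x y)"
      by (rule Bt_bar_tail[where C = C]) (use that Cons assms(1) in auto)
    then show ?thesis using Cons by (simp add: ch_simps)
  qed simp
  then show "Bd m (bar_diff m xs) = 0" using xs by (cases xs) (simp_all add: ch_simps)
qed

lemma fmap_bar_tail:
  assumes "\<And>x y. x \<in> C \<Longrightarrow> y \<in> C \<Longrightarrow> \<phi> (m x y) = m' (\<phi> x) (\<phi> y)" "x \<in> C" "set xs \<subseteq> C"
  shows "fmap (map \<phi>) (bar_tail m xs x) = bar_tail m' (map \<phi> xs) (\<phi> x)"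
  using assms(2-)
proof (induction xs arbitrary: x)
  case (Cons y ys)
  have "fmap (map \<phi>) (fmap (Cons x) z) = fmap (Cons (\<phi> x)) (fmap (map \<phi>) z)" for z
    by (simp add: fmap_fmap)
  then show ?case using Cons by (simp add: fmap_diff assms(1))
qed simp

lemma fmap_Bd:
  assumes "\<And>x y. x \<in> C \<Longrightarrow> y \<in> C \<Longrightarrow> \<phi> (m x y) = m' (\<phi> x) (\<phi> y)"
    and "\<And>xs. xs \<in> Poly_Mapping.keys z \<Longrightarrow> set xs \<subseteq> C"
  shows "fmap (map \<phi>) (Bd m z) = Bd m' (fmap (map \<phi>) z)"
  unfolding frag_extend_fmap fmap_extend
proof (rule frag_extend_eq)
  fix xs assume "xs \<in> Poly_Mapping.keys z"
  then have "set xs \<subseteq> C" by (rule assms(2))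
  then show "fmap (map \<phi>) (bar_diff m xs) = bar_diff m' (map \<phi> xs)"
    by (cases xs) (simp_all add: fmap_diff fmap_bar_tail[of C \<phi> m m'] assms(1))
qed

lemma fmap_pont: "fmap (map \<phi>) (pont as) = pont (map \<phi> as)"
proof (induction as)
  case (Cons a as)
  have "fmap (map \<phi>) (ins a ys) = ins (\<phi> a) (map \<phi> ys)" for ys
    by (induction ys) (simp_all add: fmap_diff fmap_fmap, simp flip: fmap_fmap)
  then have "fmap (map \<phi>) (Ins a z) = Ins (\<phi> a) (fmap (map \<phi>) z)" for z
    by (simp add: fmap_extend frag_extend_fmap)
  then show ?case using Cons by simp
qed simp

context mod_ring
begin

lemma bar_boundary_red: "bar_boundary R G (red q x) = red q (Bd (monoid.mult G) x)"
  unfolding bar_boundary_def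
proof (rule lin_ext_red)
  fix gs
  show "(if gs = [] then \<zero>\<^bsub>free_module R UNIV\<^esub>
     else (\<Oplus>\<^bsub>free_module R UNIV\<^esub>j\<in>{..length gs}.
             sign_in R j \<odot>\<^bsub>free_module R UNIV\<^esub> basis_elt R (bar_face G j gs)))
    = red q (bar_diff (monoid.mult G) gs)"
    by (simp add: basis_elt_red sign_smult_red finsum_red bar_diff_faces del: fm_simps)
      (simp add: fm_simps)
qed

text \<open>An integral representative of a cycle need not be an integral cycle: its boundary
  vanishes only modulo \<open>q\<close>, and it may contain foreign words with coefficients
  divisible by \<open>q\<close>.\<close>

lemma bar_cycles_iff:
  "red q x \<in> bar_cycles R G n
     \<longleftrightarrow> red q x \<in> carrier (bar_chains R G n) \<and> red q (Bd (monoid.mult G) x) = (\<lambda>s. 0)"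
  by (simp add: bar_cycles_def bar_boundary_red)

lemma bar_boundaries_iff:
  "c \<in> bar_boundaries R G n
     \<longleftrightarrow> (\<exists>y. Poly_Mapping.keys y \<subseteq> tuples (Suc n) (carrier G) \<and> c = red q (Bd (monoid.mult G) y))"
proof
  assume "c \<in> bar_boundaries R G n"
  then obtain d where d: "d \<in> carrier (bar_chains R G (Suc n))" "c = bar_boundary R G d"
    by (auto simp: bar_boundaries_def)
  then obtain y where "Poly_Mapping.keys y \<subseteq> tuples (Suc n) (carrier G)" "d = red q y"
    using red_free_rep by blast
  then show "\<exists>y. Poly_Mapping.keys y \<subseteq> tuples (Suc n) (carrier G) \<and> c = red q (Bd (monoid.mult G) y)"
    using d by (auto simp: bar_boundary_red)
next
  assume "\<exists>y. Poly_Mapping.keys y \<subseteq> tuples (Suc n) (carrier G) \<and> c = red q (Bd (monoid.mult G) y)"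
  then show "c \<in> bar_boundaries R G n"
    by (auto simp: bar_boundaries_def bar_boundary_red[symmetric] intro!: imageI red_keys_free)
qed

lemma fsub_cycles: "fsub q (bar_cycles R G n)"
  unfolding fsub_def
proof (intro conjI allI impI)
  show "bar_cycles R G n \<subseteq> range (red q)" using red_free_rep by (fastforce simp: bar_cycles_def)
  show "(\<lambda>s. 0) \<in> bar_cycles R G n"
    using bar_cycles_iff[of 0 G n] fsub_0[OF fsub_free[of "tuples n (carrier G)"]] by simp
  fix x y assume "red q x \<in> bar_cycles R G n" "red q y \<in> bar_cycles R G n"
  then show "red q (x - y) \<in> bar_cycles R G n"
    unfolding bar_cycles_iff frag_extend_diff
    by (simp add: fsub_diff[OF fsub_free]) (simp add: red_diff)
qed

lemma fsub_boundaries: "fsub q (bar_boundaries R G n)"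
  unfolding fsub_def
proof (intro conjI allI impI)
  show "bar_boundaries R G n \<subseteq> range (red q)" by (auto simp: bar_boundaries_iff)
  show "(\<lambda>s. 0) \<in> bar_boundaries R G n"
    unfolding bar_boundaries_iff by (rule exI[of _ 0]) simp
  fix x y assume "red q x \<in> bar_boundaries R G n" "red q y \<in> bar_boundaries R G n"
  then obtain x' y' where xy: "Poly_Mapping.keys x' \<subseteq> tuples (Suc n) (carrier G)" "red q x = red q (Bd (monoid.mult G) x')"
    "Poly_Mapping.keys y' \<subseteq> tuples (Suc n) (carrier G)" "red q y = red q (Bd (monoid.mult G) y')"
    unfolding bar_boundaries_iff by blast
  have "red q (x - y) = red q (Bd (monoid.mult G) (x' - y'))"
    using xy(2,4) unfolding frag_extend_diff
    by (auto simp: red_def fun_eq_iff lookup_minus intro: mod_diff_cong)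
  then show "red q (x - y) \<in> bar_boundaries R G n"
    unfolding bar_boundaries_iff
    using keys_diff[of x' y'] xy(1,3) by (intro exI[of _ "x' - y'"]) auto
qed

lemma boundaries_subset_cycles:
  assumes "\<And>x y. x \<in> carrier G \<Longrightarrow> y \<in> carrier G \<Longrightarrow> x \<otimes>\<^bsub>G\<^esub> y \<in> carrier G"
    "\<And>x y z. x \<in> carrier G \<Longrightarrow> y \<in> carrier G \<Longrightarrow> z \<in> carrier G \<Longrightarrow> (x \<otimes>\<^bsub>G\<^esub> y) \<otimes>\<^bsub>G\<^esub> z = x \<otimes>\<^bsub>G\<^esub> (y \<otimes>\<^bsub>G\<^esub> z)"
  shows "bar_boundaries R G n \<subseteq> bar_cycles R G n"
proof
  fix c assume "c \<in> bar_boundaries R G n"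
  then obtain y where y: "Poly_Mapping.keys y \<subseteq> tuples (Suc n) (carrier G)" "c = red q (Bd (monoid.mult G) y)"
    unfolding bar_boundaries_iff by blast
  have "Bd (monoid.mult G) (Bd (monoid.mult G) y) = 0"
    by (rule Bd_Bd[where C = "carrier G"]) (use y assms(2) in \<open>auto simp: tuples_def\<close>)
  then show "c \<in> bar_cycles R G n"
    unfolding y(2) bar_cycles_iff using keys_Bd[of "carrier G" "monoid.mult G" y n] y assms(1)
    by (auto intro: red_keys_free)
qed

lemma homology_quot: "group_homology R G n = fgrp q (bar_cycles R G n) Mod bar_boundaries R G n"
  unfolding group_homology_def A_FactGroup_def FactGroup_def RCOSETS_def r_coset_def set_mult_def
  by (simp add: fgrp_def)

lemma coset_cls: "N +>\<^bsub>free_module R UNIV\<^esub> red q x = cls q N x"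
  by (auto simp: a_r_coset_def r_coset_def cls_def)

lemma homology_class_red: "homology_class R G n (red q x) = cls q (bar_boundaries R G n) x"
  by (simp add: homology_class_def coset_cls)

lemma red_free_rep':
  assumes "red q x \<in> carrier (free_module R S)"
  obtains y where "Poly_Mapping.keys y \<subseteq> S" "red q x = red q y"
  using red_free_rep[OF assms] by metis

section \<open>Functoriality of group homology\<close>

lemma fmap_cycles:
  assumes hom: "\<And>x. x \<in> carrier G \<Longrightarrow> \<phi> x \<in> carrier H"
    "\<And>x y. x \<in> carrier G \<Longrightarrow> y \<in> carrier G \<Longrightarrow> \<phi> (x \<otimes>\<^bsub>G\<^esub> y) = \<phi> x \<otimes>\<^bsub>H\<^esub> \<phi> y"
    and x: "red q x \<in> bar_cycles R G n"
  shows "red q (fmap (map \<phi>) x) \<in> bar_cycles R H n"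
proof -
  have "red q x \<in> carrier (bar_chains R G n)" and bd: "red q (Bd (monoid.mult G) x) = (\<lambda>s. 0)"
    using x by (simp_all add: bar_cycles_iff)
  \<comment> \<open>The representative is replaced by one supported on words over \<open>G\<close>,
    because \<open>\<phi>\<close> is known to be multiplicative only there.\<close>
  then obtain y where y: "Poly_Mapping.keys y \<subseteq> tuples n (carrier G)" "red q x = red q y"
    using red_free_rep' by metis
  have keys: "Poly_Mapping.keys (fmap (map \<phi>) y) \<subseteq> tuples n (carrier H)"
    using keys_fmap[of "map \<phi>" y] y(1) hom(1) by (fastforce simp: tuples_def)
  have "fmap (map \<phi>) (Bd (monoid.mult G) y) = Bd (monoid.mult H) (fmap (map \<phi>) y)"
    by (rule fmap_Bd[where C = "carrier G"]) (use y hom(2) in \<open>auto simp: tuples_def\<close>)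
  moreover have "red q (Bd (monoid.mult G) y) = red q 0" using bd red_extend_cong[OF y(2), of "bar_diff (monoid.mult G)"] by simp
  ultimately have "red q (Bd (monoid.mult H) (fmap (map \<phi>) y)) = (\<lambda>s. 0)"
    using red_fmap_cong[of q "Bd (monoid.mult G) y" 0 "map \<phi>"] by simp
  then have "red q (fmap (map \<phi>) y) \<in> bar_cycles R H n"
    using red_keys_free[OF keys] by (simp add: bar_cycles_iff)
  then show ?thesis using red_fmap_cong[OF y(2), of "map \<phi>"] by simp
qed

lemma fmap_boundaries:
  assumes hom: "\<And>x. x \<in> carrier G \<Longrightarrow> \<phi> x \<in> carrier H"
    "\<And>x y. x \<in> carrier G \<Longrightarrow> y \<in> carrier G \<Longrightarrow> \<phi> (x \<otimes>\<^bsub>G\<^esub> y) = \<phi> x \<otimes>\<^bsub>H\<^esub> \<phi> y"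
    and x: "red q x \<in> bar_boundaries R G n"
  shows "red q (fmap (map \<phi>) x) \<in> bar_boundaries R H n"
proof -
  obtain y where y: "Poly_Mapping.keys y \<subseteq> tuples (Suc n) (carrier G)" "red q x = red q (Bd (monoid.mult G) y)"
    using x bar_boundaries_iff by metis
  have keys: "Poly_Mapping.keys (fmap (map \<phi>) y) \<subseteq> tuples (Suc n) (carrier H)"
    using keys_fmap[of "map \<phi>" y] y(1) hom(1) by (fastforce simp: tuples_def)
  have "fmap (map \<phi>) (Bd (monoid.mult G) y) = Bd (monoid.mult H) (fmap (map \<phi>) y)"
    by (rule fmap_Bd[where C = "carrier G"]) (use y hom(2) in \<open>auto simp: tuples_def\<close>)
  then have "red q (fmap (map \<phi>) x) = red q (Bd (monoid.mult H) (fmap (map \<phi>) y))"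
    using red_fmap_cong[OF y(2), of "map \<phi>"] by simp
  then show ?thesis using keys bar_boundaries_iff by metis
qed

lemma homology_map_cls:
  assumes hom: "\<And>x. x \<in> carrier G \<Longrightarrow> \<phi> x \<in> carrier H"
    "\<And>x y. x \<in> carrier G \<Longrightarrow> y \<in> carrier G \<Longrightarrow> \<phi> (x \<otimes>\<^bsub>G\<^esub> y) = \<phi> x \<otimes>\<^bsub>H\<^esub> \<phi> y"
    and G: "bar_boundaries R G n \<subseteq> bar_cycles R G n"
    and x: "red q x \<in> bar_cycles R G n"
  shows "homology_map R H n \<phi> (cls q (bar_boundaries R G n) x) = cls q (bar_boundaries R H n) (fmap (map \<phi>) x)"
  unfolding homology_map_def
  by (rule induced_the_elem[OF fsub_cycles fsub_boundaries G fsub_boundaries fmap_diff fmap_boundaries[OF hom] _ x])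
    (simp_all add: push_red homology_class_red)

end

section \<open>The retraction of the elementary group onto the polynomials without constant term\<close>

type_synonym quad = "int \<times> int \<times> int \<times> int"

text \<open>\<open>(a, b, c, d)\<close> is the integral matrix with rows \<open>(a, b)\<close> and
  \<open>(c, d)\<close>, acting on column vectors. Acting by scalars it cannot raise the maximal
  degree, in contrast to \<open>shear\<close>, the action of \<open>U(f)\<close>.\<close>

fun quad_act :: "quad \<Rightarrow> int poly \<times> int poly \<Rightarrow> int poly \<times> int poly" where
  "quad_act (a, b, c, d) (p, q)
     = (Polynomial.smult a p + Polynomial.smult b q, Polynomial.smult c p + Polynomial.smult d q)"

fun quad_mult :: "quad \<Rightarrow> quad \<Rightarrow> quad" where
  "quad_mult (a, b, c, d) (a', b', c', d')
     = (a * a' + b * c', a * b' + b * d', c * a' + d * c', c * b' + d * d')"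

fun quad_adj :: "quad \<Rightarrow> quad" where
  "quad_adj (a, b, c, d) = (d, - b, - c, a)"

fun lower_left :: "quad \<Rightarrow> int" where
  "lower_left (a, b, c, d) = c"

definition SL2Z :: "quad set" where
  "SL2Z = {(a, b, c, d). a * d - b * c = 1}"

definition quad_one :: quad where
  "quad_one = (1, 0, 0, 1)"

fun shear :: "int poly \<Rightarrow> int poly \<times> int poly \<Rightarrow> int poly \<times> int poly" where
  "shear f (p, q) = (p + f * q, q)"

lemma quad_act_mult: "quad_act (quad_mult M N) v = quad_act M (quad_act N v)"
  by (cases M; cases N; cases v) (simp add: smult_add_left smult_add_right algebra_simps)

lemma quad_mult_SL2Z: "M \<in> SL2Z \<Longrightarrow> N \<in> SL2Z \<Longrightarrow> quad_mult M N \<in> SL2Z"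
proof (cases M; cases N)
  fix a b c d a' b' c' d'
  assume "M \<in> SL2Z" "N \<in> SL2Z" and eq: "M = (a, b, c, d)" "N = (a', b', c', d')"
  then have "a * d - b * c = 1" "a' * d' - b' * c' = 1" by (auto simp: SL2Z_def)
  moreover have "(a * a' + b * c') * (c * b' + d * d') - (a * b' + b * d') * (c * a' + d * c')
     = (a * d - b * c) * (a' * d' - b' * c')" by (simp add: algebra_simps)
  ultimately show ?thesis by (simp add: eq SL2Z_def)
qed

lemma quad_adj_SL2Z: "M \<in> SL2Z \<Longrightarrow> quad_adj M \<in> SL2Z"
  by (cases M) (auto simp: SL2Z_def algebra_simps)

lemma quad_one_SL2Z: "quad_one \<in> SL2Z"
  by (simp add: SL2Z_def quad_one_def)

lemma quad_act_one: "quad_act quad_one v = v"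
  by (cases v) (simp add: quad_one_def)

lemma quad_mult_adj:
  "M \<in> SL2Z \<Longrightarrow> quad_mult (quad_adj M) M = quad_one" "M \<in> SL2Z \<Longrightarrow> quad_mult M (quad_adj M) = quad_one"
  by (cases M; simp add: SL2Z_def quad_one_def algebra_simps)+

lemma quad_act_adj:
  assumes "M \<in> SL2Z"
  shows "quad_act (quad_adj M) (quad_act M v) = v" "quad_act M (quad_act (quad_adj M) v) = v"
  using assms by (simp_all add: quad_act_mult[symmetric] quad_mult_adj quad_act_one)

lemma shear_0: "shear 0 v = v"
  by (cases v) simp

lemma shear_add: "shear f (shear g v) = shear (f + g) v"
  by (cases v) (simp add: algebra_simps)

text \<open>The only units of the integers are 1 and -1, so \<open>M\<close> is plus or minus a
  unipotent upper triangular matrix.\<close>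

lemma shear_quad_act:
  assumes "M \<in> SL2Z" "lower_left M = 0"
  shows "shear f (quad_act M v) = quad_act M (shear f v)"
proof -
  obtain a b c d where M: "M = (a, b, c, d)" by (cases M)
  have ad: "a * d = 1" "c = 0" using assms by (auto simp: M SL2Z_def)
  then have "a = d" by (auto simp: zmult_eq_1_iff)
  then show ?thesis using ad
    by (cases v) (simp add: M smult_add_right algebra_simps)
qed

text \<open>The word \<open>[(M\<^sub>1, f\<^sub>1), \<dots>, (M\<^sub>k, f\<^sub>k)]\<close> stands for the product \<open>M\<^sub>1 U(f\<^sub>1) \<cdots> M\<^sub>k U(f\<^sub>k)\<close>,
  where \<open>U(f)\<close> is the upper elementary matrix.\<close>

type_synonym mword = "(quad \<times> int poly) list"

primrec word_act :: "mword \<Rightarrow> int poly \<times> int poly \<Rightarrow> int poly \<times> int poly" where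
  "word_act [] v = v"
| "word_act (x # w) v = quad_act (fst x) (shear (snd x) (word_act w v))"

definition valid_word :: "mword \<Rightarrow> bool" where
  "valid_word w \<longleftrightarrow> (\<forall>(M, f) \<in> set w. M \<in> SL2Z \<and> Polynomial.coeff f 0 = 0)"

definition word_sum :: "mword \<Rightarrow> int poly" where
  "word_sum w = sum_list (map snd w)"

lemma word_act_append: "word_act (u @ w) v = word_act u (word_act w v)"
  by (induction u) simp_all

lemma degree_pos: "Polynomial.coeff f 0 = 0 \<Longrightarrow> f \<noteq> 0 \<Longrightarrow> Polynomial.degree f > 0"
  by (metis gr0I leading_coeff_0_iff)

text \<open>A ping-pong argument: a matrix with nonzero lower left entry carries the dominant degree
  from the first coordinate to the second, and the next nonconstant shear makes the first coordinate
  dominant again. The leading matrix is not applied, so its lower left entry is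
  unrestricted.\<close>

lemma reduced_word_degree:
  assumes "valid_word w" "w \<noteq> []" "\<forall>x \<in> set w. snd x \<noteq> 0" "\<forall>x \<in> set (tl w). lower_left (fst x) \<noteq> 0"
    and pq: "shear (snd (hd w)) (word_act (tl w) (0, 1)) = (p, q)"
  shows "q \<noteq> 0 \<and> Polynomial.degree q < Polynomial.degree p"
  using assms
proof (induction w arbitrary: p q)
  case (Cons x w)
  have f: "Polynomial.degree (snd x) > 0" "snd x \<noteq> 0"
    using Cons.prems by (auto simp: valid_word_def intro: degree_pos)
  obtain p' q' where v: "word_act w (0, 1) = (p', q')" by fastforce
  have *: "q' \<noteq> 0 \<and> Polynomial.degree p' \<le> Polynomial.degree q'"
  proof (cases w)
    \<comment> \<open>The start vector is \<open>(0, 1)\<close>; the zero polynomial has degree 0,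
      so the weak inequality holds.\<close>
    case Nil
    then show ?thesis using v by auto
  next
    case (Cons y u)
    obtain r s where rs: "shear (snd y) (word_act u (0, 1)) = (r, s)" by fastforce
    have "s \<noteq> 0 \<and> Polynomial.degree s < Polynomial.degree r"
      using Cons.IH[of r s] Cons.prems rs Cons by (auto simp: valid_word_def)
    moreover obtain a b c d where M: "fst y = (a, b, c, d)" by (cases "fst y")
    moreover have "c \<noteq> 0" using Cons.prems Cons M by auto
    ultimately have "Polynomial.degree (Polynomial.smult c r + Polynomial.smult d s) = Polynomial.degree r"
      and "Polynomial.degree (Polynomial.smult a r + Polynomial.smult b s) \<le> Polynomial.degree r"
      using degree_smult_le[of d s] degree_smult_le[of b s] degree_smult_le[of a r]
      by (auto intro!: degree_add_le simp: degree_add_eq_left)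
    moreover have "p' = Polynomial.smult a r + Polynomial.smult b s" "q' = Polynomial.smult c r + Polynomial.smult d s"
      using v Cons M rs by auto
    ultimately show ?thesis
      using \<open>s \<noteq> 0 \<and> Polynomial.degree s < Polynomial.degree r\<close> by auto
  qed
  then have "Polynomial.degree (snd x * q') = Polynomial.degree (snd x) + Polynomial.degree q'"
    using f by (intro degree_mult_eq) auto
  then have "Polynomial.degree (p' + snd x * q') = Polynomial.degree (snd x) + Polynomial.degree q'"
    using * f by (subst degree_add_eq_right) auto
  then show ?case using Cons.prems v f * by auto
qed simp

text \<open>A word that is not reduced can be shortened with its sum unchanged, and a nonempty
  reduced word contradicts \<open>reduced_word_degree\<close>. The target is any \<open>N\<close> in
  \<open>SL2Z\<close>, not only the identity, so that a final integral factor can be moved to the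
  other side.\<close>

lemma word_sum_eq_0:
  assumes "valid_word w" "N \<in> SL2Z" "\<And>v. word_act w v = quad_act N v"
  shows "word_sum w = 0"
  using assms
proof (induction "length w" arbitrary: w N rule: less_induct)
  case less
  have shorter: "word_sum w = 0"
    if "valid_word w'" "length w' < length w" "word_sum w' = word_sum w" "\<And>v. word_act w' v = word_act w v" for w'
    using less.hyps[OF that(2,1) less.prems(2)] that(3,4) less.prems(3) by simp
  consider "w = []" | x where "x \<in> set w" "snd x = 0"
    | x where "x \<in> set (tl w)" "lower_left (fst x) = 0"
    | "w \<noteq> []" "\<forall>x \<in> set w. snd x \<noteq> 0" "\<forall>x \<in> set (tl w). lower_left (fst x) \<noteq> 0"
    by blast
  then show ?case
  proof cases
    case 1
    then show ?thesis by (simp add: word_sum_def)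
  next
    case 2
    then obtain u w' M where w: "w = u @ (M, 0) # w'" by (metis split_list prod.collapse)
    have M: "M \<in> SL2Z" using less.prems(1) w by (auto simp: valid_word_def)
    show ?thesis
    proof (cases w')
      case Nil
      have "word_act u v = quad_act (quad_mult N (quad_adj M)) v" for v
        using less.prems(3)[of "quad_act (quad_adj M) v"] w Nil M
        by (simp add: word_act_append shear_0 quad_act_adj quad_act_mult)
      then have "word_sum u = 0"
        using less.prems M w
        by (intro less.hyps[of u "quad_mult N (quad_adj M)"])
          (auto simp: valid_word_def intro: quad_mult_SL2Z quad_adj_SL2Z)
      then show ?thesis using w Nil by (simp add: word_sum_def)
    next
      case (Cons y w'')
      \<comment> \<open>The shear of this letter is trivial and another letter follows, so its
        matrix is multiplied into the next one.\<close>
      show ?thesis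
        by (rule shorter[of "u @ (quad_mult M (fst y), snd y) # w''"])
          (use less.prems(1) w Cons M in \<open>auto simp: valid_word_def word_sum_def word_act_append quad_act_mult shear_0
             intro: quad_mult_SL2Z\<close>)
    qed
  next
    case 3
    then obtain z w0 where w0: "w = z # w0" "x \<in> set w0" by (cases w) auto
    then obtain u w' where "w0 = u @ x # w'" by (metis split_list)
    with w0 have w1: "w = (z # u) @ x # w'" by simp
    obtain u' y where "z # u = u' @ [y]" by (metis list.distinct(1) rev_exhaust)
    with w1 have w: "w = u' @ y # x # w'" by simp
    have M: "fst x \<in> SL2Z" "fst y \<in> SL2Z" using less.prems(1) w by (auto simp: valid_word_def)
    \<comment> \<open>The upper triangular matrix of \<open>x\<close> commutes with the preceding
      shear, so \<open>y\<close> and \<open>x\<close> merge into one letter with added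
      polynomials.\<close>
    show ?thesis
      by (rule shorter[of "u' @ (quad_mult (fst y) (fst x), snd y + snd x) # w'"])
        (use less.prems(1) w M 3 in \<open>auto simp: valid_word_def word_sum_def word_act_append quad_act_mult
             shear_quad_act shear_add intro: quad_mult_SL2Z\<close>)
  next
    case 4
    obtain M f w' where w: "w = (M, f) # w'" using 4(1) by (metis list.exhaust surj_pair)
    obtain p q where pq: "shear f (word_act w' (0, 1)) = (p, q)" by fastforce
    have deg: "Polynomial.degree q < Polynomial.degree p"
      using reduced_word_degree[OF less.prems(1) 4, of p q] w pq by simp
    have M: "M \<in> SL2Z" using less.prems(1) w by (auto simp: valid_word_def)
    have "quad_act M (p, q) = quad_act N (0, 1)"
      using less.prems(3)[of "(0, 1)"] w pq by simp
    \<comment> \<open>With the leading matrix removed, the vector is the second column of an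
      integral matrix, hence constant.\<close>
    then have "(p, q) = quad_act (quad_mult (quad_adj M) N) (0, 1)"
      using M by (metis quad_act_adj(1) quad_act_mult)
    then have "Polynomial.degree p = 0"
      by (cases "quad_mult (quad_adj M) N") auto
    then show ?thesis using deg by simp
  qed
qed

lemma word_sum_unique:
  assumes "valid_word w" "valid_word w'" "\<And>v. word_act w v = word_act w' v"
  shows "word_sum w = word_sum w'"
  using assms
proof (induction w' arbitrary: w)
  case Nil
  then show ?case
    using word_sum_eq_0[OF Nil(1) quad_one_SL2Z] by (simp add: quad_act_one word_sum_def)
next
  case (Cons x w')
  obtain M f where x: "x = (M, f)" by (cases x)
  have M: "M \<in> SL2Z" "Polynomial.coeff f 0 = 0" using Cons.prems x by (auto simp: valid_word_def)
  \<comment> \<open>The inverse of \<open>M U(f)\<close> is \<open>U(- f)\<close> times the inverse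
    of \<open>M\<close>; as a word it takes two letters, one with trivial matrix and one with
    trivial shear.\<close>
  let ?w = "(quad_one, - f) # (quad_adj M, 0) # w"
  have "word_sum ?w = word_sum w'"
    by (rule Cons.IH)
      (use Cons.prems M x in \<open>auto simp: valid_word_def quad_one_SL2Z quad_adj_SL2Z quad_act_one shear_0
        shear_add quad_act_adj\<close>)
  then show ?case by (simp add: word_sum_def x algebra_simps)
qed

section \<open>From words to matrices\<close>

definition mat_act :: "int poly ^ 2 ^ 2 \<Rightarrow> int poly \<times> int poly \<Rightarrow> int poly \<times> int poly" where
  "mat_act g v = (g $ 1 $ 1 * fst v + g $ 1 $ 2 * snd v, g $ 2 $ 1 * fst v + g $ 2 $ 2 * snd v)"

definition represents :: "mword \<Rightarrow> int poly ^ 2 ^ 2 \<Rightarrow> bool" where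
  "represents w g \<longleftrightarrow> valid_word w \<and> (\<forall>v. word_act w v = mat_act g v)"

text \<open>The choice of the word is immaterial by \<open>word_sum_unique\<close>; concatenation of
  words then makes the map a homomorphism on \<open>E2\<close>.\<close>

definition E2_retract :: "int poly ^ 2 ^ 2 \<Rightarrow> int poly" where
  "E2_retract g = word_sum (SOME w. represents w g)"

lemma E2_retract_eq: "represents w g \<Longrightarrow> E2_retract g = word_sum w"
  unfolding E2_retract_def
  by (rule someI2[of "\<lambda>w. represents w g"]) (auto simp: represents_def intro: word_sum_unique)

lemma mat_act_mult: "mat_act (g ** h) v = mat_act g (mat_act h v)"
  by (simp add: mat_act_def matrix_matrix_mult_def sum_2 algebra_simps)

lemma represents_mult: "represents w g \<Longrightarrow> represents w' h \<Longrightarrow> represents (w @ w') (g ** h)"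
  by (auto simp: represents_def word_act_append mat_act_mult valid_word_def simp del: split_paired_All)

text \<open>The factorisation \<open>U(c) U(f - c)\<close>, with \<open>c\<close> the constant
  coefficient of \<open>f\<close>.\<close>

definition upper_word :: "int poly \<Rightarrow> mword" where
  "upper_word f = [((1, Polynomial.coeff f 0, 0, 1), f - [:Polynomial.coeff f 0:])]"

text \<open>With \<open>S\<close> the matrix of rows \<open>(0, -1)\<close> and
  \<open>(1, 0)\<close>, the lower elementary matrix is \<open>S U(- f)\<close> times the inverse of
  \<open>S\<close>. The constant part of \<open>U(- f)\<close> is multiplied into \<open>S\<close>,
  which gives the first quadruple; the second is the inverse of \<open>S\<close>.\<close>

definition lower_word :: "int poly \<Rightarrow> mword" where
  "lower_word f = [((0, - 1, 1, - Polynomial.coeff f 0), - (f - [:Polynomial.coeff f 0:])), ((0, 1, - 1, 0), 0)]"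

lemma represents_upper: "represents (upper_word f) (upper_elem f)"
  by (auto simp: represents_def valid_word_def upper_word_def upper_elem_def mat_act_def SL2Z_def
      vector_2 algebra_simps)

lemma represents_lower: "represents (lower_word f) (lower_elem f)"
  by (auto simp: represents_def valid_word_def lower_word_def lower_elem_def mat_act_def SL2Z_def
      vector_2 algebra_simps)

lemma GL2_group: "group (GL2 :: ('a::comm_ring_1 ^ 2 ^ 2) monoid)"
proof (rule groupI)
  fix x :: "'a ^ 2 ^ 2" assume "x \<in> carrier GL2"
  then obtain y where "x ** y = mat 1" "y ** x = mat 1" by (auto simp: GL2_def invertible_def)
  then show "\<exists>y\<in>carrier GL2. y \<otimes>\<^bsub>GL2\<^esub> x = \<one>\<^bsub>GL2\<^esub>" by (auto simp: GL2_def invertible_def)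
qed (auto simp: GL2_def matrix_mul_assoc invertible_mult, auto simp: invertible_def)

lemma upper_elem_add: "upper_elem f ** upper_elem g = upper_elem (f + g :: 'a::comm_ring_1)"
  by (simp add: upper_elem_def matrix_matrix_mult_def vec_eq_iff forall_2 sum_2 vector_2 add.commute)

lemma lower_elem_add: "lower_elem f ** lower_elem g = lower_elem (f + g :: 'a::comm_ring_1)"
  by (simp add: lower_elem_def matrix_matrix_mult_def vec_eq_iff forall_2 sum_2 vector_2 add.commute)

lemma upper_elem_0: "upper_elem 0 = (mat 1 :: 'a::comm_ring_1 ^ 2 ^ 2)"
  by (simp add: upper_elem_def mat_def vec_eq_iff forall_2 vector_2)

lemma lower_elem_0: "lower_elem 0 = (mat 1 :: 'a::comm_ring_1 ^ 2 ^ 2)"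
  by (simp add: lower_elem_def mat_def vec_eq_iff forall_2 vector_2)

lemma elem_GL2: "upper_elem f \<in> carrier GL2" "lower_elem f \<in> carrier GL2"
proof -
  have "upper_elem f ** upper_elem (- f) = mat 1" "upper_elem (- f) ** upper_elem f = mat 1"
    "lower_elem f ** lower_elem (- f) = mat 1" "lower_elem (- f) ** lower_elem f = mat 1"
    by (simp_all add: upper_elem_add lower_elem_add upper_elem_0 lower_elem_0)
  then show "upper_elem f \<in> carrier GL2" "lower_elem f \<in> carrier GL2"
    by (auto simp: GL2_def invertible_def)
qed

lemma inv_elem:
  "inv\<^bsub>GL2\<^esub> (upper_elem f) = upper_elem (- f)" "inv\<^bsub>GL2\<^esub> (lower_elem f) = lower_elem (- f)"
proof -
  have "upper_elem (- f) \<otimes>\<^bsub>GL2\<^esub> upper_elem f = \<one>\<^bsub>GL2\<^esub>" "lower_elem (- f) \<otimes>\<^bsub>GL2\<^esub> lower_elem f = \<one>\<^bsub>GL2\<^esub>"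
    by (simp_all add: GL2_def upper_elem_add lower_elem_add upper_elem_0 lower_elem_0)
  then show "inv\<^bsub>GL2\<^esub> (upper_elem f) = upper_elem (- f)" "inv\<^bsub>GL2\<^esub> (lower_elem f) = lower_elem (- f)"
    by (simp_all add: group.inv_equality[OF GL2_group] elem_GL2)
qed

lemma E2_represents: "g \<in> carrier E2 \<Longrightarrow> \<exists>w. represents w g"
proof -
  assume "g \<in> carrier E2"
  then have "g \<in> generate GL2 (range upper_elem \<union> range lower_elem)" by (simp add: E2_def)
  then show ?thesis
  proof induction
    case one
    then show ?case using represents_upper[of 0] by (auto simp: GL2_def upper_elem_0)
  next
    case (incl h)
    then show ?case using represents_upper represents_lower by blast
  next
    case (inv h)
    then show ?case using represents_upper represents_lower by (force simp: inv_elem)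
  next
    case (eng h1 h2)
    then obtain w1 w2 where "represents w1 h1" "represents w2 h2" by blast
    then have "represents (w1 @ w2) (h1 \<otimes>\<^bsub>GL2\<^esub> h2)" by (simp add: GL2_def represents_mult)
    then show ?case by blast
  qed
qed

lemma E2_retract_mult:
  assumes "g \<in> carrier E2" "h \<in> carrier E2"
  shows "E2_retract (g \<otimes>\<^bsub>E2\<^esub> h) = E2_retract g + E2_retract h"
proof -
  obtain w w' where "represents w g" "represents w' h" using assms E2_represents by metis
  then show ?thesis
    using E2_retract_eq[OF represents_mult[of w g w' h]] E2_retract_eq[of w g] E2_retract_eq[of w' h]
    by (simp add: E2_def GL2_def word_sum_def)
qed

lemma E2_retract_upper: "Polynomial.coeff f 0 = 0 \<Longrightarrow> E2_retract (upper_elem f) = f"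
  using E2_retract_eq[OF represents_upper[of f]] by (simp add: upper_word_def word_sum_def)

lemma E2_retract_coeff_0:
  assumes "g \<in> carrier E2"
  shows "Polynomial.coeff (E2_retract g) 0 = 0"
proof -
  obtain w where w: "represents w g" using assms E2_represents by metis
  have "valid_word w \<Longrightarrow> Polynomial.coeff (word_sum w) 0 = 0" for w
    by (induction w) (auto simp: word_sum_def valid_word_def)
  then show ?thesis using w E2_retract_eq by (auto simp: represents_def)
qed

lemma upper_elem_E2: "upper_elem f \<in> carrier E2"
  by (auto simp: E2_def intro: generate.incl)

lemma upper_elem_mult: "upper_elem (f + g) = upper_elem f \<otimes>\<^bsub>E2\<^esub> upper_elem g"
  by (simp add: E2_def GL2_def upper_elem_add)

lemma E2_mult_closed: "g \<in> carrier E2 \<Longrightarrow> h \<in> carrier E2 \<Longrightarrow> g \<otimes>\<^bsub>E2\<^esub> h \<in> carrier E2"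
  by (auto simp: E2_def intro: generate.eng)

lemma E2_mult_assoc: "(g \<otimes>\<^bsub>E2\<^esub> h) \<otimes>\<^bsub>E2\<^esub> k = g \<otimes>\<^bsub>E2\<^esub> (h \<otimes>\<^bsub>E2\<^esub> k)"
  by (simp add: E2_def GL2_def matrix_mul_assoc)

section \<open>Congruences of chains\<close>

definition fcong :: "int \<Rightarrow> ('a \<Rightarrow> int) set \<Rightarrow> 'a frag \<Rightarrow> 'a frag \<Rightarrow> bool" where
  "fcong q N x y \<longleftrightarrow> red q (x - y) \<in> N"

context
  fixes q :: int and N :: "('a \<Rightarrow> int) set"
  assumes N: "fsub q N"
begin

lemma fcong_refl: "fcong q N x x"
  using fsub_0[OF N] by (simp add: fcong_def)

lemma fcong_sym: "fcong q N x y \<Longrightarrow> fcong q N y x"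
  using fsub_minus[OF N, of "x - y"] by (simp add: fcong_def)

lemma fcong_trans: "fcong q N x y \<Longrightarrow> fcong q N y z \<Longrightarrow> fcong q N x z"
  using fsub_add[OF N, of "x - y" "y - z"] by (simp add: fcong_def)

lemma fcong_add: "fcong q N x y \<Longrightarrow> fcong q N x' y' \<Longrightarrow> fcong q N (x + x') (y + y')"
  using fsub_add[OF N, of "x - y" "x' - y'"] by (simp add: fcong_def algebra_simps)

lemma fcong_diff: "fcong q N x y \<Longrightarrow> fcong q N x' y' \<Longrightarrow> fcong q N (x - x') (y - y')"
  using fsub_diff[OF N, of "x - y" "x' - y'"] by (simp add: fcong_def algebra_simps)

lemma fcong_minus: "fcong q N x y \<Longrightarrow> fcong q N (- x) (- y)"
  using fcong_diff[OF fcong_refl[of 0], of x y] by simp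

lemma fcong_cmul: "fcong q N x y \<Longrightarrow> fcong q N (frag_cmul k x) (frag_cmul k y)"
  using fsub_cmul[OF N, of "x - y" k] by (simp add: fcong_def frag_cmul_minus2)

lemma fcong_extend:
  "(\<And>i. i \<in> Poly_Mapping.keys x \<Longrightarrow> fcong q N (f i) (g i)) \<Longrightarrow> fcong q N (frag_extend f x) (frag_extend g x)"
  using fsub_extend[OF N, of x "\<lambda>i. f i - g i"] by (simp add: fcong_def frag_extend_fun_diff)

lemma fcong_red: "red q x = red q y \<Longrightarrow> fcong q N x y"
  using fsub_0[OF N] by (simp add: fcong_def red_diff)

lemma fcong_cls: "fcong q N x y \<longleftrightarrow> cls q N x = cls q N y"
  by (simp add: fcong_def cls_eq_iff[OF N])

end

section \<open>The Pontryagin product of polynomials\<close>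

lemma pont_not_distinct: "\<not> distinct as \<Longrightarrow> pont as = 0"
proof -
  assume "\<not> distinct as"
  then obtain u w v x where as: "as = u @ [x] @ w @ [x] @ v" using not_distinct_decomp by blast
  have "pont (u @ x # w @ x # v) = 0" for u
  proof (induction w arbitrary: u)
    case Nil
    show ?case by (simp add: pont_adjacent)
  next
    case (Cons y w)
    show ?case using pont_swap[of u x y "w @ x # v"] Cons[of "u @ [y]"] by simp
  qed
  then show ?thesis using as by simp
qed

text \<open>In the first slot \<open>ins2\<close> supplies the bounding chain, because
  \<open>pont v\<close> is a cycle; letters further in front are inserted into that chain, with a
  sign from the Leibniz rule. Its words use only the letters at hand, which later places it in the
  bar complex over \<open>A0\<close>.\<close>

lemma pont_add_boundary:
  fixes a b :: "'a::ab_semigroup_add"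
  shows "\<exists>w. pont (u @ (a + b) # v) = pont (u @ a # v) + pont (u @ b # v) + Bd (+) w
    \<and> Poly_Mapping.keys w \<subseteq> tuples (length u + length v + 2) (set u \<union> set v \<union> {a, b})"
proof (induction u)
  case Nil
  have "pont ((a + b) # v) = pont (a # v) + pont (b # v) + Bd (+) (- Ins2 a b (pont v))"
    by (simp add: frag_extend_minus Bd_Ins2 Bd_pont)
  moreover have "zs \<in> tuples (length v + 2) (set v \<union> {a, b})" if "zs \<in> Poly_Mapping.keys (- Ins2 a b (pont v))" for zs
  proof -
    have "zs \<in> Poly_Mapping.keys (Ins2 a b (pont v))" using that by simp
    then obtain ys where "ys \<in> Poly_Mapping.keys (pont v)" "zs \<in> Poly_Mapping.keys (ins2 a b ys)"
      using keys_frag_extend by fastforce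
    then have "mset ys = mset v" "mset zs = add_mset a (add_mset b (mset ys))"
      using keys_pont keys_ins2 by fastforce+
    then have "mset zs = mset (a # b # v)" by simp
    then have "length zs = length (a # b # v)" "set zs = set (a # b # v)"
      by (rule mset_eq_length, rule mset_eq_setD)
    then show ?thesis unfolding tuples_def by auto
  qed
  ultimately show ?case by (intro exI[of _ "- Ins2 a b (pont v)"]) auto
next
  case (Cons c u)
  then obtain w where w: "pont (u @ (a + b) # v) = pont (u @ a # v) + pont (u @ b # v) + Bd (+) w"
    "Poly_Mapping.keys w \<subseteq> tuples (length u + length v + 2) (set u \<union> set v \<union> {a, b})" by blast
  have "pont ((c # u) @ (a + b) # v) = pont ((c # u) @ a # v) + pont ((c # u) @ b # v) + Bd (+) (- Ins c w)"
    by (simp add: w(1) frag_extend_linear Bd_Ins)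
  moreover have "zs \<in> tuples (length (c # u) + length v + 2) (set (c # u) \<union> set v \<union> {a, b})"
    if "zs \<in> Poly_Mapping.keys (- Ins c w)" for zs
  proof -
    have "zs \<in> Poly_Mapping.keys (Ins c w)" using that by simp
    then obtain ys where ys: "ys \<in> Poly_Mapping.keys w" "zs \<in> Poly_Mapping.keys (ins c ys)"
      using keys_frag_extend by fastforce
    then have "mset zs = mset (c # ys)" using keys_ins by fastforce
    then have "length zs = length (c # ys)" "set zs = set (c # ys)"
      by (rule mset_eq_length, rule mset_eq_setD)
    then show ?thesis using ys w(2) unfolding tuples_def by auto
  qed
  ultimately show ?case by (intro exI[of _ "- Ins c w"]) auto
qed

abbreviation "A0 \<equiv> {f :: int poly. Polynomial.coeff f 0 = 0}"

lemma tZt_simps [simp]: "carrier tZt = A0" "add tZt = (+)"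
  by (simp_all add: tZt_def)

lemma poly_cong_mod:
  assumes "\<And>l. Polynomial.coeff a l mod q = Polynomial.coeff b l mod (q::int)"
  shows "\<exists>k. a = b + Polynomial.smult q k \<and> (Polynomial.coeff a 0 = Polynomial.coeff b 0 \<longrightarrow> Polynomial.coeff k 0 = 0)"
proof (intro exI conjI impI)
  define k where "k = map_poly (\<lambda>c. c div q) (a - b)"
  have k: "Polynomial.coeff k l = (Polynomial.coeff a l - Polynomial.coeff b l) div q" for l
    by (simp add: k_def coeff_map_poly)
  show "a = b + Polynomial.smult q k"
  proof (rule poly_eqI)
    fix l
    have "q dvd Polynomial.coeff a l - Polynomial.coeff b l" using assms[of l] by (simp add: mod_eq_dvd_iff)
    then show "Polynomial.coeff a l = Polynomial.coeff (b + Polynomial.smult q k) l" by (simp add: k)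
  qed
  show "Polynomial.coeff k 0 = 0" if "Polynomial.coeff a 0 = Polynomial.coeff b 0" using that by (simp add: k)
qed

context mod_ring
begin

abbreviation "BA n \<equiv> bar_boundaries R (add_monoid tZt) n"

lemmas BA_cong = fcong_refl[OF fsub_boundaries] fcong_sym[OF fsub_boundaries] fcong_trans[OF fsub_boundaries]
  fcong_add[OF fsub_boundaries] fcong_diff[OF fsub_boundaries] fcong_cmul[OF fsub_boundaries]
  fcong_red[OF fsub_boundaries]

lemma pont_slot_add:
  assumes "set u \<subseteq> A0" "set v \<subseteq> A0" "a \<in> A0" "b \<in> A0" "n = Suc (length u + length v)"
  shows "fcong q (BA n) (pont (u @ (a + b) # v)) (pont (u @ a # v) + pont (u @ b # v))"
proof -
  obtain w where w: "pont (u @ (a + b) # v) = pont (u @ a # v) + pont (u @ b # v) + Bd (+) w"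
    "Poly_Mapping.keys w \<subseteq> tuples (length u + length v + 2) (set u \<union> set v \<union> {a, b})"
    using pont_add_boundary by blast
  have "tuples (length u + length v + 2) (set u \<union> set v \<union> {a, b}) \<subseteq> tuples (Suc n) A0"
    using assms by (auto simp: tuples_def)
  then have "Poly_Mapping.keys w \<subseteq> tuples (Suc n) A0" using w(2) by (rule order_trans[rotated])
  then have "red q (Bd (+) w) \<in> BA n" unfolding bar_boundaries_iff by (intro exI[of _ w]) simp
  then show ?thesis by (simp add: fcong_def w(1))
qed

lemma pont_slot_smult:
  assumes "set u \<subseteq> A0" "set v \<subseteq> A0" "a \<in> A0" "n = Suc (length u + length v)"
  shows "fcong q (BA n) (pont (u @ Polynomial.smult r a # v)) (frag_cmul r (pont (u @ a # v)))"
proof (induction r rule: int_induct[of _ 0])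
  case base
  \<comment> \<open>Additivity at \<open>0 + 0\<close> shows that a zero slot yields a
    boundary.\<close>
  have "fcong q (BA n) (pont (u @ (0 + 0) # v)) (pont (u @ 0 # v) + pont (u @ 0 # v))"
    by (rule pont_slot_add) (use assms in auto)
  then have "fcong q (BA n) 0 (pont (u @ 0 # v))"
    unfolding fcong_def by simp
  then show ?case using BA_cong(2) by simp
next
  case (step1 r)
  have "fcong q (BA n) (pont (u @ (Polynomial.smult r a + a) # v)) (pont (u @ Polynomial.smult r a # v) + pont (u @ a # v))"
    by (rule pont_slot_add) (use assms in auto)
  moreover have "fcong q (BA n) (pont (u @ Polynomial.smult r a # v) + pont (u @ a # v)) (frag_cmul r (pont (u @ a # v)) + pont (u @ a # v))"
    by (rule BA_cong(4)[OF step1(2) BA_cong(1)])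
  ultimately have "fcong q (BA n) (pont (u @ (Polynomial.smult r a + a) # v)) (frag_cmul r (pont (u @ a # v)) + pont (u @ a # v))"
    by (rule BA_cong(3))
  then show ?case by (simp add: smult_add_left frag_cmul_distrib)
next
  case (step2 r)
  have "fcong q (BA n) (pont (u @ (Polynomial.smult (r - 1) a + a) # v)) (pont (u @ Polynomial.smult (r - 1) a # v) + pont (u @ a # v))"
    by (rule pont_slot_add) (use assms in auto)
  moreover have "Polynomial.smult (r - 1) a + a = Polynomial.smult r a" by (simp add: smult_diff_left)
  ultimately have "fcong q (BA n) (pont (u @ Polynomial.smult (r - 1) a # v) + pont (u @ a # v)) (pont (u @ Polynomial.smult r a # v))"
    using BA_cong(2) by simp
  then have "fcong q (BA n) (pont (u @ Polynomial.smult (r - 1) a # v) + pont (u @ a # v)) (frag_cmul r (pont (u @ a # v)))"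
    using step2(2) by (rule BA_cong(3))
  from BA_cong(5)[OF this BA_cong(1)[of _ _ "pont (u @ a # v)"]] show ?case
    by (simp add: frag_cmul_diff_distrib)
qed

text \<open>The letters differ by \<open>q\<close> times some \<open>k\<close>, and by linearity
  that slot contributes \<open>q\<close> times a chain, whose reduction is zero. Hence lifts that
  respect addition only modulo \<open>q\<close> are good enough.\<close>

lemma pont_slot_cong:
  assumes "set u \<subseteq> A0" "set v \<subseteq> A0" "a \<in> A0" "b \<in> A0" "n = Suc (length u + length v)"
    and "\<And>l. Polynomial.coeff a l mod q = Polynomial.coeff b l mod q"
  shows "fcong q (BA n) (pont (u @ a # v)) (pont (u @ b # v))"
proof -
  obtain k where k: "a = b + Polynomial.smult q k" "k \<in> A0"
    using poly_cong_mod[OF assms(6)] assms(3,4) by auto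
  have "fcong q (BA n) (pont (u @ (b + Polynomial.smult q k) # v)) (pont (u @ b # v) + pont (u @ Polynomial.smult q k # v))"
    by (rule pont_slot_add) (use assms k in auto)
  moreover have "fcong q (BA n) (pont (u @ Polynomial.smult q k # v)) 0"
    by (rule BA_cong(3)[OF pont_slot_smult]) (use assms k in \<open>auto intro!: BA_cong(7)\<close>)
  then have "fcong q (BA n) (pont (u @ b # v) + pont (u @ Polynomial.smult q k # v)) (pont (u @ b # v) + 0)"
    by (rule BA_cong(4)[OF BA_cong(1)])
  ultimately have "fcong q (BA n) (pont (u @ (b + Polynomial.smult q k) # v)) (pont (u @ b # v) + 0)"
    by (rule BA_cong(3))
  then show ?thesis using k by simp
qed

lemma pont_cycles:
  assumes "as \<in> tuples n A0"
  shows "red q (pont as) \<in> bar_cycles R (add_monoid tZt) n"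
proof -
  have "Poly_Mapping.keys (pont as) \<subseteq> tuples n A0"
  proof
    fix zs assume "zs \<in> Poly_Mapping.keys (pont as)"
    then have "mset zs = mset as" using keys_pont by blast
    then have "length zs = length as" "set zs = set as" by (rule mset_eq_length, rule mset_eq_setD)
    then show "zs \<in> tuples n A0" using assms by (simp add: tuples_def)
  qed
  then show ?thesis by (simp add: bar_cycles_iff Bd_pont red_keys_free)
qed

lemma BA_subset: "BA n \<subseteq> bar_cycles R (add_monoid tZt) n"
  by (rule boundaries_subset_cycles) auto

end

section \<open>Exterior powers\<close>

lemma tuples_append_Cons:
  "u @ x # v \<in> tuples n C \<longleftrightarrow> n = Suc (length u + length v) \<and> set u \<subseteq> C \<and> x \<in> C \<and> set v \<subseteq> C"
  by (auto simp: tuples_def)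

text \<open>A polynomial read as a chain of exponents. Composed with the retraction it becomes the
  additive map whose tensor powers give the cocycles.\<close>

definition coeff_frag :: "int poly \<Rightarrow> nat frag" where
  "coeff_frag f = Abs_poly_mapping (Polynomial.coeff f)"

lemma lookup_coeff_frag [simp]: "poly_mapping.lookup (coeff_frag f) = Polynomial.coeff f"
  unfolding coeff_frag_def
  by (rule Abs_poly_mapping_inverse) (simp add: MOST_coeff_eq_0[unfolded MOST_iff_cofinite])

lemma coeff_frag_add: "coeff_frag (f + g) = coeff_frag f + coeff_frag g"
  by (rule poly_mapping_eqI) (simp add: lookup_add)

lemma coeff_frag_monom: "coeff_frag (Polynomial.monom 1 l) = frag_of l"
  by (rule poly_mapping_eqI) auto

lemma keys_coeff_frag: "f \<in> A0 \<Longrightarrow> l \<in> Poly_Mapping.keys (coeff_frag f) \<Longrightarrow> l \<ge> 1"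
  by (cases l) (auto simp: in_keys_iff)

text \<open>The parameters \<open>s\<close> and \<open>t\<close> give integral representatives of the elements of \<open>M\<close> and the
  basis of monomials of positive degree. The modulus \<open>q = 0\<close> corresponds to integral coefficients.\<close>

locale ext_module = mod_ring R q for R :: "int ring" (structure) and q :: int +
  fixes M :: "(int, 'm, 'y) module_scheme" and s :: "'m \<Rightarrow> int poly" and t :: "nat \<Rightarrow> 'm"
  assumes add_closed: "x \<in> carrier M \<Longrightarrow> y \<in> carrier M \<Longrightarrow> x \<oplus>\<^bsub>M\<^esub> y \<in> carrier M"
    and smult_closed: "r mod q = r \<Longrightarrow> x \<in> carrier M \<Longrightarrow> r \<odot>\<^bsub>M\<^esub> x \<in> carrier M"
    and t_closed: "l \<ge> 1 \<Longrightarrow> t l \<in> carrier M"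
    and s_closed: "x \<in> carrier M \<Longrightarrow> s x \<in> A0"
    and s_add: "x \<in> carrier M \<Longrightarrow> y \<in> carrier M \<Longrightarrow>
      Polynomial.coeff (s (x \<oplus>\<^bsub>M\<^esub> y)) l mod q = Polynomial.coeff (s x + s y) l mod q"
    and s_smult: "r mod q = r \<Longrightarrow> x \<in> carrier M \<Longrightarrow>
      Polynomial.coeff (s (r \<odot>\<^bsub>M\<^esub> x)) l mod q = Polynomial.coeff (Polynomial.smult r (s x)) l mod q"
    and s_t: "l \<ge> 1 \<Longrightarrow> s (t l) = Polynomial.monom 1 l"
    and span: "x \<in> carrier M \<Longrightarrow> (\<And>l. l \<ge> 1 \<Longrightarrow> Q (t l))
      \<Longrightarrow> (\<And>x y. x \<in> carrier M \<Longrightarrow> y \<in> carrier M \<Longrightarrow> Q x \<Longrightarrow> Q y \<Longrightarrow> Q (x \<oplus>\<^bsub>M\<^esub> y))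
      \<Longrightarrow> (\<And>r x. r mod q = r \<Longrightarrow> x \<in> carrier M \<Longrightarrow> Q x \<Longrightarrow> Q (r \<odot>\<^bsub>M\<^esub> x)) \<Longrightarrow> Q x"
begin

abbreviation "F n \<equiv> free_module R (tuples n (carrier M))"
abbreviation "K n \<equiv> exterior_kernel R M n"

text \<open>Integral lifts of \<open>exterior_relators\<close>. Splitting a word as
  \<open>u @ x # v\<close> instead of updating a list suits the recursions of \<open>pont\<close>
  and \<open>tens\<close>.\<close>

definition relators :: "nat \<Rightarrow> 'm list frag set" where
  "relators n =
     {frag_of (u @ (x \<oplus>\<^bsub>M\<^esub> y) # v) - (frag_of (u @ x # v) + frag_of (u @ y # v)) | u v x y.
        x \<in> carrier M \<and> y \<in> carrier M \<and> u @ x # v \<in> tuples n (carrier M)}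
     \<union> {frag_of (u @ (r \<odot>\<^bsub>M\<^esub> x) # v) - frag_cmul r (frag_of (u @ x # v)) | u v r x.
        r mod q = r \<and> x \<in> carrier M \<and> u @ x # v \<in> tuples n (carrier M)}
     \<union> {frag_of xs | xs. xs \<in> tuples n (carrier M) \<and> \<not> distinct xs}"

lemma list_update_split:
  assumes "xs \<in> tuples n C" "j < n" "x \<in> C"
  shows "xs[j := z] = take j xs @ z # drop (Suc j) xs" "take j xs @ x # drop (Suc j) xs \<in> tuples n C"
  using assms
  by (auto simp: tuples_def upd_conv_take_nth_drop dest: in_set_takeD in_set_dropD)

lemma basis_elt_mem: "xs \<in> tuples n (carrier M) \<Longrightarrow> red q (frag_of xs) \<in> carrier (F n)"
  by (rule red_keys_free) simp

lemma relator_add: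
  assumes "x \<in> carrier M" "y \<in> carrier M" "u @ x # v \<in> tuples n (carrier M)"
  shows "basis_elt R (u @ (x \<oplus>\<^bsub>M\<^esub> y) # v) \<ominus>\<^bsub>F n\<^esub> (basis_elt R (u @ x # v) \<oplus>\<^bsub>F n\<^esub> basis_elt R (u @ y # v))
    = red q (frag_of (u @ (x \<oplus>\<^bsub>M\<^esub> y) # v) - (frag_of (u @ x # v) + frag_of (u @ y # v)))"
  unfolding basis_elt_red add_red
  by (rule free_minus[OF fsub_add[OF fsub_free]]; rule basis_elt_mem)
    (use assms in \<open>auto simp: tuples_append_Cons\<close>)

lemma relator_smult:
  assumes "x \<in> carrier M" "u @ x # v \<in> tuples n (carrier M)"
  shows "basis_elt R (u @ (r \<odot>\<^bsub>M\<^esub> x) # v) \<ominus>\<^bsub>F n\<^esub> (r \<odot>\<^bsub>F n\<^esub> basis_elt R (u @ x # v))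
    = red q (frag_of (u @ (r \<odot>\<^bsub>M\<^esub> x) # v) - frag_cmul r (frag_of (u @ x # v)))"
  unfolding basis_elt_red smult_red
  by (rule free_minus[OF fsub_cmul[OF fsub_free]]; rule basis_elt_mem)
    (use assms in \<open>auto simp: tuples_append_Cons\<close>)

lemma exterior_relators_eq: "exterior_relators R M n = red q ` relators n"
proof
  show "exterior_relators R M n \<subseteq> red q ` relators n"
  proof
    fix c assume "c \<in> exterior_relators R M n"
    then consider
      (1) xs j x y where "xs \<in> tuples n (carrier M)" "j < n" "x \<in> carrier M" "y \<in> carrier M"
        "c = basis_elt R (xs[j := x \<oplus>\<^bsub>M\<^esub> y]) \<ominus>\<^bsub>F n\<^esub> (basis_elt R (xs[j := x]) \<oplus>\<^bsub>F n\<^esub> basis_elt R (xs[j := y]))"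
      | (2) xs j r x where "xs \<in> tuples n (carrier M)" "j < n" "r \<in> carrier R" "x \<in> carrier M"
        "c = basis_elt R (xs[j := r \<odot>\<^bsub>M\<^esub> x]) \<ominus>\<^bsub>F n\<^esub> (r \<odot>\<^bsub>F n\<^esub> basis_elt R (xs[j := x]))"
      | (3) xs j k where "xs \<in> tuples n (carrier M)" "j < k" "k < n" "xs ! j = xs ! k" "c = basis_elt R xs"
      unfolding exterior_relators_def Let_def by (elim UnE CollectE exE conjE) metis+
    then show "c \<in> red q ` relators n"
    proof cases
      case 1
      note sp = list_update_split[OF 1(1,2,3)]
      have "c = red q (frag_of (take j xs @ (x \<oplus>\<^bsub>M\<^esub> y) # drop (Suc j) xs)
          - (frag_of (take j xs @ x # drop (Suc j) xs) + frag_of (take j xs @ y # drop (Suc j) xs)))"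
        unfolding 1(5) sp(1) by (rule relator_add[OF 1(3,4) sp(2)])
      then show ?thesis unfolding relators_def using 1(3,4) sp(2) by (intro image_eqI) auto
    next
      case 2
      note sp = list_update_split[OF 2(1,2,4)]
      have "c = red q (frag_of (take j xs @ (r \<odot>\<^bsub>M\<^esub> x) # drop (Suc j) xs)
          - frag_cmul r (frag_of (take j xs @ x # drop (Suc j) xs)))"
        unfolding 2(5) sp(1) by (rule relator_smult[OF 2(4) sp(2)])
      moreover have "r mod q = r" using 2(3) by simp
      ultimately show ?thesis unfolding relators_def using 2(4) sp(2) by (intro image_eqI) auto
    next
      case 3
      have "\<not> distinct xs" using 3 nth_eq_iff_index_eq[of xs j k] by (auto simp: tuples_def)
      then show ?thesis unfolding relators_def using 3 by (auto simp: basis_elt_red)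
    qed
  qed
  show "red q ` relators n \<subseteq> exterior_relators R M n"
  proof
    fix c assume "c \<in> red q ` relators n"
    then consider
      (1) u v x y where "x \<in> carrier M" "y \<in> carrier M" "u @ x # v \<in> tuples n (carrier M)"
        "c = red q (frag_of (u @ (x \<oplus>\<^bsub>M\<^esub> y) # v) - (frag_of (u @ x # v) + frag_of (u @ y # v)))"
      | (2) u v r x where "r mod q = r" "x \<in> carrier M" "u @ x # v \<in> tuples n (carrier M)"
        "c = red q (frag_of (u @ (r \<odot>\<^bsub>M\<^esub> x) # v) - frag_cmul r (frag_of (u @ x # v)))"
      | (3) xs where "xs \<in> tuples n (carrier M)" "\<not> distinct xs" "c = red q (frag_of xs)"
      unfolding relators_def by (elim imageE UnE CollectE exE conjE) metis+
    then show "c \<in> exterior_relators R M n"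
    proof cases
      case 1
      have n: "length u < n" using 1(3) by (simp add: tuples_append_Cons)
      have "c = basis_elt R ((u @ x # v)[length u := x \<oplus>\<^bsub>M\<^esub> y]) \<ominus>\<^bsub>F n\<^esub>
          (basis_elt R ((u @ x # v)[length u := x]) \<oplus>\<^bsub>F n\<^esub> basis_elt R ((u @ x # v)[length u := y]))"
        unfolding list_update_length 1(4) by (rule relator_add[symmetric, OF 1(1-3)])
      then show ?thesis unfolding exterior_relators_def Let_def
        using 1(1-3) n by (intro UnI1 CollectI exI conjI) assumption+
    next
      case 2
      have n: "length u < n" using 2(3) by (simp add: tuples_append_Cons)
      have r: "r \<in> carrier R" using 2(1) by simp
      have "c = basis_elt R ((u @ x # v)[length u := r \<odot>\<^bsub>M\<^esub> x]) \<ominus>\<^bsub>F n\<^esub>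
          (r \<odot>\<^bsub>F n\<^esub> basis_elt R ((u @ x # v)[length u := x]))"
        unfolding list_update_length 2(4) by (rule relator_smult[symmetric, OF 2(2,3)])
      then show ?thesis unfolding exterior_relators_def Let_def
        using 2(2,3) n r by (intro UnI1[OF UnI2] CollectI exI conjI) assumption+
    next
      case 3
      then obtain j k where "j < k" "k < n" "xs ! j = xs ! k"
        unfolding distinct_conv_nth tuples_def
        by simp (metis linorder_neqE_nat)
      then show ?thesis unfolding exterior_relators_def Let_def
        using 3 by (intro UnI2 CollectI exI[of _ xs] exI[of _ j] exI[of _ k] conjI) (simp_all add: basis_elt_red)
    qed
  qed
qed

lemma relators_subset: "red q ` relators n \<subseteq> carrier (F n)"
proof
  fix c assume "c \<in> red q ` relators n"
  then obtain z where z: "z \<in> relators n" "c = red q z" by blast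
  have "\<exists>x y. z = x - y \<and> red q x \<in> carrier (F n) \<and> red q y \<in> carrier (F n)"
    using z(1) unfolding relators_def
  proof (elim UnE CollectE exE conjE)
    fix u v x y
    assume "z = frag_of (u @ (x \<oplus>\<^bsub>M\<^esub> y) # v) - (frag_of (u @ x # v) + frag_of (u @ y # v))"
      and *: "x \<in> carrier M" "y \<in> carrier M" "u @ x # v \<in> tuples n (carrier M)"
    moreover have mem: "red q (frag_of (u @ w # v)) \<in> carrier (F n)" if "w \<in> carrier M" for w
      using * that by (intro basis_elt_mem) (auto simp: tuples_append_Cons)
    ultimately show ?thesis
      using mem[OF add_closed[OF *(1,2)]] fsub_add[OF fsub_free mem[OF *(1)] mem[OF *(2)]]
      by (intro exI conjI)
  next
    fix u v r x
    assume "z = frag_of (u @ (r \<odot>\<^bsub>M\<^esub> x) # v) - frag_cmul r (frag_of (u @ x # v))"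
      and *: "r mod q = r" "x \<in> carrier M" "u @ x # v \<in> tuples n (carrier M)"
    moreover have mem: "red q (frag_of (u @ w # v)) \<in> carrier (F n)" if "w \<in> carrier M" for w
      using * that by (intro basis_elt_mem) (auto simp: tuples_append_Cons)
    ultimately show ?thesis
      using mem[OF smult_closed[OF *(1,2)]] fsub_cmul[OF fsub_free mem[OF *(2)], of r]
      by (intro exI conjI)
  next
    fix xs assume "z = frag_of xs" "xs \<in> tuples n (carrier M)"
    then show ?thesis
      by (intro exI[of _ z] exI[of _ 0] conjI) (auto simp: basis_elt_mem fsub_0[OF fsub_free])
  qed
  then show "c \<in> carrier (F n)" unfolding z(2) using fsub_diff[OF fsub_free] by metis
qed

lemma subgroup_free_iff: "subgroup N (add_monoid (F n)) \<longleftrightarrow> subgroup N (fgrp q (carrier (F n)))"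
  unfolding subgroup_def m_inv_def by (simp add: fgrp_def)

lemma submodule_free_iff: "submodule N R (F n) \<longleftrightarrow> fsub q N \<and> N \<subseteq> carrier (F n)"
proof
  assume "submodule N R (F n)"
  then have N: "subgroup N (fgrp q (carrier (F n)))"
    by (simp only: submodule_def subgroup_free_iff)
  show "fsub q N \<and> N \<subseteq> carrier (F n)"
    using fgrp_subgroupD[OF N fsub_free] subgroup.subset[OF N] by (simp add: fgrp_def)
next
  assume N: "fsub q N \<and> N \<subseteq> carrier (F n)"
  show "submodule N R (F n)"
    unfolding submodule_def submodule_axioms_def subgroup_free_iff
  proof (intro conjI allI impI)
    show "subgroup N (fgrp q (carrier (F n)))" using N fgrp_subgroup[OF _ fsub_free] by blast
    fix a c assume "c \<in> N"
    then obtain x where "c = red q x" "red q x \<in> N" using N fsub_rep by metis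
    then show "a \<odot>\<^bsub>F n\<^esub> c \<in> N" using N fsub_cmul[of q N x a] by (simp only: smult_red)
  qed
qed

lemma K_eq: "K n = \<Inter> {N. fsub q N \<and> N \<subseteq> carrier (F n) \<and> red q ` relators n \<subseteq> N}"
  by (simp add: exterior_kernel_def submodule_free_iff exterior_relators_eq conj_assoc)

lemma K_least: "fsub q N \<Longrightarrow> N \<subseteq> carrier (F n) \<Longrightarrow> red q ` relators n \<subseteq> N \<Longrightarrow> K n \<subseteq> N"
  unfolding K_eq by (rule Inter_lower) simp

lemma relator_in_K: "z \<in> relators n \<Longrightarrow> red q z \<in> K n"
  unfolding K_eq by (simp add: image_subset_iff)

lemma K_subset: "K n \<subseteq> carrier (F n)"
  by (rule K_least[OF fsub_free order_refl relators_subset])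

lemma fsub_K: "fsub q (K n)"
  unfolding fsub_def
proof (intro conjI allI impI)
  show "K n \<subseteq> range (red q)" using K_subset fsub_free unfolding fsub_def by (rule order_trans[OF _ conjunct1])
  show "(\<lambda>s. 0) \<in> K n" unfolding K_eq by (intro InterI) (auto intro: fsub_0)
  fix x y assume xy: "red q x \<in> K n" "red q y \<in> K n"
  show "red q (x - y) \<in> K n"
    unfolding K_eq
  proof (intro InterI)
    fix N assume N: "N \<in> {N. fsub q N \<and> N \<subseteq> carrier (F n) \<and> red q ` relators n \<subseteq> N}"
    then have "K n \<subseteq> N" by (intro K_least) simp_all
    then have "red q x \<in> N" "red q y \<in> N" using xy by (simp_all add: subset_iff)
    then show "red q (x - y) \<in> N" using N fsub_diff[of q N x y] by simp
  qed
qed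

lemmas K_refl = fcong_refl[OF fsub_K]
  and K_sym = fcong_sym[OF fsub_K]
  and K_trans [trans] = fcong_trans[OF fsub_K]
  and K_cong_add = fcong_add[OF fsub_K]
  and K_cong_diff = fcong_diff[OF fsub_K]
  and K_cong_minus = fcong_minus[OF fsub_K]
  and K_cong_cmul = fcong_cmul[OF fsub_K]
  and K_cong_extend = fcong_extend[OF fsub_K]
  and K_cong_red = fcong_red[OF fsub_K]

lemma K_slot_add:
  assumes "x \<in> carrier M" "y \<in> carrier M" "u @ x # v \<in> tuples n (carrier M)"
  shows "fcong q (K n) (frag_of (u @ (x \<oplus>\<^bsub>M\<^esub> y) # v)) (frag_of (u @ x # v) + frag_of (u @ y # v))"
  unfolding fcong_def by (rule relator_in_K) (use assms in \<open>unfold relators_def, blast\<close>)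

lemma K_slot_smult:
  assumes "r mod q = r" "x \<in> carrier M" "u @ x # v \<in> tuples n (carrier M)"
  shows "fcong q (K n) (frag_of (u @ (r \<odot>\<^bsub>M\<^esub> x) # v)) (frag_cmul r (frag_of (u @ x # v)))"
  unfolding fcong_def by (rule relator_in_K) (use assms in \<open>unfold relators_def, blast\<close>)

lemma K_not_distinct:
  assumes "xs \<in> tuples n (carrier M)" "\<not> distinct xs"
  shows "fcong q (K n) (frag_of xs) 0"
  unfolding fcong_def diff_zero by (rule relator_in_K) (use assms in \<open>unfold relators_def, blast\<close>)

text \<open>Polarisation: with the sum of \<open>x\<close> and \<open>y\<close> in both slots the
  symbol vanishes, and of its four bilinear terms the two with equal entries vanish too.\<close>

lemma K_swap:
  assumes "u @ x # y # v \<in> tuples n (carrier M)"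
  shows "fcong q (K n) (frag_of (u @ x # y # v)) (- frag_of (u @ y # x # v))"
proof -
  let ?f = "\<lambda>a b. frag_of (u @ a # b # v)" and ?z = "x \<oplus>\<^bsub>M\<^esub> y"
  have xy: "x \<in> carrier M" "y \<in> carrier M" using assms by (auto simp: tuples_def)
  have z: "?z \<in> carrier M" using xy by (rule add_closed)
  have mem: "u @ a # b # v \<in> tuples n (carrier M)" if "a \<in> carrier M" "b \<in> carrier M" for a b
    using assms that by (auto simp: tuples_def)
  have mem2: "(u @ [a]) @ b # v \<in> tuples n (carrier M)" if "a \<in> carrier M" "b \<in> carrier M" for a b
    using mem[OF that] by simp
  have "fcong q (K n) (?f ?z ?z) (?f x ?z + ?f y ?z)"
    using K_slot_add[OF xy mem[OF xy(1) z]] .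
  also have "fcong q (K n) (?f x ?z + ?f y ?z) ((?f x x + ?f x y) + (?f y x + ?f y y))"
    using K_slot_add[OF xy mem2[OF xy(1) xy(1)]] K_slot_add[OF xy mem2[OF xy(2) xy(1)]]
    by (intro K_cong_add) simp_all
  also have "fcong q (K n) ((?f x x + ?f x y) + (?f y x + ?f y y)) ((0 + ?f x y) + (?f y x + 0))"
    by (intro K_cong_add K_refl K_not_distinct mem xy) simp_all
  finally have "fcong q (K n) (?f ?z ?z) (?f x y + ?f y x)" by simp
  then have "fcong q (K n) (?f x y + ?f y x) (?f ?z ?z)" by (rule K_sym)
  also have "fcong q (K n) (?f ?z ?z) 0" by (rule K_not_distinct[OF mem[OF z z]]) simp
  finally have "fcong q (K n) (?f x y + ?f y x - ?f y x) (0 - ?f y x)" by (intro K_cong_diff K_refl)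
  then show ?thesis by simp
qed

end

section \<open>Expansion in monomials modulo the exterior relators\<close>

lemma keys_tens:
  assumes "L \<in> Poly_Mapping.keys (tens \<kappa> xs)"
  shows "length L = length xs \<and> set L \<subseteq> (\<Union>x\<in>set xs. Poly_Mapping.keys (\<kappa> x))"
  using assms
proof (induction xs arbitrary: L)
  case (Cons x xs)
  have "L \<in> (\<Union>l\<in>Poly_Mapping.keys (\<kappa> x). Poly_Mapping.keys (fmap (Cons l) (tens \<kappa> xs)))"
    using Cons.prems keys_frag_extend[of "\<lambda>l. fmap (Cons l) (tens \<kappa> xs)" "\<kappa> x"] by auto
  then obtain l where l: "l \<in> Poly_Mapping.keys (\<kappa> x)" "L \<in> Poly_Mapping.keys (fmap (Cons l) (tens \<kappa> xs))"
    by blast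
  then obtain L' where "L = l # L'" "L' \<in> Poly_Mapping.keys (tens \<kappa> xs)"
    using keys_fmap[of "Cons l" "tens \<kappa> xs"] by blast
  then show ?case using Cons.IH[of L'] l by auto
qed simp

lemma tens_cong: "(\<And>x. x \<in> set xs \<Longrightarrow> \<kappa> x = \<kappa>' x) \<Longrightarrow> tens \<kappa> xs = tens \<kappa>' xs"
  by (induction xs) simp_all

definition deg_frag :: "int poly ^ 2 ^ 2 \<Rightarrow> nat frag" where
  "deg_frag g = coeff_frag (E2_retract g)"

abbreviation (input) "E2Zt \<equiv> (E2 :: (int poly ^ 2 ^ 2) monoid)"

context mod_ring
begin

lemma BE2_subset: "bar_boundaries R E2Zt n \<subseteq> bar_cycles R E2Zt n"
  by (rule boundaries_subset_cycles) (simp_all add: E2_mult_closed E2_mult_assoc)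

end

context ext_module
begin

lemma map_t_tuples:
  assumes "length L = n" "\<And>l. l \<in> set L \<Longrightarrow> l \<ge> 1"
  shows "map t L \<in> tuples n (carrier M)"
  using assms t_closed by (auto simp: tuples_def)

text \<open>Both sides are linear in \<open>x\<close> modulo \<open>K n\<close>, so
  \<open>span\<close> reduces the claim to the elements \<open>t l\<close>, where the expansion has
  a single term. As \<open>s\<close> is linear only modulo \<open>q\<close>, expansions are compared
  after reduction.\<close>

lemma K_expand_slot:
  assumes x: "x \<in> carrier M" and "set u \<subseteq> carrier M" "set v \<subseteq> carrier M" "n = Suc (length u + length v)"
  shows "fcong q (K n) (frag_extend (\<lambda>l. frag_of (u @ t l # v)) (coeff_frag (s x))) (frag_of (u @ x # v))"
    (is "fcong q _ (?E (coeff_frag (s x))) _")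
proof -
  have mem: "u @ y # v \<in> tuples n (carrier M)" if "y \<in> carrier M" for y
    using assms that by (simp add: tuples_append_Cons)
  show ?thesis
    using x
  proof (rule span[where Q = "\<lambda>x. fcong q (K n) (?E (coeff_frag (s x))) (frag_of (u @ x # v))"])
    fix l :: nat assume "l \<ge> 1"
    then show "fcong q (K n) (?E (coeff_frag (s (t l)))) (frag_of (u @ t l # v))"
      by (simp add: s_t coeff_frag_monom K_refl)
  next
    fix y z assume yz: "y \<in> carrier M" "z \<in> carrier M"
      and IH: "fcong q (K n) (?E (coeff_frag (s y))) (frag_of (u @ y # v))"
        "fcong q (K n) (?E (coeff_frag (s z))) (frag_of (u @ z # v))"
    have "red q (coeff_frag (s (y \<oplus>\<^bsub>M\<^esub> z))) = red q (coeff_frag (s y + s z))"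
      by (simp only: red_def lookup_coeff_frag s_add[OF yz])
    then have "fcong q (K n) (?E (coeff_frag (s (y \<oplus>\<^bsub>M\<^esub> z)))) (?E (coeff_frag (s y + s z)))"
      by (intro K_cong_red red_extend_cong)
    also have "?E (coeff_frag (s y + s z)) = ?E (coeff_frag (s y)) + ?E (coeff_frag (s z))"
      by (simp add: coeff_frag_add frag_extend_add)
    also have "fcong q (K n) \<dots> (frag_of (u @ y # v) + frag_of (u @ z # v))"
      by (rule K_cong_add[OF IH])
    also have "fcong q (K n) \<dots> (frag_of (u @ (y \<oplus>\<^bsub>M\<^esub> z) # v))"
      by (rule K_sym[OF K_slot_add[OF yz mem[OF yz(1)]]])
    finally show "fcong q (K n) (?E (coeff_frag (s (y \<oplus>\<^bsub>M\<^esub> z)))) (frag_of (u @ (y \<oplus>\<^bsub>M\<^esub> z) # v))" .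
  next
    fix r y assume r: "r mod q = r" and y: "y \<in> carrier M"
      and IH: "fcong q (K n) (?E (coeff_frag (s y))) (frag_of (u @ y # v))"
    have "red q (coeff_frag (s (r \<odot>\<^bsub>M\<^esub> y))) = red q (frag_cmul r (coeff_frag (s y)))"
      using s_smult[OF r y] by (simp add: red_def)
    then have "fcong q (K n) (?E (coeff_frag (s (r \<odot>\<^bsub>M\<^esub> y)))) (?E (frag_cmul r (coeff_frag (s y))))"
      by (intro K_cong_red red_extend_cong)
    also have "?E (frag_cmul r (coeff_frag (s y))) = frag_cmul r (?E (coeff_frag (s y)))"
      by (rule frag_extend_cmul)
    also have "fcong q (K n) \<dots> (frag_cmul r (frag_of (u @ y # v)))"
      by (rule K_cong_cmul[OF IH])
    also have "fcong q (K n) \<dots> (frag_of (u @ (r \<odot>\<^bsub>M\<^esub> y) # v))"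
      by (rule K_sym[OF K_slot_smult[OF r y mem[OF y]]])
    finally show "fcong q (K n) (?E (coeff_frag (s (r \<odot>\<^bsub>M\<^esub> y)))) (frag_of (u @ (r \<odot>\<^bsub>M\<^esub> y) # v))" .
  qed
qed

lemma K_expand:
  assumes "set u \<subseteq> carrier M" "set xs \<subseteq> carrier M" "n = length u + length xs"
  shows "fcong q (K n) (frag_extend (\<lambda>L. frag_of (u @ map t L)) (tens (\<lambda>x. coeff_frag (s x)) xs)) (frag_of (u @ xs))"
  using assms
proof (induction xs arbitrary: u)
  case (Cons x xs)
  let ?T = "tens (\<lambda>x. coeff_frag (s x)) xs"
  have x: "x \<in> carrier M" "set xs \<subseteq> carrier M" using Cons.prems by auto
  have "frag_extend (\<lambda>L. frag_of (u @ map t L)) (tens (\<lambda>x. coeff_frag (s x)) (x # xs))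
      = frag_extend (\<lambda>l. frag_extend (\<lambda>L. frag_of ((u @ [t l]) @ map t L)) ?T) (coeff_frag (s x))"
    by (simp add: frag_extend_extend frag_extend_fmap)
  also have "fcong q (K n) \<dots> (frag_extend (\<lambda>l. frag_of ((u @ [t l]) @ xs)) (coeff_frag (s x)))"
  proof (rule K_cong_extend)
    fix l assume "l \<in> Poly_Mapping.keys (coeff_frag (s x))"
    then have "t l \<in> carrier M" using keys_coeff_frag[OF s_closed[OF x(1)]] t_closed by blast
    then show "fcong q (K n) (frag_extend (\<lambda>L. frag_of ((u @ [t l]) @ map t L)) ?T) (frag_of ((u @ [t l]) @ xs))"
      using Cons.prems x by (intro Cons.IH) auto
  qed
  also have "frag_extend (\<lambda>l. frag_of ((u @ [t l]) @ xs)) (coeff_frag (s x))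
      = frag_extend (\<lambda>l. frag_of (u @ t l # xs)) (coeff_frag (s x))" by simp
  also have "fcong q (K n) \<dots> (frag_of (u @ x # xs))"
    using Cons.prems x by (intro K_expand_slot) auto
  finally show ?case .
qed (simp add: K_refl)

text \<open>Both sides change sign under adjacent swaps and vanish modulo \<open>K n\<close> at
  equal neighbours, so only increasing words remain, where \<open>ssort_pont\<close>
  applies.\<close>

lemma K_sort:
  assumes "length L = n" "\<And>l. l \<in> set L \<Longrightarrow> l \<ge> 1"
  shows "fcong q (K n) (fmap (map t) (ssort (pont L))) (frag_of (map t L))"
proof -
  let ?S = "\<lambda>z. fmap (map t) (ssort z)"
  define Q where "Q L \<longleftrightarrow> (length L = n \<and> (\<forall>l\<in>set L. l \<ge> 1)
    \<longrightarrow> fcong q (K n) (?S (pont L)) (frag_of (map t L)))" for L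
  have neg: "?S (- z) = - ?S z" for z by (simp add: ssort_def frag_extend_minus fmap_minus)
  have "Q L"
  proof (rule swap_induct)
    fix u v :: "nat list" and x y assume Qxy: "Q (u @ x # y # v)"
    show "Q (u @ y # x # v)"
      unfolding Q_def
    proof
      assume L: "length (u @ y # x # v) = n \<and> (\<forall>l\<in>set (u @ y # x # v). l \<ge> 1)"
      then have "fcong q (K n) (?S (pont (u @ x # y # v))) (frag_of (map t (u @ x # y # v)))"
        using Qxy by (auto simp: Q_def)
      then have "fcong q (K n) (- ?S (pont (u @ x # y # v))) (- frag_of (map t (u @ x # y # v)))"
        by (rule K_cong_minus)
      also have "fcong q (K n) (- frag_of (map t (u @ x # y # v))) (frag_of (map t (u @ y # x # v)))"
      proof -
        have "map t u @ t y # t x # map t v \<in> tuples n (carrier M)"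
          using map_t_tuples[of "u @ y # x # v" n] L by auto
        then show ?thesis using K_sym[OF K_swap] by simp
      qed
      finally show "fcong q (K n) (?S (pont (u @ y # x # v))) (frag_of (map t (u @ y # x # v)))"
        unfolding pont_swap[of u y x v] neg .
    qed
  next
    fix u v :: "nat list" and x
    show "Q (u @ x # x # v)"
      unfolding Q_def
    proof
      assume L: "length (u @ x # x # v) = n \<and> (\<forall>l\<in>set (u @ x # x # v). l \<ge> 1)"
      have "fcong q (K n) (frag_of (map t (u @ x # x # v))) 0"
        using L by (intro K_not_distinct map_t_tuples) auto
      from K_sym[OF this] show "fcong q (K n) (?S (pont (u @ x # x # v))) (frag_of (map t (u @ x # x # v)))"
        by (simp add: pont_adjacent ssort_def)
    qed
  next
    fix L :: "nat list" assume "sorted_wrt (<) L"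
    then show "Q L" by (simp add: Q_def ssort_pont K_refl)
  qed
  then show ?thesis using assms by (auto simp: Q_def)
qed

section \<open>The inclusion and its left inverse\<close>

definition pont_sum :: "'m list frag \<Rightarrow> int poly list frag" where
  "pont_sum = frag_extend (\<lambda>xs. pont (map s xs))"

lemma map_s_tuples: "xs \<in> tuples n (carrier M) \<Longrightarrow> map s xs \<in> tuples n A0"
  using s_closed by (auto simp: tuples_def)

text \<open>The two kinds of linearity relators go to boundaries slot by slot. A repeated entry
  stays repeated under \<open>s\<close>, so the alternating relators go to zero already as
  chains.\<close>

lemma pont_sum_relator:
  assumes "z \<in> relators n"
  shows "red q (pont_sum z) \<in> BA n"
  using assms unfolding relators_def
proof (elim UnE CollectE exE conjE)
  fix u v x y
  assume z: "z = frag_of (u @ (x \<oplus>\<^bsub>M\<^esub> y) # v) - (frag_of (u @ x # v) + frag_of (u @ y # v))"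
    and xy: "x \<in> carrier M" "y \<in> carrier M" and "u @ x # v \<in> tuples n (carrier M)"
  then have uv: "set (map s u) \<subseteq> A0" "set (map s v) \<subseteq> A0" "n = Suc (length (map s u) + length (map s v))"
    using s_closed by (auto simp: tuples_append_Cons)
  have "fcong q (BA n) (pont (map s u @ s (x \<oplus>\<^bsub>M\<^esub> y) # map s v)) (pont (map s u @ (s x + s y) # map s v))"
    using xy s_closed add_closed s_add by (intro pont_slot_cong uv) auto
  also have "fcong q (BA n) \<dots> (pont (map s u @ s x # map s v) + pont (map s u @ s y # map s v))"
    using xy s_closed by (intro pont_slot_add uv) auto
  finally (fcong_trans[OF fsub_boundaries]) show ?thesis
    by (simp add: z pont_sum_def frag_extend_linear fcong_def)
next
  fix u v r x
  assume z: "z = frag_of (u @ (r \<odot>\<^bsub>M\<^esub> x) # v) - frag_cmul r (frag_of (u @ x # v))"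
    and r: "r mod q = r" and x: "x \<in> carrier M" and "u @ x # v \<in> tuples n (carrier M)"
  then have uv: "set (map s u) \<subseteq> A0" "set (map s v) \<subseteq> A0" "n = Suc (length (map s u) + length (map s v))"
    using s_closed by (auto simp: tuples_append_Cons)
  have "fcong q (BA n) (pont (map s u @ s (r \<odot>\<^bsub>M\<^esub> x) # map s v)) (pont (map s u @ Polynomial.smult r (s x) # map s v))"
    using r x s_closed smult_closed s_smult by (intro pont_slot_cong uv) auto
  also have "fcong q (BA n) \<dots> (frag_cmul r (pont (map s u @ s x # map s v)))"
    using x s_closed by (intro pont_slot_smult uv) auto
  finally (fcong_trans[OF fsub_boundaries]) show ?thesis
    by (simp add: z pont_sum_def frag_extend_linear fcong_def)
next
  fix xs assume "z = frag_of xs" "\<not> distinct xs"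
  moreover have "\<not> distinct (map s xs)" using \<open>\<not> distinct xs\<close> by (simp add: distinct_map)
  ultimately show ?thesis
    using fsub_0[OF fsub_boundaries] by (simp add: pont_sum_def pont_not_distinct)
qed

text \<open>As \<open>K n\<close> is an intersection of submodules, it is used through minimality:
  the chains sent to boundaries form a submodule containing all relators.\<close>

lemma pont_sum_K:
  assumes "red q x \<in> K n"
  shows "red q (pont_sum x) \<in> BA n"
proof -
  define N where "N = {red q x | x. red q x \<in> carrier (F n) \<and> red q (pont_sum x) \<in> BA n}"
  \<comment> \<open>The condition depends on the reduction only, although \<open>N\<close> is
    described through representatives.\<close>
  have N_iff: "red q x \<in> N \<longleftrightarrow> red q x \<in> carrier (F n) \<and> red q (pont_sum x) \<in> BA n" for x
  proof
    assume "red q x \<in> N"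
    then obtain y where y: "red q x = red q y" "red q y \<in> carrier (F n)" "red q (pont_sum y) \<in> BA n"
      unfolding N_def by (elim CollectE exE conjE) metis
    then have "red q (pont_sum x) = red q (pont_sum y)" unfolding pont_sum_def by (intro red_extend_cong)
    then show "red q x \<in> carrier (F n) \<and> red q (pont_sum x) \<in> BA n" using y by simp
  next
    assume "red q x \<in> carrier (F n) \<and> red q (pont_sum x) \<in> BA n"
    then show "red q x \<in> N" unfolding N_def by (intro CollectI exI[of _ x]) simp
  qed
  have "fsub q N"
    unfolding fsub_def
  proof (intro conjI allI impI)
    show "N \<subseteq> range (red q)" by (auto simp: N_def)
    show "(\<lambda>s. 0) \<in> N"
      using N_iff[of 0] fsub_0[OF fsub_boundaries[of "add_monoid tZt" n]] fsub_0[OF fsub_free[of "tuples n (carrier M)"]]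
      by (simp add: pont_sum_def)
    show "red q (x - y) \<in> N" if "red q x \<in> N" "red q y \<in> N" for x y
      using that fsub_diff[OF fsub_boundaries, of "pont_sum x" "add_monoid tZt" n "pont_sum y"]
        fsub_diff[OF fsub_free, of x "tuples n (carrier M)" y]
      by (simp add: N_iff) (simp add: pont_sum_def frag_extend_diff)
  qed
  moreover have "N \<subseteq> carrier (F n)" by (auto simp: N_def)
  moreover have "red q ` relators n \<subseteq> N"
    using pont_sum_relator relators_subset by (simp add: N_iff image_subset_iff)
  ultimately have "K n \<subseteq> N" by (rule K_least)
  then have "red q x \<in> N" using assms by (rule subsetD)
  then show ?thesis using N_iff[of x] by blast
qed

lemma pont_sum_cycles:
  assumes "red q x \<in> carrier (F n)"
  shows "red q (pont_sum x) \<in> bar_cycles R (add_monoid tZt) n"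
proof -
  obtain y where y: "Poly_Mapping.keys y \<subseteq> tuples n (carrier M)" "red q x = red q y"
    using red_free_rep'[OF assms] by metis
  have "red q (pont_sum y) \<in> bar_cycles R (add_monoid tZt) n"
    unfolding pont_sum_def
    by (rule fsub_extend[OF fsub_cycles], rule pont_cycles, rule map_s_tuples) (use y(1) in blast)
  then show ?thesis using red_extend_cong[OF y(2), of "\<lambda>xs. pont (map s xs)"] by (simp add: pont_sum_def)
qed

lemma pontryagin_map_cls:
  assumes "red q x \<in> carrier (F n)"
  shows "pontryagin_map R (add_monoid tZt) s n (cls q (K n) x) = cls q (BA n) (pont_sum x)"
  unfolding pontryagin_map_def
proof (rule induced_the_elem[OF fsub_free fsub_K K_subset fsub_boundaries _ pont_sum_K _ assms])
  fix x y show "pont_sum (x - y) = pont_sum x - pont_sum y"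
    by (simp add: pont_sum_def frag_extend_diff)
next
  fix x
  have "lin_ext R (\<lambda>xs. pontryagin_cycle R (map s xs)) (red q x) = red q (pont_sum x)"
    unfolding pont_sum_def by (rule lin_ext_red) (rule pontryagin_cycle_red)
  then show "homology_class R (add_monoid tZt) n (lin_ext R (\<lambda>xs. pontryagin_cycle R (map s xs)) (red q x))
      = cls q (BA n) (pont_sum x)"
    by (simp only: homology_class_red)
qed

definition incl :: "'m list frag \<Rightarrow> (int poly ^ 2 ^ 2) list frag" where
  "incl x = fmap (map upper_elem) (pont_sum x)"

definition incl_map :: "nat \<Rightarrow> ('m list \<Rightarrow> int) set \<Rightarrow> ((int poly ^ 2 ^ 2) list \<Rightarrow> int) set" where
  "incl_map n X = homology_map R E2 n upper_elem (pontryagin_map R (add_monoid tZt) s n X)"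

lemma incl_map_cls:
  assumes "red q x \<in> carrier (F n)"
  shows "incl_map n (cls q (K n) x) = cls q (bar_boundaries R E2Zt n) (incl x)"
  unfolding incl_map_def incl_def pontryagin_map_cls[OF assms]
  by (rule homology_map_cls[OF _ _ BA_subset pont_sum_cycles[OF assms]])
    (simp_all add: upper_elem_E2 upper_elem_mult)

lemma incl_cycles:
  assumes "red q x \<in> carrier (F n)"
  shows "red q (incl x) \<in> bar_cycles R E2Zt n"
  unfolding incl_def
  by (rule fmap_cycles[OF _ _ pont_sum_cycles[OF assms]]) (simp_all add: upper_elem_E2 upper_elem_mult)

lemma exterior_quot: "exterior_power R M n = fgrp q (carrier (F n)) Mod K n"
  unfolding exterior_power_def A_FactGroup_def FactGroup_def RCOSETS_def r_coset_def set_mult_def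
  by (simp add: fgrp_def)

lemma incl_map_hom: "incl_map n \<in> hom (exterior_power R M n) (group_homology R E2Zt n)"
  unfolding exterior_quot homology_quot
  by (rule quot_homI[where F = incl, OF fsub_free fsub_K K_subset fsub_cycles fsub_boundaries BE2_subset
        _ incl_cycles incl_map_cls])
    (simp_all add: incl_def pont_sum_def frag_extend_add fmap_add)

text \<open>The left inverse on chains: evaluate the cocycle of each increasing exponent sequence
  and attach to its value the word of the corresponding monomials.\<close>

definition retr :: "(int poly ^ 2 ^ 2) list frag \<Rightarrow> 'm list frag" where
  "retr z = fmap (map t) (ssort (Tens deg_frag z))"

lemma retr_linear: "retr (x + y) = retr x + retr y" "retr (x - y) = retr x - retr y" "retr 0 = 0"
  by (simp_all add: retr_def ssort_def frag_extend_linear fmap_linear)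

lemma retr_cong: "red q x = red q y \<Longrightarrow> red q (retr x) = red q (retr y)"
  unfolding retr_def ssort_def by (intro red_fmap_cong red_extend_cong)

text \<open>The coefficients of \<open>Tens deg_frag\<close> are cocycles since
  \<open>E2_retract\<close> is additive; hence the reduced value is zero as a chain and not merely
  modulo \<open>K n\<close>.\<close>

lemma retr_boundaries:
  assumes "red q z \<in> bar_boundaries R E2Zt n"
  shows "red q (retr z) = (\<lambda>s. 0)"
proof -
  obtain y where y: "Poly_Mapping.keys y \<subseteq> tuples (Suc n) (carrier E2Zt)" "red q z = red q (Bd (monoid.mult E2Zt) y)"
    using assms bar_boundaries_iff by metis
  have "Tens deg_frag (Bd (monoid.mult E2Zt) y) = 0"
    by (rule Tens_Bd[where C = "carrier E2Zt"])
      (use y(1) in \<open>auto simp: deg_frag_def E2_retract_mult coeff_frag_add tuples_def\<close>)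
  then have "retr (Bd (monoid.mult E2Zt) y) = 0" by (simp add: retr_def ssort_def)
  then show ?thesis using retr_cong[OF y(2)] by simp
qed

lemma keys_ssort: "Poly_Mapping.keys (ssort z) \<subseteq> Poly_Mapping.keys z"
  unfolding ssort_def by (rule order_trans[OF keys_frag_extend]) (auto split: if_splits)

text \<open>Exponents are positive because the retraction takes values without constant term; it is
  for these that \<open>t l\<close> is known to lie in \<open>M\<close>.\<close>

lemma retr_chains:
  assumes "red q z \<in> bar_cycles R E2Zt n"
  shows "red q (retr z) \<in> carrier (F n)"
proof -
  have "red q z \<in> carrier (bar_chains R E2Zt n)" using assms bar_cycles_iff by blast
  then obtain y where y: "Poly_Mapping.keys y \<subseteq> tuples n (carrier E2Zt)" "red q z = red q y"
    using red_free_rep' by metis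
  have "Poly_Mapping.keys (retr y) \<subseteq> tuples n (carrier M)"
  proof
    fix ms assume "ms \<in> Poly_Mapping.keys (retr y)"
    then obtain L where L: "ms = map t L" "L \<in> Poly_Mapping.keys (Tens deg_frag y)"
      unfolding retr_def using keys_fmap[of "map t" "ssort (Tens deg_frag y)"] keys_ssort[of "Tens deg_frag y"] by blast
    then obtain gs where gs: "gs \<in> Poly_Mapping.keys y" "L \<in> Poly_Mapping.keys (tens deg_frag gs)"
      using keys_frag_extend[of "tens deg_frag" y] by blast
    then have "length L = length gs" and sub: "set L \<subseteq> (\<Union>g\<in>set gs. Poly_Mapping.keys (deg_frag g))"
      using keys_tens by blast+
    moreover have "gs \<in> tuples n (carrier E2Zt)" using gs y by blast
    moreover have "l \<ge> 1" if "l \<in> set L" for l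
    proof -
      obtain g where "g \<in> set gs" "l \<in> Poly_Mapping.keys (deg_frag g)" using sub \<open>l \<in> set L\<close> by blast
      moreover have "g \<in> carrier E2Zt" using \<open>gs \<in> tuples n (carrier E2Zt)\<close> \<open>g \<in> set gs\<close> by (auto simp: tuples_def)
      ultimately show ?thesis
        using keys_coeff_frag[of "E2_retract g" l] E2_retract_coeff_0[of g] by (simp add: deg_frag_def)
    qed
    ultimately show "ms \<in> tuples n (carrier M)" unfolding L(1) by (intro map_t_tuples) (simp_all add: tuples_def)
  qed
  then show ?thesis using red_keys_free retr_cong[OF y(2)] by simp
qed

text \<open>Any integral chain representing the class may be chosen, since two of them differ by a
  boundary, on which \<open>retr\<close> reduces to zero.\<close>

definition retr_map :: "nat \<Rightarrow> ((int poly ^ 2 ^ 2) list \<Rightarrow> int) set \<Rightarrow> ('m list \<Rightarrow> int) set" where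
  "retr_map n X = cls q (K n) (retr (SOME z. X = cls q (bar_boundaries R E2Zt n) z))"

lemma retr_map_cls: "retr_map n (cls q (bar_boundaries R E2Zt n) z) = cls q (K n) (retr z)"
proof -
  define w where "w = (SOME w. cls q (bar_boundaries R E2Zt n) z = cls q (bar_boundaries R E2Zt n) w)"
  have "cls q (bar_boundaries R E2Zt n) z = cls q (bar_boundaries R E2Zt n) w"
    unfolding w_def by (rule someI[of _ z]) (rule refl)
  then have "red q (z - w) \<in> bar_boundaries R E2Zt n" by (simp only: cls_eq_iff[OF fsub_boundaries])
  then have "red q (retr z - retr w) = (\<lambda>s. 0)" using retr_boundaries retr_linear(2) by metis
  then have "cls q (K n) (retr z) = cls q (K n) (retr w)"
    using fsub_0[OF fsub_K] by (simp only: cls_eq_iff[OF fsub_K])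
  then show ?thesis by (simp add: retr_map_def w_def)
qed

lemma retr_map_hom: "retr_map n \<in> hom (group_homology R E2Zt n) (exterior_power R M n)"
  unfolding exterior_quot homology_quot
  by (rule quot_homI[where F = retr, OF fsub_cycles fsub_boundaries BE2_subset fsub_free fsub_K K_subset retr_linear(1)
        retr_chains retr_map_cls])

text \<open>The retraction undoes \<open>upper_elem\<close>, so the cocycles see the coefficients of
  the letters \<open>s x\<close> themselves. By \<open>Tens_pont\<close> the value is a combination
  of terms \<open>ssort (pont L)\<close> over exponent words \<open>L\<close>; \<open>K_sort\<close>
  and \<open>K_expand\<close> reassemble them into \<open>xs\<close>.\<close>

lemma retr_incl_of:
  assumes xs: "xs \<in> tuples n (carrier M)"
  shows "fcong q (K n) (retr (fmap (map upper_elem) (pont (map s xs)))) (frag_of xs)"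
proof -
  let ?T = "tens (\<lambda>x. coeff_frag (s x)) xs"
  have "tens deg_frag (map upper_elem (map s xs)) = ?T"
    unfolding tens_map
    by (rule tens_cong) (use xs s_closed in \<open>auto simp: deg_frag_def E2_retract_upper tuples_def\<close>)
  then have "retr (fmap (map upper_elem) (pont (map s xs))) = frag_extend (\<lambda>L. fmap (map t) (ssort (pont L))) ?T"
    by (simp add: retr_def fmap_pont Tens_pont ssort_def frag_extend_extend fmap_extend)
  also have "fcong q (K n) \<dots> (frag_extend (\<lambda>L. frag_of ([] @ map t L)) ?T)"
  proof (rule K_cong_extend)
    fix L assume "L \<in> Poly_Mapping.keys ?T"
    then have L: "length L = length xs" "set L \<subseteq> (\<Union>x\<in>set xs. Poly_Mapping.keys (coeff_frag (s x)))"
      using keys_tens by blast+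
    have "l \<ge> 1" if "l \<in> set L" for l
      using L(2) that keys_coeff_frag s_closed xs unfolding tuples_def by blast
    then show "fcong q (K n) (fmap (map t) (ssort (pont L))) (frag_of ([] @ map t L))"
      using L(1) xs by (simp add: K_sort tuples_def)
  qed
  also have "fcong q (K n) \<dots> (frag_of ([] @ xs))"
    using xs by (intro K_expand) (auto simp: tuples_def)
  finally show ?thesis by simp
qed

lemma retr_incl_map:
  assumes "X \<in> carrier (exterior_power R M n)"
  shows "retr_map n (incl_map n X) = X"
proof -
  obtain x where x: "X = cls q (K n) x" "red q x \<in> carrier (F n)"
    using assms unfolding exterior_quot carrier_quot[OF fsub_free] by (elim CollectE exE conjE) metis
  \<comment> \<open>The termwise comparison below applies to words over \<open>M\<close>, hence the
    passage to a representative supported on them.\<close>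
  obtain y where y: "Poly_Mapping.keys y \<subseteq> tuples n (carrier M)" "red q x = red q y"
    using red_free_rep'[OF x(2)] by metis
  have X: "X = cls q (K n) y" "red q y \<in> carrier (F n)"
    using x y(2) K_cong_red[OF y(2)] by (simp_all add: fcong_cls[OF fsub_K])
  have "retr (incl y) = frag_extend (\<lambda>xs. retr (fmap (map upper_elem) (pont (map s xs)))) y"
    by (simp add: retr_def incl_def pont_sum_def ssort_def fmap_extend frag_extend_extend)
  also have "fcong q (K n) \<dots> (frag_extend frag_of y)"
    by (rule K_cong_extend, rule retr_incl_of) (use y(1) in blast)
  also have "frag_extend frag_of y = y" by (rule frag_expansion[symmetric])
  finally have "cls q (K n) (retr (incl y)) = cls q (K n) y" by (simp only: fcong_cls[OF fsub_K])
  then show ?thesis unfolding X(1) incl_map_cls[OF X(2)] retr_map_cls .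
qed

lemma exterior_group: "group (exterior_power R M n)"
  unfolding exterior_quot by (rule comm_group.axioms(2)[OF quot_group[OF fsub_free fsub_K K_subset]])

lemma homology_group: "group (group_homology R E2Zt n)"
  unfolding homology_quot
  by (rule comm_group.axioms(2)[OF quot_group[OF fsub_cycles fsub_boundaries BE2_subset]])

lemmas incl_map_mon = direct_summand_retract(1)[OF exterior_group homology_group incl_map_hom retr_map_hom retr_incl_map]
  and incl_map_summand = direct_summand_retract(2)[OF exterior_group homology_group incl_map_hom retr_map_hom retr_incl_map]

lemma incl_map_wedge:
  assumes "xs \<in> tuples n (carrier M)"
  shows "incl_map n (wedge R M xs) = cls q (bar_boundaries R E2Zt n) (pont (map upper_elem (map s xs)))"
proof -
  have "wedge R M xs = cls q (K n) (frag_of xs)"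
    using assms by (simp add: wedge_def basis_elt_red coset_cls tuples_def)
  then show ?thesis
    using incl_map_cls[OF basis_elt_mem[OF assms]] by (simp add: incl_def pont_sum_def fmap_pont)
qed

end

section \<open>Integral and modular coefficients\<close>

lemma mod_ring_Z: "mod_ring \<Z> 0"
  by (intro mod_ring.intro int_is_cring mod_ring_axioms.intro) simp_all

lemma A0_span:
  fixes f :: "int poly"
  assumes "f \<in> A0" and mon: "\<And>l. l \<ge> 1 \<Longrightarrow> Q (Polynomial.monom 1 l)"
    and add: "\<And>x y. x \<in> A0 \<Longrightarrow> y \<in> A0 \<Longrightarrow> Q x \<Longrightarrow> Q y \<Longrightarrow> Q (x + y)"
    and smult: "\<And>r x. x \<in> A0 \<Longrightarrow> Q x \<Longrightarrow> Q (Polynomial.smult r x)"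
  shows "Q f"
proof -
  have "Q f" if "Polynomial.coeff f 0 = 0" "\<And>l. l > n \<Longrightarrow> Polynomial.coeff f l = 0" for n f
    using that
  proof (induction n arbitrary: f)
    case 0
    then have "Polynomial.coeff f l = 0" for l by (cases l) auto
    then have "f = Polynomial.smult 0 (Polynomial.monom 1 1)" by (simp add: poly_eq_iff)
    then show ?case using smult[OF _ mon[of 1], of 0] by simp
  next
    case (Suc n)
    define c where "c = Polynomial.coeff f (Suc n)"
    have "Q (f - Polynomial.monom c (Suc n))"
    proof (rule Suc.IH)
      fix l assume "n < l"
      then show "Polynomial.coeff (f - Polynomial.monom c (Suc n)) l = 0"
        using Suc.prems(2)[of l] by (cases "l = Suc n") (auto simp: c_def)
    qed (simp add: Suc.prems(1))
    moreover have "Q (Polynomial.smult c (Polynomial.monom 1 (Suc n)))" by (intro smult mon) simp_all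
    ultimately have "Q ((f - Polynomial.monom c (Suc n)) + Polynomial.smult c (Polynomial.monom 1 (Suc n)))"
      using Suc.prems(1) by (intro add) simp_all
    then show ?case by (simp add: smult_monom)
  qed
  from this[of f "Polynomial.degree f"] show ?thesis using assms(1) by (simp add: coeff_eq_0)
qed

lemma ext_module_Z: "ext_module \<Z> 0 tZt (\<lambda>f. f) (\<lambda>l. Polynomial.monom 1 l)"
proof (intro ext_module.intro mod_ring_Z ext_module_axioms.intro)
  show "Q x" if "x \<in> carrier tZt" "\<And>l. l \<ge> 1 \<Longrightarrow> Q (Polynomial.monom 1 l)"
    "\<And>x y. x \<in> carrier tZt \<Longrightarrow> y \<in> carrier tZt \<Longrightarrow> Q x \<Longrightarrow> Q y \<Longrightarrow> Q (x \<oplus>\<^bsub>tZt\<^esub> y)"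
    "\<And>r x. r mod 0 = r \<Longrightarrow> x \<in> carrier tZt \<Longrightarrow> Q x \<Longrightarrow> Q (r \<odot>\<^bsub>tZt\<^esub> x)" for x Q
    by (rule A0_span[of x Q]) (use that in \<open>simp_all add: tZt_def\<close>)
qed (simp_all add: tZt_def)

context
  fixes p :: nat
  assumes p: "prime p"
begin

lemma Fp_simps [simp]: "\<zero>\<^bsub>Fp p\<^esub> = 0" "\<one>\<^bsub>Fp p\<^esub> = 1" "a \<oplus>\<^bsub>Fp p\<^esub> b = (a + b) mod int p"
  "a \<otimes>\<^bsub>Fp p\<^esub> b = (a * b) mod int p"
  by (simp_all add: residue_ring_def)

lemma Fp_carrier: "carrier (Fp p) = {a. a mod int p = a}"
proof -
  have "int p > 0" using p prime_gt_0_nat by simp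
  then have "a mod int p = a \<longleftrightarrow> 0 \<le> a \<and> a < int p" for a
    unfolding zmod_trivial_iff by linarith
  then have "{a. a mod int p = a} = {0..int p - 1}" by (simp add: set_eq_iff)
  then show ?thesis by (simp add: residue_ring_def)
qed

lemma mod_ring_Fp: "mod_ring (Fp p) (int p)"
proof -
  have p1: "int p > 1" using p prime_gt_1_nat by simp
  have "cring (Fp p)" by (rule residues.cring[OF residues.intro[OF p1]])
  moreover have "Fp p = \<lparr>carrier = {a. a mod int p = a}, monoid.mult = (\<lambda>x y. (x * y) mod int p), one = 1,
      zero = 0, add = (\<lambda>x y. (x + y) mod int p)\<rparr>"
    using Fp_carrier by (simp add: residue_ring_def)
  moreover have "1 mod int p = 1" using p1 by simp
  ultimately show ?thesis by (intro mod_ring.intro mod_ring_axioms.intro)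
qed

lemma up_iff: "f \<in> up (Fp p) \<longleftrightarrow> (\<forall>l. f l mod int p = f l) \<and> (\<exists>n. \<forall>m>n. f m = 0)"
  by (auto simp: up_def Fp_carrier bound_def)

lemma UP_simps [simp]:
  "f \<in> up (Fp p) \<Longrightarrow> UnivPoly.coeff (UP (Fp p)) f = f"
  "f \<in> up (Fp p) \<Longrightarrow> g \<in> up (Fp p) \<Longrightarrow> f \<oplus>\<^bsub>UP (Fp p)\<^esub> g = (\<lambda>l. (f l + g l) mod int p)"
  "r mod int p = r \<Longrightarrow> f \<in> up (Fp p) \<Longrightarrow> r \<odot>\<^bsub>UP (Fp p)\<^esub> f = (\<lambda>l. (r * f l) mod int p)"
  "carrier (UP (Fp p)) = up (Fp p)"
  by (simp_all add: UP_def Fp_carrier)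

lemma tFpt_simps [simp]:
  "f \<oplus>\<^bsub>tFpt p\<^esub> g = f \<oplus>\<^bsub>UP (Fp p)\<^esub> g" "r \<odot>\<^bsub>tFpt p\<^esub> f = r \<odot>\<^bsub>UP (Fp p)\<^esub> f"
  by (simp_all add: tFpt_def)

lemma tFpt_carrier: "f \<in> carrier (tFpt p) \<longleftrightarrow> f \<in> up (Fp p) \<and> f 0 = 0"
  by (auto simp: tFpt_def)

lemma UP_monom: "UnivPoly.monom (UP (Fp p)) \<one>\<^bsub>Fp p\<^esub> l = (\<lambda>i. if i = l then 1 else 0)"
  using prime_gt_1_nat[OF p] by (simp add: UP_def Fp_carrier fun_eq_iff)

lemma coeff_lift_poly:
  assumes f: "f \<in> up (Fp p)"
  shows "Polynomial.coeff (lift_poly p f) = f"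
proof -
  obtain n where n: "\<forall>m>n. f m = 0" using f up_iff by blast
  have "{l. f l \<noteq> 0} \<subseteq> {..n}" using n by (auto simp flip: not_less)
  then have "finite {l. f l \<noteq> 0}" by (rule finite_subset) simp
  then have "Polynomial.coeff (Abs_poly f) = f" by (intro Abs_poly_inverse) (simp add: eventually_cofinite)
  then show ?thesis unfolding lift_poly_def UP_simps(1)[OF f] .
qed

lemma add_up: "f \<in> up (Fp p) \<Longrightarrow> g \<in> up (Fp p) \<Longrightarrow> (\<lambda>l. (f l + g l) mod int p) \<in> up (Fp p)"
proof -
  assume "f \<in> up (Fp p)" "g \<in> up (Fp p)"
  then obtain m n where "\<forall>k>m. f k = 0" "\<forall>k>n. g k = 0" unfolding up_iff by blast
  then have "\<forall>k>max m n. (f k + g k) mod int p = 0" by simp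
  then show ?thesis unfolding up_iff by (intro conjI exI[of _ "max m n"]) simp_all
qed

lemma smult_up: "f \<in> up (Fp p) \<Longrightarrow> (\<lambda>l. (r * f l) mod int p) \<in> up (Fp p)"
proof -
  assume "f \<in> up (Fp p)"
  then obtain n where "\<forall>m>n. f m = 0" unfolding up_iff by blast
  then show ?thesis unfolding up_iff by (intro conjI exI[of _ n]) simp_all
qed

lemma monom_up: "(\<lambda>i. if i = l then 1 else 0) \<in> up (Fp p)"
  using prime_gt_1_nat[OF p] unfolding up_iff by (intro conjI exI[of _ l]) auto

lemma tFpt_span:
  assumes "f \<in> carrier (tFpt p)" and mon: "\<And>l. l \<ge> 1 \<Longrightarrow> Q (\<lambda>i. if i = l then 1 else 0)"
    and add: "\<And>x y. x \<in> carrier (tFpt p) \<Longrightarrow> y \<in> carrier (tFpt p) \<Longrightarrow> Q x \<Longrightarrow> Q y \<Longrightarrow> Q (x \<oplus>\<^bsub>tFpt p\<^esub> y)"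
    and smult: "\<And>r x. r mod int p = r \<Longrightarrow> x \<in> carrier (tFpt p) \<Longrightarrow> Q x \<Longrightarrow> Q (r \<odot>\<^bsub>tFpt p\<^esub> x)"
  shows "Q f"
proof -
  have mon_c: "(\<lambda>i. if i = l then 1 else 0) \<in> carrier (tFpt p)" if "l \<ge> 1" for l
    using monom_up that by (simp add: tFpt_carrier)
  have "Q f" if "f \<in> carrier (tFpt p)" "\<And>l. l > n \<Longrightarrow> f l = 0" for n f
    using that
  proof (induction n arbitrary: f)
    case 0
    then have "f l = 0" for l by (cases l) (auto simp: tFpt_carrier)
    then have "f = 0 \<odot>\<^bsub>tFpt p\<^esub> (\<lambda>i. if i = 1 then 1 else 0)" by (simp add: monom_up fun_eq_iff)
    then show ?case using smult[OF _ mon_c mon, of 0 1] by simp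
  next
    case (Suc n)
    \<comment> \<open>The top coefficient is cleared by a function update rather than by
      subtraction, which keeps all values reduced.\<close>
    let ?g = "f(Suc n := 0)" and ?m = "\<lambda>i. if i = Suc n then 1 else (0::int)"
    have f: "\<And>l. f l mod int p = f l" "f 0 = 0" using Suc.prems(1) by (simp_all add: tFpt_carrier up_iff)
    have g: "?g \<in> carrier (tFpt p)"
      using f Suc.prems(2) unfolding tFpt_carrier up_iff by (auto intro!: exI[of _ "Suc n"])
    have 1: "Q ?g" using Suc.prems(2) by (intro Suc.IH[OF g]) auto
    have 2: "Q (f (Suc n) \<odot>\<^bsub>tFpt p\<^esub> ?m)"
      by (rule smult[OF f(1) mon_c mon]) simp_all
    have mc: "f (Suc n) \<odot>\<^bsub>tFpt p\<^esub> ?m = (\<lambda>l. (f (Suc n) * ?m l) mod int p)"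
      using f(1) monom_up by simp
    have m: "f (Suc n) \<odot>\<^bsub>tFpt p\<^esub> ?m \<in> carrier (tFpt p)"
      unfolding mc tFpt_carrier using smult_up[OF monom_up] by simp
    have "f = ?g \<oplus>\<^bsub>tFpt p\<^esub> (f (Suc n) \<odot>\<^bsub>tFpt p\<^esub> ?m)"
      using g m f(1) unfolding mc by (auto simp: tFpt_carrier)
    then show ?case using add[OF g m 1 2] by simp
  qed
  moreover obtain n where "\<forall>l>n. f l = 0" using assms(1) unfolding tFpt_carrier up_iff by blast
  ultimately show ?thesis using assms(1) by blast
qed

lemma ext_module_Fp:
  "ext_module (Fp p) (int p) (tFpt p) (lift_poly p) (\<lambda>l. UnivPoly.monom (UP (Fp p)) \<one>\<^bsub>Fp p\<^esub> l)"
  unfolding UP_monom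
proof (intro ext_module.intro mod_ring_Fp ext_module_axioms.intro)
  show "Q x" if "x \<in> carrier (tFpt p)" "\<And>l. l \<ge> 1 \<Longrightarrow> Q (\<lambda>i. if i = l then 1 else 0)"
    "\<And>x y. x \<in> carrier (tFpt p) \<Longrightarrow> y \<in> carrier (tFpt p) \<Longrightarrow> Q x \<Longrightarrow> Q y \<Longrightarrow> Q (x \<oplus>\<^bsub>tFpt p\<^esub> y)"
    "\<And>r x. r mod int p = r \<Longrightarrow> x \<in> carrier (tFpt p) \<Longrightarrow> Q x \<Longrightarrow> Q (r \<odot>\<^bsub>tFpt p\<^esub> x)" for x Q
    using that by (rule tFpt_span)
  show "lift_poly p (\<lambda>i. if i = l then 1 else 0) = Polynomial.monom 1 l" if "l \<ge> 1" for l
    by (rule poly_eqI) (simp add: coeff_lift_poly[OF monom_up])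
qed (simp_all add: tFpt_carrier coeff_lift_poly add_up smult_up monom_up)

end

section \<open>Reduction of coefficients\<close>

lemma comp_red_0: "(\<lambda>a. a mod q) \<circ> red 0 x = red q x"
  by (auto simp: red_def)

text \<open>Equal reductions modulo 0 mean equal chains, so the same integral bounding chain serves
  modulo \<open>p\<close>.\<close>

lemma boundaries_mod:
  assumes "prime p" and x: "red 0 x \<in> bar_boundaries \<Z> G n"
  shows "red (int p) x \<in> bar_boundaries (Fp p) G n"
proof -
  obtain y where y: "Poly_Mapping.keys y \<subseteq> tuples (Suc n) (carrier G)" "red 0 x = red 0 (Bd (monoid.mult G) y)"
    using x mod_ring.bar_boundaries_iff[OF mod_ring_Z] by metis
  have "x = Bd (monoid.mult G) y" using iffD1[OF red_eq_iff y(2)] by simp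
  then show ?thesis using y(1) mod_ring.bar_boundaries_iff[OF mod_ring_Fp[OF assms(1)]] by metis
qed

theorem proposition3p4:
  fixes i :: nat
  shows "wedge_Z_incl i \<in> mon (exterior_power \<Z> tZt i)
                            (group_homology \<Z> (E2 :: (int poly ^ 2 ^ 2) monoid) i)
    \<and> direct_summand (wedge_Z_incl i ` carrier (exterior_power \<Z> tZt i))
                     (group_homology \<Z> (E2 :: (int poly ^ 2 ^ 2) monoid) i)
    \<and> (\<forall>p::nat. prime p \<longrightarrow>
         wedge_Fp_incl p i \<in> mon (exterior_power (Fp p) (tFpt p) i)
                               (group_homology (Fp p) (E2 :: (int poly ^ 2 ^ 2) monoid) i)
         \<and> (\<forall>ls :: nat list. length ls = i \<and> (\<forall>l\<in>set ls. l \<ge> 1) \<longrightarrow>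
              coeff_map (Fp p) (E2 :: (int poly ^ 2 ^ 2) monoid) i (\<lambda>a. a mod int p)
                (wedge_Z_incl i (wedge \<Z> tZt (map (\<lambda>l. Polynomial.monom 1 l) ls)))
              = wedge_Fp_incl p i
                  (wedge (Fp p) (tFpt p)
                     (map (\<lambda>l. UnivPoly.monom (UP (Fp p)) \<one>\<^bsub>Fp p\<^esub> l) ls))))"
proof -
  interpret Z: ext_module \<Z> 0 tZt "\<lambda>f. f" "\<lambda>l. Polynomial.monom 1 l" by (rule ext_module_Z)
  have Z: "wedge_Z_incl i = Z.incl_map i"
    by (rule ext) (simp only: wedge_Z_incl_def Z.incl_map_def)
  have mon_Fp: "wedge_Fp_incl p i \<in> mon (exterior_power (Fp p) (tFpt p) i) (group_homology (Fp p) E2Zt i)"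
    and reduction: "\<And>ls. length ls = i \<and> (\<forall>l\<in>set ls. l \<ge> 1) \<Longrightarrow> coeff_map (Fp p) E2Zt i (\<lambda>a. a mod int p)
            (wedge_Z_incl i (wedge \<Z> tZt (map (\<lambda>l. Polynomial.monom 1 l) ls)))
          = wedge_Fp_incl p i
              (wedge (Fp p) (tFpt p) (map (\<lambda>l. UnivPoly.monom (UP (Fp p)) \<one>\<^bsub>Fp p\<^esub> l) ls))"
    if p: "prime p" for p
  proof -
    interpret P: ext_module "Fp p" "int p" "tFpt p" "lift_poly p" "\<lambda>l. UnivPoly.monom (UP (Fp p)) \<one>\<^bsub>Fp p\<^esub> l"
      by (rule ext_module_Fp[OF p])
    have P: "wedge_Fp_incl p i = P.incl_map i"
      by (rule ext) (simp only: wedge_Fp_incl_def P.incl_map_def)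
    show "wedge_Fp_incl p i \<in> mon (exterior_power (Fp p) (tFpt p) i) (group_homology (Fp p) E2Zt i)"
      unfolding P by (rule P.incl_map_mon)
    fix ls :: "nat list" assume "length ls = i \<and> (\<forall>l\<in>set ls. l \<ge> 1)"
    then have ls: "length ls = i" "\<And>l. l \<in> set ls \<Longrightarrow> l \<ge> 1" by blast+
    let ?xs = "map (\<lambda>l. Polynomial.monom 1 l :: int poly) ls"
    let ?ys = "map (\<lambda>l. UnivPoly.monom (UP (Fp p)) \<one>\<^bsub>Fp p\<^esub> l) ls"
    \<comment> \<open>One integral chain represents both wedges: directly over the integers, and
      modulo \<open>p\<close> because lifted monomials are again monomials. The compatibility of
      coefficients then becomes \<open>induced_the_elem\<close> for the identity on integral
      chains.\<close>
    let ?z = "pont (map upper_elem ?xs)"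
    have memZ: "?xs \<in> tuples i (carrier tZt)" by (rule Z.map_t_tuples[OF ls])
    have memP: "?ys \<in> tuples i (carrier (tFpt p))" by (rule P.map_t_tuples[OF ls])
    have wZ: "wedge_Z_incl i (wedge \<Z> tZt ?xs) = cls 0 (bar_boundaries \<Z> E2Zt i) ?z"
      unfolding Z Z.incl_map_wedge[OF memZ] by (simp only: list.map_ident)
    have lift: "map (lift_poly p) ?ys = ?xs"
      unfolding map_map o_def by (rule map_cong[OF refl], rule P.s_t, rule ls(2))
    have wP: "wedge_Fp_incl p i (wedge (Fp p) (tFpt p) ?ys) = cls (int p) (bar_boundaries (Fp p) E2Zt i) ?z"
      unfolding P P.incl_map_wedge[OF memP] lift ..
    have z: "red 0 ?z \<in> bar_cycles \<Z> E2Zt i"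
      using Z.incl_cycles[OF Z.basis_elt_mem[OF memZ]]
      unfolding Z.incl_def Z.pont_sum_def frag_extend_of fmap_pont list.map_ident .
    have "coeff_map (Fp p) E2Zt i (\<lambda>a. a mod int p) (cls 0 (bar_boundaries \<Z> E2Zt i) ?z)
        = cls (int p) (bar_boundaries (Fp p) E2Zt i) ?z"
      unfolding coeff_map_def
      by (rule induced_the_elem[where F = "\<lambda>x. x", OF Z.fsub_cycles Z.fsub_boundaries Z.BE2_subset
            P.fsub_boundaries refl boundaries_mod[OF p] _ z]) (simp_all only: comp_red_0 P.homology_class_red)
    then show "coeff_map (Fp p) E2Zt i (\<lambda>a. a mod int p) (wedge_Z_incl i (wedge \<Z> tZt ?xs))
        = wedge_Fp_incl p i (wedge (Fp p) (tFpt p) ?ys)"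
      unfolding wZ wP .
  qed
  show ?thesis
  proof (intro conjI allI impI)
    show "wedge_Z_incl i \<in> mon (exterior_power \<Z> tZt i) (group_homology \<Z> E2Zt i)"
      unfolding Z by (rule Z.incl_map_mon)
    show "direct_summand (wedge_Z_incl i ` carrier (exterior_power \<Z> tZt i)) (group_homology \<Z> E2Zt i)"
      unfolding Z by (rule Z.incl_map_summand)
  qed (rule mon_Fp reduction; assumption)+
qed

end
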